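(* Suppose that the cost function $c$ is bounded from above and that $t\mapsto c(\omega_{\cdot\wedge t},t)$ is upper semicontinuous for $\mathbb{W}$-a.e. $\omega\in C_0(\mathbb{R}_+)$, where $\mathbb{W}$ denotes the Wiener measure. Then $\mu\mapsto v(\mu)$ is upper semicontinuous on $\mathcal{P}$ in the topology induced by $\mathcal{W}_1$, the first Wasserstein metric.
   Context: $\mathcal{P}$ is the set of probability measures on $(0,\infty)$ with finite first moment. $C_0(\mathbb{R}_+)$ is the space of continuous functions $\mathbb{R}_+\to\mathbb{R}$ starting at $0$, with the topology of uniform convergence on compacts. Let $(\Omega,\mathcal{G},(\mathcal{G}_t)_{t\ge0},\mathbb{P})$ be a filtered probability space supporting a Brownian motion $(W_t)_{t\ge0}$ and an independent $\mathcal{G}_0$-measurable random variable $U$ uniformly distributed on $[0,1]$. For $\mu\in\mathcal{P}$, $\mathcal{T}(\mu)$ is the set of $(\mathcal{G}_t)$-stopping times with law $\mu$, and $$v(\mu)=\sup_{\tau\in\mathcal{T}(\mu)}\mathbb{E}\left[c(W_\cdot,\tau)\right],$$ where $c:C_0(\mathbb{R}_+)\times\mathbb{R}_+\to\mathbb{R}$ is a given measurable function with $c(\omega,t)=c(\omega_{\cdot\wedge t},t)$. Standing assumptions: $\mathbb{E}[c(W_\cdot,\tau)]$ is well defined and $<\infty$ for all $\tau\in\bigcup_{\mu\in\mathcal{P}}\mathcal{T}(\mu)$, and for every $\mu\in\mathcal{P}$ there exists $\tau\in\mathcal{T}(\mu)$ with $\mathbb{E}[c(W_\cdot,\tau)]>-\infty$;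 thus $v:\mathcal{P}\to(-\infty,\infty]$. *)

theory Defs
  imports "HOL-Probability.Probability"
begin

section \<open>Upper semicontinuity\<close>

definition usc_on :: "'a topology \<Rightarrow> ('a \<Rightarrow> ereal) \<Rightarrow> bool" where
  "usc_on X f \<longleftrightarrow>
     (\<forall>x\<in>topspace X. \<forall>a>f x. \<exists>U. openin X U \<and> x \<in> U \<and> (\<forall>y\<in>U. f y < a))"

section \<open>Path space\<close>

text \<open>A function on the half-line of nonnegative reals is represented by its extensional
  representative, i.e. it takes the value \<^term>\<open>undefined\<close> at negative arguments.\<close>

definition C0 :: "(real \<Rightarrow> real) set" where
  "C0 = {w \<in> extensional {0..}. continuous_on {0..} w \<and> w 0 = 0}"

definition C0_open :: "(real \<Rightarrow> real) set \<Rightarrow> bool" where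
  "C0_open U \<longleftrightarrow> U \<subseteq> C0 \<and>
     (\<forall>w\<in>U. \<exists>T\<ge>0. \<exists>e>0. \<forall>w'\<in>C0. (\<forall>t\<in>{0..T}. \<bar>w' t - w t\<bar> < e) \<longrightarrow> w' \<in> U)"

lemma istopology_C0_open: "istopology C0_open"
proof (unfold istopology_def, intro conjI allI impI)
  fix S T assume S: "C0_open S" and T: "C0_open T"
  show "C0_open (S \<inter> T)"
    unfolding C0_open_def
  proof (intro conjI ballI)
    show "S \<inter> T \<subseteq> C0" using S by (auto simp: C0_open_def)
    fix w assume w: "w \<in> S \<inter> T"
    from S w obtain A a where a: "A \<ge> 0" "a > 0"
      "\<forall>w'\<in>C0. (\<forall>t\<in>{0..A}. \<bar>w' t - w t\<bar> < a) \<longrightarrow> w' \<in> S"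
      unfolding C0_open_def by blast
    from T w obtain B b where b: "B \<ge> 0" "b > 0"
      "\<forall>w'\<in>C0. (\<forall>t\<in>{0..B}. \<bar>w' t - w t\<bar> < b) \<longrightarrow> w' \<in> T"
      unfolding C0_open_def by blast
    show "\<exists>T'\<ge>0. \<exists>e>0. \<forall>w'\<in>C0. (\<forall>t\<in>{0..T'}. \<bar>w' t - w t\<bar> < e) \<longrightarrow> w' \<in> S \<inter> T"
    proof (rule exI[of _ "max A B"], rule conjI, rule_tac [2] exI[of _ "min a b"],
        rule_tac [2] conjI, rule_tac [3] ballI, rule_tac [3] impI)
      show "max A B \<ge> 0" "min a b > 0" using a b by auto
      fix w' assume w': "w' \<in> C0" "\<forall>t\<in>{0..max A B}. \<bar>w' t - w t\<bar> < min a b"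
      then have "\<forall>t\<in>{0..A}. \<bar>w' t - w t\<bar> < a" "\<forall>t\<in>{0..B}. \<bar>w' t - w t\<bar> < b"
        by auto
      then show "w' \<in> S \<inter> T" using a(3) b(3) w'(1) by blast
    qed
  qed
next
  fix K assume "\<forall>U\<in>K. C0_open U"
  then show "C0_open (\<Union>K)"
    unfolding C0_open_def by (intro conjI ballI) (blast, (erule UnionE, metis UnionI))
qed

definition C0_topology :: "(real \<Rightarrow> real) topology" where
  "C0_topology = topology C0_open"

lemma openin_C0_topology: "openin C0_topology = C0_open"
  by (simp add: C0_topology_def istopology_C0_open)

definition C0_borel :: "(real \<Rightarrow> real) measure" where
  "C0_borel = sigma C0 {U. openin C0_topology U}"

definition stopped :: "real \<Rightarrow> (real \<Rightarrow> real) \<Rightarrow> real \<Rightarrow> real" where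
  "stopped t w = (\<lambda>s\<in>{0..}. w (min s t))"

definition path_of :: "(real \<Rightarrow> 'a \<Rightarrow> real) \<Rightarrow> 'a \<Rightarrow> real \<Rightarrow> real" where
  "path_of W x = (\<lambda>t\<in>{0..}. W t x)"

lemma path_of_in_C0:
  assumes "continuous_on {0..} (\<lambda>t. W t x)" "W 0 x = 0"
  shows "path_of W x \<in> C0"
proof -
  have "continuous_on {0..} (path_of W x)"
    using assms(1) by (rule continuous_on_eq) (simp add: path_of_def)
  then show ?thesis
    using assms(2) by (simp add: C0_def path_of_def)
qed

lemma stopped_in_C0:
  assumes "w \<in> C0" "t \<ge> 0"
  shows "stopped t w \<in> C0"
proof -
  have "continuous_on {0..} (\<lambda>s. w (min s t))"
    using assms by (intro continuous_on_compose2[of "{0..}" w "{0..}" "\<lambda>s. min s t"] continuous_on_min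
        continuous_on_id continuous_on_const) (auto simp: C0_def)
  then have "continuous_on {0..} (stopped t w)"
    by (rule continuous_on_eq) (simp add: stopped_def)
  then show ?thesis
    using assms by (simp add: C0_def stopped_def)
qed

section \<open>Brownian motion relative to a filtration\<close>

text \<open>Filtrations are indexed by \<^typ>\<open>ennreal\<close>, so that the stopping times of the library are
  exactly the usual ones with values in the extended half-line. The \<open>\<sigma>\<close>-algebra at index
  infinity plays no role: it imposes no condition on a stopping time. The usual conditions are
  not assumed.\<close>

definition filtered_prob_space :: "'a measure \<Rightarrow> (ennreal \<Rightarrow> 'a measure) \<Rightarrow> bool" where
  "filtered_prob_space M G \<longleftrightarrow>
     prob_space M \<and> filtration (space M) G \<and> (\<forall>t. subalgebra M (G t))"

definition brownian_motion ::
    "'a measure \<Rightarrow> (ennreal \<Rightarrow> 'a measure) \<Rightarrow> (real \<Rightarrow> 'a \<Rightarrow> real) \<Rightarrow> bool" where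
  "brownian_motion M G W \<longleftrightarrow>
     (\<forall>x\<in>space M. W 0 x = 0 \<and> continuous_on {0..} (\<lambda>t. W t x)) \<and>
     (\<forall>t\<ge>0. W t \<in> borel_measurable (G (ennreal t))) \<and>
     (\<forall>s t. 0 \<le> s \<and> s < t \<longrightarrow>
        distributed M lborel (\<lambda>x. W t x - W s x) (\<lambda>y. ennreal (normal_density 0 (sqrt (t - s)) y)) \<and>
        prob_space.indep_set M (sets (G (ennreal s)))
          (sets (vimage_algebra (space M) (\<lambda>x. W t x - W s x) borel)))"

text \<open>The law on the path space of a Brownian motion, whichever one is chosen.\<close>

definition wiener_measure :: "'a measure \<Rightarrow> (real \<Rightarrow> 'a \<Rightarrow> real) \<Rightarrow> (real \<Rightarrow> real) measure" where
  "wiener_measure M W = distr M C0_borel (path_of W)"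

text \<open>The constant \<open>prob_space.indep_var\<close> only covers variables with values in a common type,
  hence independence of \<open>U\<close> and \<open>W\<close> is stated for the generated \<open>\<sigma>\<close>-algebras.\<close>

definition uniform_independent ::
    "'a measure \<Rightarrow> (ennreal \<Rightarrow> 'a measure) \<Rightarrow> (real \<Rightarrow> 'a \<Rightarrow> real) \<Rightarrow> ('a \<Rightarrow> real) \<Rightarrow> bool" where
  "uniform_independent M G W U \<longleftrightarrow>
     U \<in> borel_measurable (G 0) \<and>
     distr M borel U = uniform_measure lborel {0..1} \<and>
     prob_space.indep_set M (sets (vimage_algebra (space M) U borel))
       (sets (vimage_algebra (space M) (path_of W) C0_borel))"

section \<open>Probability measures on the open half-line and the first Wasserstein distance\<close>

text \<open>Probability measures on the open half-line are identified with Borel probability measures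
  on the real line that are concentrated there.\<close>

definition P1 :: "real measure set" where
  "P1 = {\<mu>. prob_space \<mu> \<and> sets \<mu> = sets borel \<and> (AE x in \<mu>. 0 < x) \<and> integrable \<mu> (\<lambda>x. x)}"

definition couplings :: "real measure \<Rightarrow> real measure \<Rightarrow> (real \<times> real) measure set" where
  "couplings \<mu> \<nu> =
     {\<pi>. sets \<pi> = sets (borel \<Otimes>\<^sub>M borel) \<and> distr \<pi> borel fst = \<mu> \<and> distr \<pi> borel snd = \<nu>}"

definition W1 :: "real measure \<Rightarrow> real measure \<Rightarrow> ennreal" where
  "W1 \<mu> \<nu> = (INF \<pi>\<in>couplings \<mu> \<nu>. \<integral>\<^sup>+p. ennreal \<bar>fst p - snd p\<bar> \<partial>\<pi>)"

definition W1_open :: "real measure set \<Rightarrow> bool" where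
  "W1_open U \<longleftrightarrow> U \<subseteq> P1 \<and> (\<forall>\<mu>\<in>U. \<exists>e>0. \<forall>\<nu>\<in>P1. W1 \<mu> \<nu> < ennreal e \<longrightarrow> \<nu> \<in> U)"

lemma istopology_W1_open: "istopology W1_open"
proof (unfold istopology_def, intro conjI allI impI)
  fix S T assume S: "W1_open S" and T: "W1_open T"
  show "W1_open (S \<inter> T)"
    unfolding W1_open_def
  proof (intro conjI ballI)
    show "S \<inter> T \<subseteq> P1" using S by (auto simp: W1_open_def)
    fix \<mu> assume \<mu>: "\<mu> \<in> S \<inter> T"
    from S \<mu> obtain a where a: "a > 0" "\<forall>\<nu>\<in>P1. W1 \<mu> \<nu> < ennreal a \<longrightarrow> \<nu> \<in> S"
      unfolding W1_open_def by blast
    from T \<mu> obtain b where b: "b > 0" "\<forall>\<nu>\<in>P1. W1 \<mu> \<nu> < ennreal b \<longrightarrow> \<nu> \<in> T"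
      unfolding W1_open_def by blast
    show "\<exists>e>0. \<forall>\<nu>\<in>P1. W1 \<mu> \<nu> < ennreal e \<longrightarrow> \<nu> \<in> S \<inter> T"
    proof (intro exI[of _ "min a b"] conjI ballI impI)
      show "min a b > 0" using a b by simp
      fix \<nu> assume \<nu>: "\<nu> \<in> P1" "W1 \<mu> \<nu> < ennreal (min a b)"
      have "ennreal (min a b) \<le> ennreal a" "ennreal (min a b) \<le> ennreal b"
        by (rule ennreal_leI, simp)+
      then have "W1 \<mu> \<nu> < ennreal a" "W1 \<mu> \<nu> < ennreal b"
        using \<nu>(2) less_le_trans by blast+
      then show "\<nu> \<in> S \<inter> T" using a(2) b(2) \<nu>(1) by blast
    qed
  qed
next
  fix K assume "\<forall>U\<in>K. W1_open U"
  then show "W1_open (\<Union>K)"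
    unfolding W1_open_def by (intro conjI ballI) (blast, (erule UnionE, metis UnionI))
qed

definition W1_topology :: "real measure topology" where
  "W1_topology = topology W1_open"

lemma openin_W1_topology: "openin W1_topology = W1_open"
  by (simp add: W1_topology_def istopology_W1_open)

lemma topspace_W1_topology: "topspace W1_topology = P1"
proof -
  have "W1_open P1" by (auto simp: W1_open_def intro: exI[of _ 1])
  then show ?thesis
    by (metis W1_open_def openin_W1_topology openin_subset openin_topspace subset_antisym)
qed

section \<open>Optimal stopping with a distribution constraint\<close>

text \<open>Stopping times take values in the extended half-line. One with law in \<^term>\<open>P1\<close> is
  finite almost surely, so the convention \<open>enn2real \<infinity> = 0\<close> matters only on a null set.
  Finiteness everywhere is not required: the filtration need not be complete, and then an almost
  surely finite stopping time may have no modification that is an everywhere finite one.\<close>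

definition stopping_times ::
    "'a measure \<Rightarrow> (ennreal \<Rightarrow> 'a measure) \<Rightarrow> real measure \<Rightarrow> ('a \<Rightarrow> ennreal) set" where
  "stopping_times M G \<mu> =
     {\<tau>. stopping_time G \<tau> \<and> (AE x in M. \<tau> x < \<infinity>) \<and> distr M borel (\<lambda>x. enn2real (\<tau> x)) = \<mu>}"

text \<open>Expectations with values in the extended reals. The coercion \<^const>\<open>ennreal\<close> truncates
  negative numbers to 0, so the two integrals are those of the positive and negative parts.\<close>

definition expectation_defined :: "'a measure \<Rightarrow> ('a \<Rightarrow> real) \<Rightarrow> bool" where
  "expectation_defined M f \<longleftrightarrow>
     f \<in> borel_measurable M \<and> ((\<integral>\<^sup>+x. ennreal (f x) \<partial>M) < \<infinity> \<or> (\<integral>\<^sup>+x. ennreal (- f x) \<partial>M) < \<infinity>)"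

definition ext_expectation :: "'a measure \<Rightarrow> ('a \<Rightarrow> real) \<Rightarrow> ereal" where
  "ext_expectation M f =
     enn2ereal (\<integral>\<^sup>+x. ennreal (f x) \<partial>M) - enn2ereal (\<integral>\<^sup>+x. ennreal (- f x) \<partial>M)"

definition cost ::
    "(real \<Rightarrow> 'a \<Rightarrow> real) \<Rightarrow> ((real \<Rightarrow> real) \<Rightarrow> real \<Rightarrow> real) \<Rightarrow> ('a \<Rightarrow> ennreal) \<Rightarrow> 'a \<Rightarrow> real" where
  "cost W c \<tau> x = c (path_of W x) (enn2real (\<tau> x))"

definition stopping_value ::
    "'a measure \<Rightarrow> (ennreal \<Rightarrow> 'a measure) \<Rightarrow> (real \<Rightarrow> 'a \<Rightarrow> real) \<Rightarrow>
     ((real \<Rightarrow> real) \<Rightarrow> real \<Rightarrow> real) \<Rightarrow> real measure \<Rightarrow> ereal" where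
  "stopping_value M G W c \<mu> = (SUP \<tau>\<in>stopping_times M G \<mu>. ext_expectation M (cost W c \<tau>))"

end

theory Submission
  imports Defs
begin

text \<open>Suppose that \<open>v(\<nu>\<^sub>n) > b > v(\<mu>)\<close> with \<open>\<nu>\<^sub>n \<rightarrow> \<mu>\<close>, and choose stopping times \<open>\<tau>\<^sub>n\<close> with law
  \<open>\<nu>\<^sub>n\<close> and value above \<open>b\<close>. Encode \<open>\<tau>\<^sub>n\<close> by the conditional distribution functions
  \<open>a\<^sub>n(q) = P(\<tau>\<^sub>n \<le> q | W)\<close>, which depend only on the path up to time \<open>q\<close>. All constraints are convex in
  \<open>a\<^sub>n\<close>, so convex combinations of the tails converge strongly in \<open>L\<^sup>2\<close>, and along a subsequence
  almost surely at all rational times. The quantile transforms of the limiting sequence at \<open>U\<close> then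
  converge almost surely to the quantile transform \<open>\<tau>\<close> of the limit. Upper semicontinuity in time
  and Fatou's lemma bound the value of \<open>\<tau>\<close> from below by \<open>b\<close>, and \<open>\<tau>\<close> has law \<open>\<mu>\<close>.

  The limit only satisfies \<open>{\<tau> < t} \<in> G\<^sub>t\<close>, and the filtration is neither complete nor right-continuous.
  But \<open>\<tau>\<close> is a functional of \<open>(U, W)\<close>, and the martingales of \<open>(U, W)\<close> are continuous; hence \<open>\<tau>\<close> is
  predictable, and an announcing sequence yields a genuine stopping time equal to \<open>\<tau>\<close> almost
  surely.\<close>

section \<open>The path space\<close>

text \<open>The cost is upper semicontinuous only in time, along almost every fixed path. Weak
  limits of the joint laws of path and time would not control it: the path has to stay fixed while
  the times converge almost surely. This dictates the strong \<open>L\<^sup>2\<close> selection and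
  the realization of all times on the given space through the one variable \<open>U\<close>.
  Stopping times with a given law do not form a convex set, but their joint laws with
  \<open>W\<close> can be averaged, and everything to be kept is a linear upper bound on such a law:
  the integral of the nonnegative function \<open>K - c\<close>, the mean, and the integrals of
  Lipschitz functions, which differ from those under \<open>\<mu>\<close> by at most the Wasserstein
  distance. That \<open>P(\<tau>\<^sub>n \<le> q | W)\<close> sees only the path up to
  \<open>q\<close> rests on the independence of the later increments from all of
  \<open>G\<^sub>q\<close>. As \<open>G\<close> may carry more information than
  \<open>(U, W)\<close>, conditional expectations are written as explicit averages over later
  increments; they are adapted, and for suitable functionals continuous, at every outcome, so that
  first passage times fit an incomplete filtration.\<close>

lemma space_C0_borel [simp]: "space C0_borel = C0"
  by (simp add: C0_borel_def space_measure_of_conv)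

lemma sets_C0_borel: "sets C0_borel = sigma_sets C0 {U. C0_open U}"
  unfolding C0_borel_def openin_C0_topology
  by (rule sets_measure_of) (auto simp: C0_open_def)

lemma measurable_C0_eval [measurable]:
  assumes "0 \<le> s"
  shows "(\<lambda>w. w s) \<in> borel_measurable C0_borel"
proof (rule borel_measurableI_less)
  fix a :: real
  have "C0_open {w \<in> C0. w s < a}"
    unfolding C0_open_def
  proof (intro conjI ballI)
    fix w assume w: "w \<in> {w \<in> C0. w s < a}"
    show "\<exists>T\<ge>0. \<exists>e>0. \<forall>w'\<in>C0. (\<forall>t\<in>{0..T}. \<bar>w' t - w t\<bar> < e) \<longrightarrow> w' \<in> {w \<in> C0. w s < a}"
    proof (intro exI conjI ballI impI)
      show "0 \<le> s" by fact
      show "a - w s > 0" using w by simp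
      fix w' assume "w' \<in> C0" "\<forall>t\<in>{0..s}. \<bar>w' t - w t\<bar> < a - w s"
      moreover from this assms have "\<bar>w' s - w s\<bar> < a - w s" by auto
      ultimately show "w' \<in> {w \<in> C0. w s < a}" by auto
    qed
  qed auto
  then show "{w \<in> space C0_borel. w s < a} \<in> sets C0_borel"
    by (auto simp: sets_C0_borel)
qed

text \<open>Turns uniform closeness of two paths on an interval into countably many conditions. The
  approximating rationals lie to the right of \<open>t\<close>, hence the strict
  \<open>t < b\<close>.\<close>

lemma continuous_abs_le_of_rational:
  fixes g :: "real \<Rightarrow> real"
  assumes g: "continuous_on {0..} g" and le: "\<And>t. t \<in> \<rat> \<Longrightarrow> t \<in> {0..b} \<Longrightarrow> \<bar>g t\<bar> \<le> r"
    and t: "0 \<le> t" "t < b"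
  shows "\<bar>g t\<bar> \<le> r"
proof (rule ccontr)
  assume "\<not> \<bar>g t\<bar> \<le> r"
  then have "\<bar>g t\<bar> - r > 0" by simp
  with g t obtain d where d: "d > 0" "\<And>s. s \<in> {0..} \<Longrightarrow> dist s t < d \<Longrightarrow> dist (g s) (g t) < \<bar>g t\<bar> - r"
    unfolding continuous_on_iff by (metis atLeast_iff)
  have "t < min b (t + d)" using t d by simp
  from Rats_dense_in_real[OF this] obtain s where s: "s \<in> \<rat>" "t < s" "s < b" "s < t + d"
    by auto
  then have "dist (g s) (g t) < \<bar>g t\<bar> - r" using t by (intro d(2)) (auto simp: dist_real_def)
  moreover have "\<bar>g s\<bar> \<le> r" using s t by (intro le) auto
  ultimately show False by (simp add: dist_real_def)
qed

text \<open>Second countability in disguise: every open set is a union of sets \<open>S i\<close>,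
  bands around step functions with finitely many rational values, and the indices \<open>i\<close>
  range over a countable type. Membership in a band is a condition at rational times only, so
  measurable coordinates suffice.\<close>

lemma measurable_C0_borel:
  assumes C0: "\<And>x. x \<in> space N \<Longrightarrow> f x \<in> C0"
    and meas [measurable]: "\<And>s. 0 \<le> s \<Longrightarrow> (\<lambda>x. f x s) \<in> borel_measurable N"
  shows "f \<in> N \<rightarrow>\<^sub>M C0_borel"
  unfolding C0_borel_def openin_C0_topology
proof (rule measurable_measure_of)
  fix U assume "U \<in> {U. C0_open U}"
  then have U: "C0_open U" by simp
  \<comment> \<open>The step function with mesh \<open>1/m\<close> and values listed in
    \<open>as\<close>; beyond the end of the list it is 0.\<close>
  define p where "p m as t = real_of_rat (nth_default 0 as (nat \<lfloor>real m * t\<rfloor>))" for m :: nat and as :: "rat list" and t :: real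
  define S where "S = (\<lambda>(m, as, n, k). {w\<in>C0. \<forall>t\<in>\<rat> \<inter> {0..real n}. \<bar>w t - p m as t\<bar> \<le> 1 / real (Suc k)})"
  have U_eq: "U = (\<Union>i\<in>{i. S i \<subseteq> U}. S i)"
  proof (intro equalityI subsetI)
    fix w assume w: "w \<in> U"
    with U obtain T e where T: "T \<ge> 0" and e: "e > 0"
      and sub: "\<And>w'. w' \<in> C0 \<Longrightarrow> (\<forall>t\<in>{0..T}. \<bar>w' t - w t\<bar> < e) \<Longrightarrow> w' \<in> U"
      unfolding C0_open_def by metis
    have wC: "w \<in> C0" "continuous_on {0..} w" using w U by (auto simp: C0_open_def C0_def)
    obtain n :: nat where n: "T < real n" using reals_Archimedean2 by blast
    obtain k :: nat where k: "1 / real (Suc k) < e / 2"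
      using reals_Archimedean[of "e/2"] e by (auto simp: inverse_eq_divide)
    define r where "r = 1 / real (Suc k)"
    have r: "r > 0" "2 * r < e" using k by (auto simp: r_def)
    have "uniformly_continuous_on {0..real n} w"
      by (rule compact_uniformly_continuous) (auto intro: continuous_on_subset[OF wC(2)])
    then obtain d where d: "d > 0" "\<And>s t. s \<in> {0..real n} \<Longrightarrow> t \<in> {0..real n} \<Longrightarrow> dist s t < d \<Longrightarrow> dist (w s) (w t) < r / 2"
      unfolding uniformly_continuous_on_def using r by (metis half_gt_zero)
    obtain m' :: nat where m': "1 / real (Suc m') < d"
      using reals_Archimedean[of d] d by (auto simp: inverse_eq_divide)
    define m where "m = Suc m'"
    have m: "m > 0" "1 / real m < d" using m' by (auto simp: m_def)
    have "\<exists>q. \<bar>real_of_rat q - w (real i / real m)\<bar> < r / 2" for i :: nat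
    proof -
      have "w (real i / real m) - r/2 < w (real i / real m) + r/2" using r by simp
      from of_rat_dense[OF this] obtain q where
        "w (real i / real m) - r/2 < real_of_rat q" "real_of_rat q < w (real i / real m) + r/2" by blast
      then show ?thesis by (intro exI[of _ q]) (simp only: abs_less_iff, linarith)
    qed
    then obtain q where q: "\<And>i::nat. \<bar>real_of_rat (q i) - w (real i / real m)\<bar> < r / 2" by metis
    \<comment> \<open>\<open>n * m + 1\<close> entries, since the right endpoint
      \<open>t = n\<close> has index \<open>n * m\<close>.\<close>
    define as where "as = map q [0..<Suc (n * m)]"
    have close: "\<bar>w t - p m as t\<bar> \<le> r" if t: "t \<in> {0..real n}" for t
    proof -
      define i where "i = nat \<lfloor>real m * t\<rfloor>"
      have fl: "0 \<le> \<lfloor>real m * t\<rfloor>" using t by simp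
      have i1: "real i \<le> real m * t" using fl by (simp add: i_def)
      have i2: "real m * t < real i + 1" using fl unfolding i_def by linarith
      have "real m * t \<le> real m * real n" using t by (intro mult_left_mono) auto
      then have "real i \<le> real (n * m)" using i1 by (simp add: mult.commute)
      then have "i < Suc (n * m)" by linarith
      then have pq: "p m as t = real_of_rat (q i)"
        by (simp add: p_def as_def i_def[symmetric] nth_default_nth del: upt_Suc)
      have it: "real i / real m \<le> t" "t < real i / real m + 1 / real m"
        using i1 i2 m(1) by (auto simp: field_simps)
      have "dist (w (real i / real m)) (w t) < r / 2"
        using it m t by (intro d(2)) (auto simp: dist_real_def)
      with q[of i] show ?thesis unfolding pq dist_real_def by linarith
    qed
    have "w \<in> S (m, as, n, k)"
      using wC close by (auto simp: S_def r_def)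
    moreover have "S (m, as, n, k) \<subseteq> U"
    proof
      fix w' assume w': "w' \<in> S (m, as, n, k)"
      then have w'C: "w' \<in> C0" "continuous_on {0..} w'" by (auto simp: S_def C0_def)
      show "w' \<in> U"
      proof (rule sub[OF w'C(1)], rule ballI)
        fix t assume t: "t \<in> {0..T}"
        have "\<bar>w' t - w t\<bar> \<le> 2 * r"
        proof (rule continuous_abs_le_of_rational[where b = "real n" and g = "\<lambda>t. w' t - w t"])
          show "continuous_on {0..} (\<lambda>t. w' t - w t)"
            using w'C wC by (intro continuous_intros)
          fix s :: real assume s: "s \<in> \<rat>" "s \<in> {0..real n}"
          then have "\<bar>w' s - p m as s\<bar> \<le> r" using w' by (auto simp: S_def r_def)
          with close[OF s(2)] show "\<bar>w' s - w s\<bar> \<le> 2 * r" by linarith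
        qed (use t n in auto)
        then show "\<bar>w' t - w t\<bar> < e" using r by linarith
      qed
    qed
    ultimately show "w \<in> (\<Union>i\<in>{i. S i \<subseteq> U}. S i)" by blast
  qed auto
  have meas_S: "f -` S i \<inter> space N \<in> sets N" for i
  proof -
    obtain m as n k where i: "i = (m, as, n, k)" by (cases i) auto
    have "f -` S i \<inter> space N = {x\<in>space N. \<forall>t\<in>\<rat> \<inter> {0..real n}. \<bar>f x t - p m as t\<bar> \<le> 1 / real (Suc k)}"
      using C0 by (auto simp: S_def i)
    also have "\<dots> \<in> sets N"
    proof (rule sets.sets_Collect_countable_All')
      fix t :: real assume "t \<in> \<rat> \<inter> {0..real n}"
      then have [measurable]: "(\<lambda>x. f x t) \<in> borel_measurable N" by (intro meas) auto
      show "{x \<in> space N. \<bar>f x t - p m as t\<bar> \<le> 1 / real (Suc k)} \<in> sets N" by measurable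
    qed (intro countable_Int1 countable_rat)
    finally show ?thesis .
  qed
  have "f -` U \<inter> space N = (\<Union>i\<in>{i. S i \<subseteq> U}. f -` S i \<inter> space N)"
    by (subst U_eq) blast
  also have "\<dots> \<in> sets N"
    using meas_S by (intro sets.countable_UN') auto
  finally show "f -` U \<inter> space N \<in> sets N" .
qed (use C0 in \<open>auto simp: C0_open_def\<close>)

section \<open>Independence of increments and the associated martingales\<close>

abbreviation UC_borel :: "(real \<times> (real \<Rightarrow> real)) measure" where
  "UC_borel \<equiv> borel \<Otimes>\<^sub>M C0_borel"

abbreviation CT_borel :: "((real \<Rightarrow> real) \<times> real) measure" where
  "CT_borel \<equiv> C0_borel \<Otimes>\<^sub>M borel"

lemma path_of_nonneg [simp]: "0 \<le> s \<Longrightarrow> path_of W x s = W s x"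
  by (simp add: path_of_def)

text \<open>Intended for \<open>d\<close> vanishing up to \<open>t\<close>: the path follows
  \<open>w\<close> until \<open>t\<close> and then moves on by \<open>d\<close>. The sum makes
  continuity and coordinatewise limits immediate.\<close>

definition concat_path :: "real \<Rightarrow> (real \<Rightarrow> real) \<Rightarrow> (real \<Rightarrow> real) \<Rightarrow> real \<Rightarrow> real" where
  "concat_path t w d = (\<lambda>s\<in>{0..}. w (min s t) + d s)"

lemma restrict_in_C0:
  assumes "continuous_on {0..} f" "f 0 = 0"
  shows "restrict f {0..} \<in> C0"
  using path_of_in_C0[of "\<lambda>t _. f t" undefined] assms by (simp add: path_of_def)

lemma concat_path_in_C0:
  assumes "w \<in> C0" "d \<in> C0" "0 \<le> t"
  shows "concat_path t w d \<in> C0"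
  unfolding concat_path_def
proof (rule restrict_in_C0)
  have "continuous_on {0..} (\<lambda>s. w (min s t))"
    using assms by (intro continuous_on_compose2[of "{0..}" w "{0..}" "\<lambda>s. min s t"] continuous_intros) (auto simp: C0_def)
  then show "continuous_on {0..} (\<lambda>s. w (min s t) + d s)"
    using assms by (intro continuous_intros) (auto simp: C0_def)
qed (use assms in \<open>simp add: C0_def\<close>)

text \<open>Both uses have the identity into a smaller \<sigma>-algebra as one of the two maps. The
  product law then expresses the independence of a random variable from a whole \<sigma>-algebra,
  and Fubini applies with an outcome as one coordinate.\<close>

lemma (in prob_space) distr_pair_indep:
  assumes X [measurable]: "X \<in> M \<rightarrow>\<^sub>M S" and Y [measurable]: "Y \<in> M \<rightarrow>\<^sub>M T"
    and indep: "\<And>A B. A \<in> sets S \<Longrightarrow> B \<in> sets T \<Longrightarrow>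
      prob ((X -` A \<inter> space M) \<inter> (Y -` B \<inter> space M)) = prob (X -` A \<inter> space M) * prob (Y -` B \<inter> space M)"
  shows "distr M (S \<Otimes>\<^sub>M T) (\<lambda>x. (X x, Y x)) = distr M S X \<Otimes>\<^sub>M distr M T Y"
proof (rule pair_measure_eqI[symmetric])
  show "sigma_finite_measure (distr M S X)" "sigma_finite_measure (distr M T Y)"
    by (intro finite_measure.axioms(1) prob_space.finite_measure prob_space_distr X Y)+
  fix A B assume "A \<in> sets (distr M S X)" "B \<in> sets (distr M T Y)"
  then have [measurable]: "A \<in> sets S" "B \<in> sets T" by auto
  have "emeasure (distr M (S \<Otimes>\<^sub>M T) (\<lambda>x. (X x, Y x))) (A \<times> B) = emeasure M ((X -` A \<inter> space M) \<inter> (Y -` B \<inter> space M))"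
    by (subst emeasure_distr) (auto intro!: arg_cong[where f="emeasure M"])
  also have "\<dots> = emeasure M (X -` A \<inter> space M) * emeasure M (Y -` B \<inter> space M)"
    by (simp add: emeasure_eq_measure indep ennreal_mult)
  finally show "emeasure (distr M S X) A * emeasure (distr M T Y) B =
      emeasure (distr M (S \<Otimes>\<^sub>M T) (\<lambda>x. (X x, Y x))) (A \<times> B)"
    by (simp add: emeasure_distr)
qed simp

section \<open>The filtration, the path and the uniform variable\<close>

locale randomized_brownian = prob_space M for M :: "'a measure" +
  fixes G :: "ennreal \<Rightarrow> 'a measure" and W :: "real \<Rightarrow> 'a \<Rightarrow> real" and U :: "'a \<Rightarrow> real"
  assumes filtered: "filtered_prob_space M G"
    and brownian: "brownian_motion M G W"
    and randomization: "uniform_independent M G W U"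
begin

lemma subalgebra_G: "subalgebra M (G t)"
  using filtered by (simp add: filtered_prob_space_def)

lemma space_G [simp]: "space (G t) = space M"
  using subalgebra_G by (simp add: subalgebra_def)

lemma sets_G_subset: "A \<in> sets (G t) \<Longrightarrow> A \<in> sets M"
  using subalgebra_G by (auto simp: subalgebra_def)

lemma sets_G_mono: "A \<in> sets (G s) \<Longrightarrow> s \<le> t \<Longrightarrow> A \<in> sets (G t)"
  using filtered by (auto simp: filtered_prob_space_def filtration_def)

lemma measurable_G_mono:
  assumes "f \<in> G s \<rightarrow>\<^sub>M N" "s \<le> t"
  shows "f \<in> G t \<rightarrow>\<^sub>M N"
proof (rule measurableI)
  fix x assume "x \<in> space (G t)"
  then show "f x \<in> space N" using measurable_space[OF assms(1)] by simp
next
  fix A assume "A \<in> sets N"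
  from sets_G_mono[OF measurable_sets[OF assms(1) this] assms(2)]
  show "f -` A \<inter> space (G t) \<in> sets (G t)" by simp
qed

lemma measurable_from_G: "f \<in> G s \<rightarrow>\<^sub>M N \<Longrightarrow> f \<in> M \<rightarrow>\<^sub>M N"
  by (rule measurable_from_subalg[OF subalgebra_G])

lemma W_0 [simp]: "x \<in> space M \<Longrightarrow> W 0 x = 0"
  using brownian by (simp add: brownian_motion_def)

lemma continuous_W: "x \<in> space M \<Longrightarrow> continuous_on {0..} (\<lambda>t. W t x)"
  using brownian by (simp add: brownian_motion_def)

lemma W_adapted:
  assumes "0 \<le> s" "ennreal s \<le> t"
  shows "W s \<in> borel_measurable (G t)"
proof -
  have "W s \<in> borel_measurable (G (ennreal s))"
    using brownian assms by (simp add: brownian_motion_def)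
  then show ?thesis using assms(2) by (rule measurable_G_mono)
qed

lemma W_measurable [measurable]: "0 \<le> s \<Longrightarrow> W s \<in> borel_measurable M"
  using measurable_from_G[OF W_adapted[of s "ennreal s"]] by simp

lemma U_adapted: "U \<in> borel_measurable (G t)"
proof (rule measurable_G_mono)
  show "U \<in> borel_measurable (G 0)"
    using randomization unfolding uniform_independent_def by blast
qed simp

lemma U_measurable [measurable]: "U \<in> borel_measurable M"
  by (rule measurable_from_G[OF U_adapted])

lemma path_C0 [simp]: "x \<in> space M \<Longrightarrow> path_of W x \<in> C0"
  by (rule path_of_in_C0[OF continuous_W W_0])

lemma path_measurable [measurable]: "path_of W \<in> M \<rightarrow>\<^sub>M C0_borel"
  by (rule measurable_C0_borel) simp_all

text \<open>No shift of time: the increments after \<open>t\<close> keep the original clock and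
  vanish before \<open>t\<close>, so \<open>concat_path\<close> restores the path by mere
  addition.\<close>

definition incr :: "real \<Rightarrow> 'a \<Rightarrow> real \<Rightarrow> real" where
  "incr t x = (\<lambda>s\<in>{0..}. W s x - W (min s t) x)"

lemma incr_nonneg [simp]: "0 \<le> s \<Longrightarrow> incr t x s = W s x - W (min s t) x"
  by (simp add: incr_def)

lemma continuous_W_min: "x \<in> space M \<Longrightarrow> 0 \<le> t \<Longrightarrow> continuous_on {0..} (\<lambda>s. W (min s t) x)"
  by (rule continuous_on_compose2[OF continuous_W continuous_on_min[OF continuous_on_id continuous_on_const]]) auto

lemma incr_C0 [simp]: "x \<in> space M \<Longrightarrow> 0 \<le> t \<Longrightarrow> incr t x \<in> C0"
  unfolding incr_def
  by (rule restrict_in_C0[OF continuous_on_diff[OF continuous_W continuous_W_min]]) auto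

lemma incr_measurable [measurable]: "0 \<le> t \<Longrightarrow> incr t \<in> M \<rightarrow>\<^sub>M C0_borel"
  by (rule measurable_C0_borel) simp_all

lemma concat_path_incr: "0 \<le> t \<Longrightarrow> concat_path t (path_of W x) (incr t x) = path_of W x"
  by (rule ext) (simp add: concat_path_def path_of_def)

definition incr_algebra :: "real \<Rightarrow> real set \<Rightarrow> 'a measure" where
  "incr_algebra t I = sigma (space M) (\<Union>s\<in>I. {(\<lambda>x. W s x - W t x) -` A \<inter> space M | A. A \<in> sets borel})"

lemma space_incr_algebra [simp]: "space (incr_algebra t I) = space M"
  by (simp add: incr_algebra_def space_measure_of_conv)

lemma sets_incr_algebra: "sets (incr_algebra t I) =
    sigma_sets (space M) (\<Union>s\<in>I. {(\<lambda>x. W s x - W t x) -` A \<inter> space M | A. A \<in> sets borel})"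
  unfolding incr_algebra_def by (rule sets_measure_of) auto

lemma incr_algebra_measurable:
  "s \<in> I \<Longrightarrow> (\<lambda>x. W s x - W t x) \<in> borel_measurable (incr_algebra t I)"
  by (rule measurableI) (auto simp: sets_incr_algebra)

lemma sets_incr_algebra_subset:
  assumes "space N = space M" "\<And>s. s \<in> I \<Longrightarrow> (\<lambda>x. W s x - W t x) \<in> borel_measurable N"
  shows "sets (incr_algebra t I) \<subseteq> sets N"
  unfolding sets_incr_algebra assms(1)[symmetric]
  by (rule sets.sigma_sets_subset) (auto intro: measurable_sets[OF assms(2)])

text \<open>The definition of Brownian motion makes only one increment at a time independent of the
  past. Induct on the largest time \<open>r\<close>: with \<open>s\<close> the time before it, an
  event of \<open>G t\<close> met with one of the earlier increments lies in \<open>G s\<close>, and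
  the increment from \<open>s\<close> to \<open>r\<close> splits off.\<close>

lemma indep_incr_finite:
  assumes "finite I" "0 \<le> t" "I \<subseteq> {t<..}"
  shows "indep_set (sets (G (ennreal t))) (sets (incr_algebra t I))"
  using assms(1,3)
proof (induction I rule: finite_linorder_max_induct)
  case empty
  have *: "sets (incr_algebra t {}) = {{}, space M}"
    unfolding sets_incr_algebra by (simp add: sigma_sets_empty_eq)
  show ?case unfolding *
  proof (rule indep_setI)
    fix a b assume "a \<in> sets (G (ennreal t))" "b \<in> {{}, space M}"
    then show "prob (a \<inter> b) = prob a * prob b"
      using sets.sets_into_space[of a "G (ennreal t)"] by (auto simp: prob_space Int_absorb2)
  qed (auto intro: sets_G_subset)
next
  case (insert r I)
  \<comment> \<open>The time preceding \<open>r\<close>; it is \<open>t\<close> itself if no other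
    time is left.\<close>
  define s where "s = Max (insert t I)"
  have s_in: "s = t \<or> s \<in> I" using Max_in[of "insert t I"] insert by (auto simp: s_def)
  have s_ge: "t \<le> s" "\<And>u. u \<in> I \<Longrightarrow> u \<le> s" using insert by (auto simp: s_def)
  have sr: "s < r" using s_in insert by auto
  have s0: "0 \<le> s" using s_ge assms by simp
  define C where "C = vimage_algebra (space M) (\<lambda>x. W r x - W s x) borel"
  have indep_s: "indep_set (sets (G (ennreal s))) (sets C)"
    using brownian s0 sr by (simp add: brownian_motion_def C_def)
  have IH: "indep_set (sets (G (ennreal t))) (sets (incr_algebra t I))"
    using insert by auto
  have sub: "sets (incr_algebra t I) \<subseteq> sets (G (ennreal s))"
  proof (rule sets_incr_algebra_subset)
    fix u assume "u \<in> I"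
    with insert s_ge assms have "t < u" "u \<le> s" by auto
    then show "(\<lambda>x. W u x - W t x) \<in> borel_measurable (G (ennreal s))"
      using assms by (intro borel_measurable_diff W_adapted ennreal_leI) auto
  qed simp
  have C_ev: "sets C \<subseteq> events" using indep_s by (auto simp: indep_sets2_eq)
  \<comment> \<open>These sets are stable under intersection, and the \<sigma>-algebra they generate
    contains all increments from \<open>t\<close>, because \<open>W r - W t\<close> is the sum of
    the increments over \<open>[t, s]\<close> and \<open>[s, r]\<close>.\<close>
  define E where "E = {A \<inter> B | A B. A \<in> sets (incr_algebra t I) \<and> B \<in> sets C}"
  have spC: "space C = space M" by (simp add: C_def)
  have "indep_set (sets (G (ennreal t))) E"
  proof (rule indep_setI)
    show "E \<subseteq> events"
    proof
      fix b assume "b \<in> E"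
      then obtain A B where "b = A \<inter> B" "A \<in> sets (incr_algebra t I)" "B \<in> sets C" by (auto simp: E_def)
      then show "b \<in> events" using sub C_ev by (blast intro: sets.Int sets_G_subset)
    qed
    show "sets (G (ennreal t)) \<subseteq> events" by (blast intro: sets_G_subset)
    fix a b assume a: "a \<in> sets (G (ennreal t))" and "b \<in> E"
    then obtain A B where b: "b = A \<inter> B" "A \<in> sets (incr_algebra t I)" "B \<in> sets C" by (auto simp: E_def)
    have A: "A \<in> sets (G (ennreal s))" using b sub by auto
    have a': "a \<in> sets (G (ennreal s))" by (rule sets_G_mono[OF a ennreal_leI[OF s_ge(1)]])
    have "prob (a \<inter> b) = prob ((a \<inter> A) \<inter> B)" by (simp add: b Int_assoc)
    also have "\<dots> = prob (a \<inter> A) * prob B" using A a' b by (intro indep_setD[OF indep_s]) auto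
    also have "prob (a \<inter> A) = prob a * prob A" using a b by (intro indep_setD[OF IH])
    also have "prob a * prob A * prob B = prob a * prob b"
      using indep_setD[OF indep_s A b(3)] by (simp add: b)
    finally show "prob (a \<inter> b) = prob a * prob b" .
  qed
  moreover have "Int_stable E"
    unfolding Int_stable_def
  proof safe
    fix a b assume "a \<in> E" "b \<in> E"
    then obtain A B A' B' where *: "a = A \<inter> B" "b = A' \<inter> B'" "A \<in> sets (incr_algebra t I)" "B \<in> sets C"
      "A' \<in> sets (incr_algebra t I)" "B' \<in> sets C" by (auto simp: E_def)
    then show "a \<inter> b \<in> E" unfolding E_def
      by (intro CollectI exI[of _ "A \<inter> A'"] exI[of _ "B \<inter> B'"]) auto
  qed
  ultimately have ind: "indep_set (sigma_sets (space M) (sets (G (ennreal t)))) (sigma_sets (space M) E)"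
    by (intro indep_set_sigma_sets) (auto simp: Int_stable_def)
  have E_sub: "E \<subseteq> Pow (space M)" using sets.sets_into_space[of _ C] by (auto simp: E_def spC)
  define N where "N = sigma (space M) E"
  have N: "space N = space M" "sets N = sigma_sets (space M) E"
    using E_sub by (auto simp: N_def space_measure_of_conv)
  have IN: "sets (incr_algebra t I) \<subseteq> sets N"
  proof
    fix A assume A: "A \<in> sets (incr_algebra t I)"
    then have "A = A \<inter> space C" using sets.sets_into_space[OF A] spC by auto
    then have "A \<in> E" using A unfolding E_def by blast
    then show "A \<in> sets N" by (simp add: N(2) sigma_sets.Basic)
  qed
  have CN: "sets C \<subseteq> sets N"
  proof
    fix B assume B: "B \<in> sets C"
    then have "B = space (incr_algebra t I) \<inter> B" using sets.sets_into_space[OF B] spC by auto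
    then have "B \<in> E" using B unfolding E_def by blast
    then show "B \<in> sets N" by (simp add: N(2) sigma_sets.Basic)
  qed
  have I_meas: "(\<lambda>x. W u x - W t x) \<in> borel_measurable N" if "u \<in> I" for u
    using incr_algebra_measurable[OF that] IN by (auto simp: measurable_def N)
  have r_meas: "(\<lambda>x. W r x - W s x) \<in> borel_measurable N"
    using measurable_vimage_algebra1[of "\<lambda>x. W r x - W s x" "space M" borel] CN
    by (auto simp: measurable_def N C_def)
  have s_meas: "(\<lambda>x. W s x - W t x) \<in> borel_measurable N"
    using s_in I_meas by auto
  have "sets (incr_algebra t (insert r I)) \<subseteq> sets N"
  proof (rule sets_incr_algebra_subset)
    fix u assume "u \<in> insert r I"
    moreover have "(\<lambda>x. W r x - W t x) \<in> borel_measurable N"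
      using borel_measurable_add[OF r_meas s_meas] by simp
    ultimately show "(\<lambda>x. W u x - W t x) \<in> borel_measurable N" using I_meas by auto
  qed (simp add: N)
  with ind show ?case
    unfolding N(2) sets.sigma_sets_eq[of "G (ennreal t)", simplified]
    by (auto simp: indep_sets2_eq)
qed

text \<open>Finite sets of times are directed under union, so the events depending on finitely many
  increments are stable under intersection; by \<open>measurable_C0_borel\<close> they generate
  everything about the increment path.\<close>

lemma indep_incr:
  assumes t: "0 \<le> t" and A: "A \<in> sets (G (ennreal t))" and B: "B \<in> sets C0_borel"
  shows "prob (A \<inter> (incr t -` B \<inter> space M)) = prob A * prob (incr t -` B \<inter> space M)"
proof -
  define E where "E = (\<Union>I\<in>{I. finite I \<and> I \<subseteq> {t<..}}. sets (incr_algebra t I))"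
  have "indep_set (sets (G (ennreal t))) E"
    using indep_incr_finite[OF _ t] unfolding indep_sets2_eq E_def by blast
  moreover have "Int_stable E"
    unfolding Int_stable_def
  proof safe
    fix a b assume "a \<in> E" "b \<in> E"
    then obtain I J where *: "finite I" "I \<subseteq> {t<..}" "finite J" "J \<subseteq> {t<..}"
      "a \<in> sets (incr_algebra t I)" "b \<in> sets (incr_algebra t J)" by (auto simp: E_def)
    have "sets (incr_algebra t I) \<subseteq> sets (incr_algebra t (I \<union> J))" "sets (incr_algebra t J) \<subseteq> sets (incr_algebra t (I \<union> J))"
      by (intro sets_incr_algebra_subset incr_algebra_measurable; simp)+
    with * have "a \<inter> b \<in> sets (incr_algebra t (I \<union> J))" by auto
    with * show "a \<inter> b \<in> E" unfolding E_def by (intro UN_I[of "I \<union> J"]) auto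
  qed
  ultimately have ind: "indep_set (sigma_sets (space M) (sets (G (ennreal t)))) (sigma_sets (space M) E)"
    by (intro indep_set_sigma_sets) (auto simp: Int_stable_def)
  have E_sub: "E \<subseteq> Pow (space M)"
    using sets.sets_into_space[of _ "incr_algebra t _"] by (force simp: E_def)
  define N where "N = sigma (space M) E"
  have N: "space N = space M" "sets N = sigma_sets (space M) E"
    using E_sub by (auto simp: N_def space_measure_of_conv)
  have "incr t \<in> N \<rightarrow>\<^sub>M C0_borel"
  proof (rule measurable_C0_borel)
    fix s :: real assume s: "0 \<le> s"
    show "(\<lambda>x. incr t x s) \<in> borel_measurable N"
    proof (cases "t < s")
      case True
      have "sets (incr_algebra t {s}) \<subseteq> sets N"
        using True by (auto simp: N E_def intro!: sigma_sets.Basic)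
      then have "(\<lambda>x. W s x - W t x) \<in> borel_measurable N"
        using incr_algebra_measurable[of s "{s}" t] by (auto simp: measurable_def N)
      then show ?thesis using s True by (simp add: min_def)
    next
      case False
      then have "incr t x s = 0" for x using s by (simp add: min_def)
      then show ?thesis by simp
    qed
  qed (simp add: N t)
  from measurable_sets[OF this B] have "incr t -` B \<inter> space M \<in> sigma_sets (space M) E"
    by (simp only: N)
  moreover have "A \<in> sigma_sets (space M) (sets (G (ennreal t)))" using A by (rule sigma_sets.Basic)
  ultimately show ?thesis using indep_setD[OF ind] by blast
qed

text \<open>The freezing lemma: the outcome, observed through \<open>G t\<close>, and the later
  increments have a product law, so the increments may be replaced by those of an independent
  outcome.\<close>

lemma integral_incr:
  fixes H :: "'a \<times> (real \<Rightarrow> real) \<Rightarrow> real"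
  assumes t: "0 \<le> t" and H [measurable]: "H \<in> borel_measurable (G (ennreal t) \<Otimes>\<^sub>M C0_borel)"
    and bound: "\<And>x d. x \<in> space M \<Longrightarrow> d \<in> C0 \<Longrightarrow> \<bar>H (x, d)\<bar> \<le> K"
  shows "(\<integral>x. H (x, incr t x) \<partial>M) = (\<integral>x. \<integral>x'. H (x, incr t x') \<partial>M \<partial>M)"
proof -
  have id_meas: "(\<lambda>x. x) \<in> M \<rightarrow>\<^sub>M G (ennreal t)"
    by (rule measurable_from_G[of _ "ennreal t"]) simp
  have inc: "incr t \<in> M \<rightarrow>\<^sub>M C0_borel" using t by simp
  define MG where "MG = distr M (G (ennreal t)) (\<lambda>x. x)"
  define D where "D = distr M C0_borel (incr t)"
  interpret MG: prob_space MG unfolding MG_def by (rule prob_space_distr[OF id_meas])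
  interpret D: prob_space D unfolding D_def by (rule prob_space_distr[OF inc])
  interpret MD: pair_prob_space MG D ..
  have law: "distr M (G (ennreal t) \<Otimes>\<^sub>M C0_borel) (\<lambda>x. (x, incr t x)) = MG \<Otimes>\<^sub>M D"
    unfolding MG_def D_def
  proof (rule distr_pair_indep[OF id_meas inc])
    fix A B assume A: "A \<in> sets (G (ennreal t))" and B: "B \<in> sets C0_borel"
    have "(\<lambda>x. x) -` A \<inter> space M = A" using sets.sets_into_space[OF sets_G_subset[OF A]] by auto
    with indep_incr[OF t A B] show "prob (((\<lambda>x. x) -` A \<inter> space M) \<inter> (incr t -` B \<inter> space M)) =
        prob ((\<lambda>x. x) -` A \<inter> space M) * prob (incr t -` B \<inter> space M)" by simp
  qed
  have sets_eq: "sets (MG \<Otimes>\<^sub>M D) = sets (G (ennreal t) \<Otimes>\<^sub>M C0_borel)"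
    by (intro sets_pair_measure_cong) (auto simp: MG_def D_def)
  have Hm: "H \<in> borel_measurable (MG \<Otimes>\<^sub>M D)"
    unfolding measurable_cong_sets[OF sets_eq refl] by fact
  have "integrable (MG \<Otimes>\<^sub>M D) H"
  proof (rule MD.integrable_const_bound[where B = K])
    show "AE x in MG \<Otimes>\<^sub>M D. norm (H x) \<le> K"
      by (rule AE_I2) (auto simp: space_pair_measure MG_def D_def bound)
  qed fact
  then have "(\<integral>p. H p \<partial>(MG \<Otimes>\<^sub>M D)) = (\<integral>x. \<integral>d. H (x, d) \<partial>D \<partial>MG)"
    by (rule MD.integral_fst'[symmetric])
  also have "\<dots> = (\<integral>x. \<integral>d. H (x, d) \<partial>D \<partial>M)"
  proof -
    have "(\<lambda>x. \<integral>d. H (x, d) \<partial>D) \<in> borel_measurable MG"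
      using D.borel_measurable_lebesgue_integral[of "\<lambda>x d. H (x, d)" MG] Hm by simp
    then show ?thesis
      unfolding MG_def by (intro integral_distr[OF id_meas]) (simp add: measurable_def)
  qed
  also have "\<dots> = (\<integral>x. \<integral>x'. H (x, incr t x') \<partial>M \<partial>M)"
  proof (rule Bochner_Integration.integral_cong[OF refl])
    fix x assume "x \<in> space M"
    then have "(\<lambda>d. H (x, d)) \<in> borel_measurable C0_borel"
      by (intro measurable_compose[OF measurable_Pair1' H]) simp
    then show "(\<integral>d. H (x, d) \<partial>D) = (\<integral>x'. H (x, incr t x') \<partial>M)"
      unfolding D_def by (intro integral_distr[OF inc])
  qed
  also have "(\<integral>p. H p \<partial>(MG \<Otimes>\<^sub>M D)) = (\<integral>x. H (x, incr t x) \<partial>M)"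
    unfolding law[symmetric]
    by (rule integral_distr[OF measurable_Pair[OF id_meas inc] H])
  finally show ?thesis .
qed

text \<open>A version of the conditional expectation of \<open>F(U, W)\<close> given \<open>G\<^sub>t\<close> that is defined everywhere and uses
  no null sets: keep the path up to time \<open>t\<close> and average over independent copies of the later
  increments.\<close>

definition mart :: "(real \<times> (real \<Rightarrow> real) \<Rightarrow> real) \<Rightarrow> real \<Rightarrow> 'a \<Rightarrow> real" where
  "mart F t x = (\<integral>x'. F (U x, concat_path t (path_of W x) (incr t x')) \<partial>M)"

lemma concat_path_measurable:
  assumes "0 \<le> t"
  shows "(\<lambda>p. concat_path t (path_of W (fst p)) (snd p)) \<in> G (ennreal t) \<Otimes>\<^sub>M C0_borel \<rightarrow>\<^sub>M C0_borel"
proof (rule measurable_C0_borel)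
  fix p assume "p \<in> space (G (ennreal t) \<Otimes>\<^sub>M C0_borel)"
  then show "concat_path t (path_of W (fst p)) (snd p) \<in> C0"
    using assms by (auto simp: space_pair_measure intro: concat_path_in_C0)
next
  fix s :: real assume s: "0 \<le> s"
  have "W (min s t) \<in> borel_measurable (G (ennreal t))"
    using s assms by (intro W_adapted ennreal_leI) auto
  then have "(\<lambda>p. W (min s t) (fst p) + snd p s) \<in> borel_measurable (G (ennreal t) \<Otimes>\<^sub>M C0_borel)"
    using s by measurable
  then show "(\<lambda>p. concat_path t (path_of W (fst p)) (snd p) s) \<in> borel_measurable (G (ennreal t) \<Otimes>\<^sub>M C0_borel)"
    using s assms by (simp add: concat_path_def)
qed

lemma concat_path_functional_measurable:
  assumes t: "0 \<le> t" and F [measurable]: "F \<in> borel_measurable UC_borel"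
  shows "(\<lambda>p. F (U (fst p), concat_path t (path_of W (fst p)) (snd p))) \<in> borel_measurable (G (ennreal t) \<Otimes>\<^sub>M C0_borel)"
proof -
  note [measurable] = concat_path_measurable[OF t] U_adapted[of "ennreal t"]
  show ?thesis by measurable
qed

text \<open>Exact, with no exceptional null set: the first argument enters only through
  \<open>U\<close> and the path up to \<open>t\<close>, and the second is integrated out.\<close>

lemma mart_adapted:
  assumes t: "0 \<le> t" and F: "F \<in> borel_measurable UC_borel"
  shows "mart F t \<in> borel_measurable (G (ennreal t))"
proof -
  have [measurable]: "incr t \<in> M \<rightarrow>\<^sub>M C0_borel" using t by simp
  have "(\<lambda>p. (fst p, incr t (snd p))) \<in> G (ennreal t) \<Otimes>\<^sub>M M \<rightarrow>\<^sub>M G (ennreal t) \<Otimes>\<^sub>M C0_borel"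
    by measurable
  from measurable_compose[OF this concat_path_functional_measurable[OF t F]]
  have "(\<lambda>(x, x'). F (U x, concat_path t (path_of W x) (incr t x'))) \<in> borel_measurable (G (ennreal t) \<Otimes>\<^sub>M M)"
    by (simp add: case_prod_beta')
  from borel_measurable_lebesgue_integral[OF this] show ?thesis
    by (simp add: mart_def[abs_def])
qed

lemma mart_bound:
  assumes bound: "\<And>u w. w \<in> C0 \<Longrightarrow> \<bar>F (u, w)\<bar> \<le> K" and "x \<in> space M" "0 \<le> t"
  shows "\<bar>mart F t x\<bar> \<le> K"
proof -
  have K: "0 \<le> K" by (rule order_trans[OF abs_ge_zero bound[OF path_C0[OF assms(2)]]])
  have "norm (mart F t x) \<le> (\<integral>x'. norm (F (U x, concat_path t (path_of W x) (incr t x'))) \<partial>M)"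
    unfolding mart_def by (rule integral_norm_bound)
  also have "\<dots> \<le> (\<integral>x'. K \<partial>M)"
    by (rule integral_mono_AE') (use assms K in \<open>auto intro!: AE_I2 bound concat_path_in_C0\<close>)
  also have "\<dots> = K" by (simp add: prob_space)
  finally show ?thesis by simp
qed

text \<open>Gluing a path to its own increments gives the path back, so this is
  \<open>integral_incr\<close> with \<open>g\<close> as a factor. Since \<open>g\<close> may be any
  bounded function measurable for \<open>G t\<close>, \<open>mart F\<close> is a martingale for the
  given filtration and not just for the one generated by \<open>U\<close> and
  \<open>W\<close>.\<close>

lemma mart_martingale:
  assumes t: "0 \<le> t" and F: "F \<in> borel_measurable UC_borel"
    and bound: "\<And>u w. w \<in> C0 \<Longrightarrow> \<bar>F (u, w)\<bar> \<le> K"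
    and g: "g \<in> borel_measurable (G (ennreal t))" and g_bound: "\<And>x. x \<in> space M \<Longrightarrow> \<bar>g x\<bar> \<le> L"
  shows "(\<integral>x. g x * F (U x, path_of W x) \<partial>M) = (\<integral>x. g x * mart F t x \<partial>M)"
proof -
  define H where "H p = g (fst p) * F (U (fst p), concat_path t (path_of W (fst p)) (snd p))" for p
  have "(\<integral>x. H (x, incr t x) \<partial>M) = (\<integral>x. \<integral>x'. H (x, incr t x') \<partial>M \<partial>M)"
  proof (rule integral_incr[OF t])
    note [measurable] = g concat_path_functional_measurable[OF t F]
    show "H \<in> borel_measurable (G (ennreal t) \<Otimes>\<^sub>M C0_borel)"
      unfolding H_def by measurable
    fix x d assume "x \<in> space M" "d \<in> C0"
    then show "\<bar>H (x, d)\<bar> \<le> L * K"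
      unfolding H_def abs_mult using t
      by (auto intro!: mult_mono g_bound bound concat_path_in_C0 order_trans[OF abs_ge_zero g_bound])
  qed
  then show ?thesis by (simp add: H_def mart_def concat_path_incr[OF t])
qed

end

section \<open>Optional stopping\<close>

text \<open>Pointwise convergence of paths is what gluing at a moving time provides, and functionals
  of finitely many coordinates respect it. Together with mere measurability in \<open>u\<close>,
  these suffice to approximate every bounded functional of \<open>(U, W)\<close> in the
  mean.\<close>

definition pointwise_continuous :: "(real \<times> (real \<Rightarrow> real) \<Rightarrow> real) \<Rightarrow> bool" where
  "pointwise_continuous F \<longleftrightarrow> F \<in> borel_measurable UC_borel \<and>
     (\<forall>u. \<forall>w\<in>C0. 0 \<le> F (u, w) \<and> F (u, w) \<le> 1) \<and>
     (\<forall>u v w. (\<forall>n. v n \<in> C0) \<longrightarrow> w \<in> C0 \<longrightarrow> (\<forall>s\<ge>0. (\<lambda>n. v n s) \<longlonglongrightarrow> w s) \<longrightarrow>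
        (\<lambda>n::nat. F (u, v n)) \<longlonglongrightarrow> F (u, w))"

lemma pointwise_continuousD:
  assumes "pointwise_continuous F"
  shows pointwise_continuous_measurable: "F \<in> borel_measurable UC_borel"
    and pointwise_continuous_nonneg: "w \<in> C0 \<Longrightarrow> 0 \<le> F (u, w)"
    and pointwise_continuous_le_1: "w \<in> C0 \<Longrightarrow> F (u, w) \<le> 1"
    and pointwise_continuous_abs_le_1: "w \<in> C0 \<Longrightarrow> \<bar>F (u, w)\<bar> \<le> 1"
    and pointwise_continuous_tendsto: "(\<And>n. v n \<in> C0) \<Longrightarrow> w \<in> C0 \<Longrightarrow>
      (\<And>s. 0 \<le> s \<Longrightarrow> (\<lambda>n. v n s) \<longlonglongrightarrow> w s) \<Longrightarrow> (\<lambda>n::nat. F (u, v n)) \<longlonglongrightarrow> F (u, w)"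
  using assms unfolding pointwise_continuous_def by (auto simp: abs_le_iff intro: order_trans)

text \<open>Borel-Cantelli in integrated form: the sum of the functions has finite integral, hence
  is finite almost everywhere, hence its terms tend to 0.\<close>

lemma AE_tendsto_0_of_summable:
  fixes f :: "nat \<Rightarrow> 'a \<Rightarrow> ennreal"
  assumes [measurable]: "\<And>n. f n \<in> borel_measurable M"
    and le: "\<And>n. (\<integral>\<^sup>+x. f n x \<partial>M) \<le> ennreal (c n)" and c: "summable c" "\<And>n. 0 \<le> c n"
  shows "AE x in M. (\<lambda>n. f n x) \<longlonglongrightarrow> 0"
proof -
  have "(\<integral>\<^sup>+x. (\<Sum>n. f n x) \<partial>M) = (\<Sum>n. \<integral>\<^sup>+x. f n x \<partial>M)"
    by (rule nn_integral_suminf) simp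
  also have "\<dots> \<le> (\<Sum>n. ennreal (c n))" by (intro suminf_le le) auto
  also have "\<dots> = ennreal (suminf c)" by (rule suminf_ennreal2) (use c in auto)
  finally have "(\<integral>\<^sup>+x. (\<Sum>n. f n x) \<partial>M) \<noteq> \<infinity>" by (auto simp: top_unique)
  then have "AE x in M. (\<Sum>n. f n x) \<noteq> \<infinity>" by (intro nn_integral_PInf_AE) auto
  then show ?thesis
  proof eventually_elim
    case (elim x)
    then have fin: "f n x < top" for n
      using ennreal_suminf_lessD[of "\<lambda>n. f n x" top n] by (auto simp: less_top)
    have eq: "f n x = ennreal (enn2real (f n x))" for n using fin[of n] by simp
    have "(\<Sum>n. ennreal (enn2real (f n x))) \<noteq> top" using elim eq by simp
    then have "summable (\<lambda>n. enn2real (f n x))" by (intro summable_suminf_not_top) auto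
    then have "(\<lambda>n. ennreal (enn2real (f n x))) \<longlonglongrightarrow> ennreal 0"
      by (intro tendsto_ennrealI summable_LIMSEQ_zero)
    then show ?case using eq by simp
  qed
qed

context randomized_brownian
begin

lemma mart_integrand_measurable:
  assumes t: "0 \<le> t" and F: "F \<in> borel_measurable UC_borel" and x: "x \<in> space M"
  shows "(\<lambda>x'. F (U x, concat_path t (path_of W x) (incr t x'))) \<in> borel_measurable M"
proof -
  have "(\<lambda>d. F (U x, concat_path t (path_of W x) d)) \<in> borel_measurable C0_borel"
    using measurable_compose[OF measurable_Pair1' concat_path_functional_measurable[OF t F]] x by simp
  from measurable_compose[OF incr_measurable[OF t] this] show ?thesis .
qed

text \<open>When the gluing time moves, the glued paths converge at every time because
  \<open>W\<close> is continuous; dominated convergence does the rest. This continuity is the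
  property of the Brownian setting behind predictability.\<close>

lemma mart_continuous:
  assumes F: "pointwise_continuous F" and x: "x \<in> space M"
  shows "continuous_on {0..} (\<lambda>t. mart F t x)"
  unfolding continuous_on_sequentially
proof (intro allI ballI impI, elim conjE)
  fix v :: "nat \<Rightarrow> real" and t :: real
  assume t: "t \<in> {0..}" and v: "\<forall>n. v n \<in> {0..}" "v \<longlonglongrightarrow> t"
  have Wlim: "(\<lambda>n. W (min s (v n)) y) \<longlonglongrightarrow> W (min s t) y" if "y \<in> space M" "0 \<le> s" for s y
    by (rule continuous_on_tendsto_compose[OF continuous_W[OF that(1)]])
      (use v t that in \<open>auto intro!: tendsto_intros\<close>)
  have "(\<lambda>n. \<integral>x'. F (U x, concat_path (v n) (path_of W x) (incr (v n) x')) \<partial>M)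
      \<longlonglongrightarrow> (\<integral>x'. F (U x, concat_path t (path_of W x) (incr t x')) \<partial>M)"
  proof (rule integral_dominated_convergence[where w = "\<lambda>_. 1"])
    show "AE x' in M. (\<lambda>n. F (U x, concat_path (v n) (path_of W x) (incr (v n) x'))) \<longlonglongrightarrow>
        F (U x, concat_path t (path_of W x) (incr t x'))"
    proof (rule AE_I2)
      fix x' assume x': "x' \<in> space M"
      show "(\<lambda>n. F (U x, concat_path (v n) (path_of W x) (incr (v n) x'))) \<longlonglongrightarrow>
        F (U x, concat_path t (path_of W x) (incr t x'))"
      proof (rule pointwise_continuous_tendsto[OF F])
        fix s :: real assume s: "0 \<le> s"
        have "(\<lambda>n. W (min s (v n)) x + (W s x' - W (min s (v n)) x')) \<longlonglongrightarrow>
            W (min s t) x + (W s x' - W (min s t) x')"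
          by (intro tendsto_intros Wlim x x' s)
        then show "(\<lambda>n. concat_path (v n) (path_of W x) (incr (v n) x') s) \<longlonglongrightarrow> concat_path t (path_of W x) (incr t x') s"
          using v t s by (simp add: concat_path_def)
      qed (use x x' v t in \<open>auto intro: concat_path_in_C0\<close>)
    qed
    show "AE x' in M. norm (F (U x, concat_path (v n) (path_of W x) (incr (v n) x'))) \<le> 1" for n
      using x v by (intro AE_I2) (auto intro!: pointwise_continuous_abs_le_1[OF F] concat_path_in_C0)
  qed (use v t x in \<open>auto intro!: mart_integrand_measurable pointwise_continuous_measurable[OF F]\<close>)
  then show "((\<lambda>t. mart F t x) \<circ> v) \<longlonglongrightarrow> mart F t x"
    by (simp add: mart_def comp_def)
qed

text \<open>Approximate \<open>\<rho>\<close> from above by the right endpoint of its cell in the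
  grid of mesh \<open>1/(n+1)\<close>. The part of \<open>B\<close> in a cell is known at that
  endpoint, so the martingale property applies cell by cell, and continuity of \<open>mart F\<close>
  lets the mesh tend to 0. The last hypothesis says at once that \<open>\<rho>\<close> is optional
  on \<open>B\<close> and that \<open>B\<close> belongs to its past.\<close>

lemma optional_stopping:
  assumes F: "pointwise_continuous F"
    and B_fin: "\<And>x. x \<in> B \<Longrightarrow> x \<in> space M \<and> \<rho> x < \<infinity>"
    and B: "\<And>s. 0 \<le> s \<Longrightarrow> {x \<in> B. \<rho> x < ennreal s} \<in> sets (G (ennreal s))"
  shows "(\<integral>x. indicat_real B x * F (U x, path_of W x) \<partial>M) =
      (\<integral>x. indicat_real B x * mart F (enn2real (\<rho> x)) x \<partial>M)"
    and "(\<lambda>x. indicat_real B x * mart F (enn2real (\<rho> x)) x) \<in> borel_measurable M"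
    and "B \<in> sets M"
proof -
  note Fm [measurable] = pointwise_continuous_measurable[OF F]
  have mart_le: "\<bar>mart F t x\<bar> \<le> 1" if "x \<in> space M" "0 \<le> t" for x t
    by (rule mart_bound[where K = 1]) (use that in \<open>auto intro: pointwise_continuous_abs_le_1[OF F]\<close>)
  define r where "r x = enn2real (\<rho> x)" for x
  have \<rho>r: "\<rho> x < ennreal s \<longleftrightarrow> r x < s" if "x \<in> B" "0 \<le> s" for x s
  proof -
    have "\<rho> x = ennreal (r x)" using B_fin[OF that(1)] by (simp add: r_def)
    moreover have "0 \<le> r x" by (simp add: r_def)
    ultimately show ?thesis by (simp add: ennreal_less_iff)
  qed
  have B_eq: "B = (\<Union>n. {x\<in>B. \<rho> x < ennreal (real n)})"
    by (auto simp: \<rho>r intro: reals_Archimedean2)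
  show Bm: "B \<in> sets M"
    by (subst B_eq) (auto intro!: sets_G_subset[OF B])
  \<comment> \<open>Cells are closed on the left: \<open>\<rho>\<close> lies strictly before the
    right endpoint, so only events \<open>\<rho> < s\<close> occur.\<close>
  define A where "A n k = {x\<in>B. real k / real (Suc n) \<le> r x \<and> r x < real (Suc k) / real (Suc n)}" for n k
  have AG: "A n k \<in> sets (G (ennreal (real (Suc k) / real (Suc n))))" for n k
  proof -
    have "A n k = {x\<in>B. \<rho> x < ennreal (real (Suc k) / real (Suc n))} - {x\<in>B. \<rho> x < ennreal (real k / real (Suc n))}"
      by (auto simp: A_def \<rho>r not_less simp del: of_nat_Suc)
    also have "\<dots> \<in> sets (G (ennreal (real (Suc k) / real (Suc n))))"
      by (intro sets.Diff B sets_G_mono[OF B]) (auto intro!: ennreal_leI divide_right_mono)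
    finally show ?thesis .
  qed
  have Am [measurable]: "A n k \<in> sets M" for n k by (rule sets_G_subset[OF AG])
  have A_disj: "A n i \<inter> A n j = {}" if "i \<noteq> j" for n i j
  proof -
    have False if "x \<in> A n i" "x \<in> A n j" "i < j" for x i j
    proof -
      have "r x * real (Suc n) < real (Suc i)" "real j \<le> r x * real (Suc n)"
        using that by (auto simp: A_def field_simps)
      with \<open>i < j\<close> show False by linarith
    qed
    with that show ?thesis by (metis disjoint_iff linorder_neqE_nat)
  qed
  have A_index: "x \<in> A n (nat \<lfloor>r x * real (Suc n)\<rfloor>)" if "x \<in> B" for x n
  proof -
    have *: "0 \<le> r x * real (Suc n)" by (simp add: r_def)
    define k where "k = nat \<lfloor>r x * real (Suc n)\<rfloor>"
    have "real k \<le> r x * real (Suc n)" "r x * real (Suc n) < real (Suc k)"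
      using * unfolding k_def by linarith+
    then show ?thesis using that unfolding k_def[symmetric] A_def
      by (simp add: divide_le_eq less_divide_eq del: of_nat_Suc)
  qed
  have A_Un: "(\<Union>k. A n k) = B" for n using A_index by (auto simp: A_def)
  define Y where "Y n x = mart F (real (Suc (nat \<lfloor>r x * real (Suc n)\<rfloor>)) / real (Suc n)) x" for n x
  have Y_A: "Y n x = mart F (real (Suc k) / real (Suc n)) x" if "x \<in> A n k" for n k x
  proof -
    have "x \<in> B" using that by (simp add: A_def)
    then have "k = nat \<lfloor>r x * real (Suc n)\<rfloor>" using A_index[of x n] A_disj that by blast
    then show ?thesis by (simp add: Y_def)
  qed
  have Y_eq: "indicat_real B x * Y n x = (\<Sum>k. indicat_real (A n k) x * mart F (real (Suc k) / real (Suc n)) x)" for n x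
  proof (cases "x \<in> B")
    case True
    define k where "k = nat \<lfloor>r x * real (Suc n)\<rfloor>"
    have "x \<in> A n k" using A_index[OF True] by (simp add: k_def)
    then have "indicat_real (A n i) x * mart F (real (Suc i) / real (Suc n)) x = (if i = k then Y n x else 0)" for i
      using A_disj[of i k n] Y_A by (auto simp: indicator_def)
    then show ?thesis using True sums_unique[OF sums_single[of k "\<lambda>_. Y n x"]] by (simp del: of_nat_Suc)
  next
    case False
    then have "indicat_real (A n i) x = 0" for i by (auto simp: A_def)
    then show ?thesis using False by simp
  qed
  have mart_m [measurable]: "mart F t \<in> borel_measurable M" if "0 \<le> t" for t
    by (rule measurable_from_G[OF mart_adapted[OF that Fm]])
  have Ym: "(\<lambda>x. indicat_real B x * Y n x) \<in> borel_measurable M" for n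
  proof -
    have [measurable]: "mart F (real (Suc k) / real (Suc n)) \<in> borel_measurable M" for k by (rule mart_m) simp
    show ?thesis unfolding Y_eq by measurable
  qed
  have YI: "(\<integral>x. indicat_real B x * F (U x, path_of W x) \<partial>M) = (\<integral>x. indicat_real B x * Y n x \<partial>M)" for n
  proof -
    have "(\<integral>x. indicat_real B x * F (U x, path_of W x) \<partial>M) = (LINT x:(\<Union>k. A n k)|M. F (U x, path_of W x))"
      by (simp add: set_lebesgue_integral_def A_Un)
    also have "\<dots> = (\<Sum>k. LINT x:A n k|M. F (U x, path_of W x))"
    proof (rule lebesgue_integral_countable_add[OF Am A_disj])
      show "set_integrable M (\<Union>k. A n k) (\<lambda>x. F (U x, path_of W x))"
        unfolding set_integrable_def A_Un
        by (rule integrable_const_bound[where B = 1])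
          (use Bm in \<open>auto intro!: AE_I2 pointwise_continuous_abs_le_1[OF F] simp: indicator_def\<close>)
    qed
    also have "\<dots> = (\<Sum>k. LINT x:A n k|M. Y n x)"
    proof (rule suminf_cong)
      fix k
      have "(LINT x:A n k|M. F (U x, path_of W x)) =
          (\<integral>x. indicat_real (A n k) x * F (U x, path_of W x) \<partial>M)"
        by (simp add: set_lebesgue_integral_def)
      also have "\<dots> = (\<integral>x. indicat_real (A n k) x * mart F (real (Suc k) / real (Suc n)) x \<partial>M)"
        by (rule mart_martingale[where K = 1 and L = 1])
          (use AG in \<open>auto intro: pointwise_continuous_abs_le_1[OF F] simp: indicator_def simp del: of_nat_Suc\<close>)
      also have "\<dots> = (LINT x:A n k|M. Y n x)"
        unfolding set_lebesgue_integral_def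
        by (rule Bochner_Integration.integral_cong[OF refl]) (simp add: Y_A indicator_def)
      finally show "(LINT x:A n k|M. F (U x, path_of W x)) = (LINT x:A n k|M. Y n x)" .
    qed
    also have "\<dots> = (LINT x:(\<Union>k. A n k)|M. Y n x)"
    proof (rule lebesgue_integral_countable_add[OF Am A_disj, symmetric])
      show "set_integrable M (\<Union>k. A n k) (Y n)"
        unfolding set_integrable_def A_Un
        by (rule integrable_const_bound[where B = 1])
          (use Ym in \<open>auto intro!: AE_I2 mart_le simp: indicator_def Y_def\<close>)
    qed
    also have "\<dots> = (\<integral>x. indicat_real B x * Y n x \<partial>M)"
      by (simp add: set_lebesgue_integral_def A_Un)
    finally show ?thesis .
  qed
  have time_lim: "(\<lambda>n. real (Suc (nat \<lfloor>a * real (Suc n)\<rfloor>)) / real (Suc n)) \<longlonglongrightarrow> a" if "0 \<le> a" for a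
  proof (rule tendsto_sandwich[where f = "\<lambda>_. a" and h = "\<lambda>n. a + 1 / real (Suc n)"])
    show "(\<lambda>n. a + 1 / real (Suc n)) \<longlonglongrightarrow> a"
      using tendsto_add[OF tendsto_const[of a] LIMSEQ_Suc[OF lim_1_over_n]] by simp
    have *: "a * real (Suc n) \<le> real (Suc (nat \<lfloor>a * real (Suc n)\<rfloor>))"
      "real (Suc (nat \<lfloor>a * real (Suc n)\<rfloor>)) \<le> a * real (Suc n) + 1" for n
    proof -
      have "0 \<le> a * real (Suc n)" using that by simp
      then show "a * real (Suc n) \<le> real (Suc (nat \<lfloor>a * real (Suc n)\<rfloor>))"
        "real (Suc (nat \<lfloor>a * real (Suc n)\<rfloor>)) \<le> a * real (Suc n) + 1" by linarith+
    qed
    show "\<forall>\<^sub>F n in sequentially. a \<le> real (Suc (nat \<lfloor>a * real (Suc n)\<rfloor>)) / real (Suc n)"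
      using *(1) by (simp add: le_divide_eq del: of_nat_Suc)
    show "\<forall>\<^sub>F n in sequentially. real (Suc (nat \<lfloor>a * real (Suc n)\<rfloor>)) / real (Suc n) \<le> a + 1 / real (Suc n)"
    proof (rule always_eventually, rule allI)
      fix n
      have "real (Suc (nat \<lfloor>a * real (Suc n)\<rfloor>)) / real (Suc n) \<le> (a * real (Suc n) + 1) / real (Suc n)"
        by (rule divide_right_mono[OF *(2)]) simp
      also have "\<dots> = a + 1 / real (Suc n)" by (simp add: field_simps)
      finally show "real (Suc (nat \<lfloor>a * real (Suc n)\<rfloor>)) / real (Suc n) \<le> a + 1 / real (Suc n)" .
    qed
  qed simp
  have Y_lim: "(\<lambda>n. indicat_real B x * Y n x) \<longlonglongrightarrow> indicat_real B x * mart F (enn2real (\<rho> x)) x"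
    if x: "x \<in> space M" for x
    unfolding Y_def r_def[symmetric]
    by (intro tendsto_mult tendsto_const continuous_on_tendsto_compose[OF mart_continuous[OF F x]] time_lim)
      (auto simp: r_def)
  show meas: "(\<lambda>x. indicat_real B x * mart F (enn2real (\<rho> x)) x) \<in> borel_measurable M"
    by (rule borel_measurable_LIMSEQ_real[OF Y_lim Ym])
  have "(\<lambda>n. \<integral>x. indicat_real B x * Y n x \<partial>M) \<longlonglongrightarrow> (\<integral>x. indicat_real B x * mart F (enn2real (\<rho> x)) x \<partial>M)"
    by (rule integral_dominated_convergence[where w = "\<lambda>_. 1"])
      (use Ym meas Y_lim in \<open>auto intro!: AE_I2 mart_le simp: indicator_def Y_def\<close>)
  then show "(\<integral>x. indicat_real B x * F (U x, path_of W x) \<partial>M) =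
      (\<integral>x. indicat_real B x * mart F (enn2real (\<rho> x)) x \<partial>M)"
    unfolding YI[symmetric] by (simp add: LIMSEQ_const_iff)
qed

end

section \<open>Predictability of optional times\<close>

context randomized_brownian
begin

text \<open>The first passage of the martingale below the curve \<open>\<phi>\<close>, infinite if
  there is none. By continuity rational times see every crossing, and they keep the events
  measurable.\<close>

definition hit :: "(real \<times> (real \<Rightarrow> real) \<Rightarrow> real) \<Rightarrow> (real \<Rightarrow> real) \<Rightarrow> 'a \<Rightarrow> ennreal" where
  "hit F \<phi> x = (INF q\<in>{q\<in>\<rat>. 0 \<le> q \<and> mart F q x < \<phi> q}. ennreal q)"

lemma hit_less_iff: "hit F \<phi> x < s \<longleftrightarrow> (\<exists>q\<in>\<rat>. 0 \<le> q \<and> ennreal q < s \<and> mart F q x < \<phi> q)"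
  unfolding hit_def by (auto simp: INF_less_iff)

lemma hit_optional:
  assumes F: "pointwise_continuous F" and s: "0 \<le> s"
  shows "{x \<in> space M. hit F \<phi> x < ennreal s} \<in> sets (G (ennreal s))"
proof -
  have "{x \<in> space M. hit F \<phi> x < ennreal s} = (\<Union>q\<in>{q\<in>\<rat>. 0 \<le> q \<and> q < s}. {x \<in> space M. mart F q x < \<phi> q})"
    by (auto simp: hit_less_iff ennreal_less_iff)
  also have "\<dots> \<in> sets (G (ennreal s))"
  proof (rule sets.countable_UN')
    show "countable {q\<in>\<rat>. 0 \<le> q \<and> q < s}" by (rule countable_subset[OF _ countable_rat]) auto
    show "(\<lambda>q. {x \<in> space M. mart F q x < \<phi> q}) ` {q\<in>\<rat>. 0 \<le> q \<and> q < s} \<subseteq> sets (G (ennreal s))"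
    proof safe
      fix q :: real assume q: "0 \<le> q" "q < s"
      have "mart F q \<in> borel_measurable (G (ennreal s))"
        using mart_adapted[OF q(1) pointwise_continuous_measurable[OF F]]
        by (rule measurable_G_mono) (use q in \<open>auto intro: ennreal_leI\<close>)
      then have "{x \<in> space (G (ennreal s)). mart F q x < \<phi> q} \<in> sets (G (ennreal s))" by measurable
      then show "{x \<in> space M. mart F q x < \<phi> q} \<in> sets (G (ennreal s))" by simp
    qed
  qed
  finally show ?thesis .
qed

text \<open>By continuity the martingale is below the curve already slightly before
  \<open>t\<close>, whence the strict inequality; times before \<open>t\<close> exist because
  \<open>0 < t\<close>.\<close>

lemma hit_less:
  assumes F: "pointwise_continuous F" and x: "x \<in> space M" and \<phi>: "continuous_on {0..} \<phi>"
    and t: "0 < t" "mart F t x < \<phi> t"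
  shows "hit F \<phi> x < ennreal t"
proof -
  have "continuous_on {0..} (\<lambda>t. \<phi> t - mart F t x)"
    by (intro continuous_on_diff \<phi> mart_continuous[OF F x])
  moreover have "0 < \<phi> t - mart F t x" using t by simp
  ultimately obtain d where d: "d > 0" "\<And>s. 0 \<le> s \<Longrightarrow> dist s t < d \<Longrightarrow>
      dist (\<phi> s - mart F s x) (\<phi> t - mart F t x) < \<phi> t - mart F t x"
    unfolding continuous_on_iff using t by (metis atLeast_iff less_imp_le)
  have "max 0 (t - d) < t" using t d by simp
  from Rats_dense_in_real[OF this] obtain q where q: "q \<in> \<rat>" "0 < q" "t - d < q" "q < t" by auto
  have "dist (\<phi> q - mart F q x) (\<phi> t - mart F t x) < \<phi> t - mart F t x"
    by (rule d(2)) (use q in \<open>auto simp: dist_real_def\<close>)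
  then have "mart F q x < \<phi> q" by (simp add: dist_real_def)
  with q show ?thesis unfolding hit_less_iff by (intro bexI[of _ q]) (auto simp: ennreal_less_iff)
qed

text \<open>Otherwise the martingale would stay above the curve for a while after the passage,
  although passages occur at rationals arbitrarily close to the infimum.\<close>

lemma mart_at_hit:
  assumes F: "pointwise_continuous F" and x: "x \<in> space M" and \<phi>: "continuous_on {0..} \<phi>"
    and fin: "hit F \<phi> x < \<infinity>"
  shows "mart F (enn2real (hit F \<phi> x)) x \<le> \<phi> (enn2real (hit F \<phi> x))"
proof (rule ccontr)
  define t where "t = enn2real (hit F \<phi> x)"
  have t: "0 \<le> t" "hit F \<phi> x = ennreal t" using fin by (auto simp: t_def)
  assume "\<not> mart F (enn2real (hit F \<phi> x)) x \<le> \<phi> (enn2real (hit F \<phi> x))"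
  then have pos: "0 < mart F t x - \<phi> t" by (simp add: t_def)
  have "continuous_on {0..} (\<lambda>t. mart F t x - \<phi> t)"
    by (intro continuous_on_diff \<phi> mart_continuous[OF F x])
  with pos t(1) obtain d where d: "d > 0" "\<And>s. 0 \<le> s \<Longrightarrow> dist s t < d \<Longrightarrow>
      dist (mart F s x - \<phi> s) (mart F t x - \<phi> t) < mart F t x - \<phi> t"
    unfolding continuous_on_iff by (metis atLeast_iff)
  have "hit F \<phi> x < ennreal (t + d)" using t d by (simp add: ennreal_less_iff)
  then obtain q where q: "q \<in> \<rat>" "0 \<le> q" "ennreal q < ennreal (t + d)" "mart F q x < \<phi> q"
    unfolding hit_less_iff by blast
  have "hit F \<phi> x \<le> ennreal q" unfolding hit_def using q by (intro INF_lower) auto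
  then have "t \<le> q" "q < t + d" using q t by (auto simp: ennreal_less_iff)
  then have "dist (mart F q x - \<phi> q) (mart F t x - \<phi> t) < mart F t x - \<phi> t"
    using q by (intro d(2)) (auto simp: dist_real_def)
  with q show False by (simp add: dist_real_def)
qed

text \<open>A rational \<open>q < s\<close> separates \<open>\<theta>\<close> from the minimum of
  \<open>\<tau>\<close> and \<open>s\<close>, and the event \<open>\<theta> < q \<le> \<tau>\<close>
  is known at time \<open>q\<close>. The minimum is used because \<open>\<tau>\<close> may be
  infinite.\<close>

lemma optional_less_Int:
  fixes \<theta> \<tau> :: "'a \<Rightarrow> ennreal"
  assumes \<theta>: "\<And>s. 0 \<le> s \<Longrightarrow> {x \<in> space M. \<theta> x < ennreal s} \<in> sets (G (ennreal s))"
    and \<tau>: "\<And>s. 0 \<le> s \<Longrightarrow> {x \<in> space M. \<tau> x < ennreal s} \<in> sets (G (ennreal s))"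
    and s: "0 \<le> s"
  shows "{x \<in> space M. \<theta> x < \<tau> x \<and> \<theta> x < ennreal s} \<in> sets (G (ennreal s))"
proof -
  have *: "\<exists>q\<in>\<rat>. 0 \<le> q \<and> q < s \<and> \<theta> x < ennreal q \<and> \<not> \<tau> x < ennreal q" if "\<theta> x < \<tau> x" "\<theta> x < ennreal s" for x
  proof -
    define a b where "a = enn2real (\<theta> x)" and "b = enn2real (min (\<tau> x) (ennreal s))"
    have a: "\<theta> x = ennreal a" "0 \<le> a" using that unfolding a_def by (cases "\<theta> x") auto
    have b: "min (\<tau> x) (ennreal s) = ennreal b" "0 \<le> b"
    proof -
      have "min (\<tau> x) (ennreal s) < top" by (simp add: min_less_iff_disj)
      then show "min (\<tau> x) (ennreal s) = ennreal b" by (simp add: b_def)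
    qed (simp add: b_def)
    have "ennreal a < ennreal b" using that unfolding a(1)[symmetric] b(1)[symmetric] by simp
    then have "a < b" using a by (simp add: ennreal_less_iff)
    from Rats_dense_in_real[OF this] obtain q where q: "q \<in> \<rat>" "a < q" "q < b" by blast
    have "ennreal q < ennreal b" using q a by (simp add: ennreal_less_iff)
    then have "ennreal q < \<tau> x" "ennreal q < ennreal s" unfolding b(1)[symmetric] by auto
    then show ?thesis using q a by (intro bexI[of _ q]) (auto simp: ennreal_less_iff)
  qed
  have **: "\<theta> x < \<tau> x \<and> \<theta> x < ennreal s"
    if "q < s" "\<theta> x < ennreal q" "\<not> \<tau> x < ennreal q" for q x
    using that ennreal_leI[of q s] by (auto simp: not_less)
  have "{x \<in> space M. \<theta> x < \<tau> x \<and> \<theta> x < ennreal s} =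
      (\<Union>q\<in>{q\<in>\<rat>. 0 \<le> q \<and> q < s}. {x \<in> space M. \<theta> x < ennreal q} - {x \<in> space M. \<tau> x < ennreal q})"
    using * ** by blast
  also have "\<dots> \<in> sets (G (ennreal s))"
  proof (rule sets.countable_UN')
    show "countable {q\<in>\<rat>. 0 \<le> q \<and> q < s}" by (rule countable_subset[OF _ countable_rat]) auto
    show "(\<lambda>q. {x \<in> space M. \<theta> x < ennreal q} - {x \<in> space M. \<tau> x < ennreal q}) `
        {q\<in>\<rat>. 0 \<le> q \<and> q < s} \<subseteq> sets (G (ennreal s))"
      by safe (intro sets.Diff sets_G_mono[OF \<theta>] sets_G_mono[OF \<tau>] ennreal_leI; simp)
  qed
  finally show ?thesis .
qed

text \<open>The strict increase of the announcing sequence is what removes the need for right-continuity: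
  on \<open>{\<eta>\<^sub>j < \<sigma> for all j}\<close> the event \<open>{\<sigma> \<le> t}\<close> is decided by the events \<open>{\<eta>\<^sub>j < t}\<close>. The null set
  where the sequence becomes constant is sent to infinity.\<close>

lemma stopping_time_announced:
  fixes \<theta> :: "nat \<Rightarrow> 'a \<Rightarrow> ennreal" and \<tau> :: "'a \<Rightarrow> ennreal"
  assumes \<theta>: "\<And>i s. 0 \<le> s \<Longrightarrow> {x \<in> space M. \<theta> i x < ennreal s} \<in> sets (G (ennreal s))"
    and less: "AE x in M. \<forall>\<^sub>F i in sequentially. \<theta> i x < \<tau> x"
    and ge: "AE x in M. \<forall>r. r < \<tau> x \<longrightarrow> (\<forall>\<^sub>F i in sequentially. r \<le> \<theta> i x)"
  shows "\<exists>\<sigma>. stopping_time G \<sigma> \<and> (AE x in M. \<sigma> x = \<tau> x)"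
proof -
  \<comment> \<open>Tail infima make the announcing sequence increasing and keep it strictly below
    \<open>\<tau>\<close>: one term with \<open>\<theta> i x < \<tau> x\<close> and
    \<open>i \<ge> j\<close> bounds \<open>\<eta> j x\<close>.\<close>
  define \<eta> where "\<eta> j x = (INF i\<in>{j..}. \<theta> i x)" for j :: nat and x
  define \<sigma> where "\<sigma> x = (if \<forall>j. \<exists>i. \<eta> j x < \<eta> i x then SUP j. \<eta> j x else \<infinity>)" for x
  have \<eta>: "{x \<in> space M. \<eta> j x < ennreal s} \<in> sets (G (ennreal s))" if "0 \<le> s" for j s
  proof -
    have "{x \<in> space M. \<eta> j x < ennreal s} = (\<Union>i\<in>{j..}. {x \<in> space M. \<theta> i x < ennreal s})"
      by (auto simp: \<eta>_def INF_less_iff)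
    then show ?thesis using \<theta>[OF that] by auto
  qed
  have "stopping_time G \<sigma>"
  proof
    fix t
    show "Measurable.pred (G t) (\<lambda>x. \<sigma> x \<le> t)"
    proof (cases "t = \<infinity>")
      case False
      then obtain s where s: "t = ennreal s" "0 \<le> s" by (cases t) auto
      \<comment> \<open>A term equal to \<open>t\<close> would be exceeded by another one, so the
        supremum is at most \<open>t\<close> exactly if all terms stay strictly below
        \<open>t\<close>; strict events are the ones known at time \<open>t\<close>.\<close>
      have iff: "\<sigma> x \<le> t \<longleftrightarrow> (\<forall>j. \<exists>i. \<eta> j x < \<eta> i x \<and> \<eta> i x < t)" for x
      proof
        assume le: "\<sigma> x \<le> t"
        then have inc: "\<forall>j. \<exists>i. \<eta> j x < \<eta> i x" using False by (auto simp: \<sigma>_def top_unique split: if_splits)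
        then have "\<eta> i x < t" for i
        proof -
          obtain i' where "\<eta> i x < \<eta> i' x" using inc by blast
          also have "\<eta> i' x \<le> \<sigma> x" using inc by (auto simp: \<sigma>_def intro: SUP_upper)
          finally show ?thesis using le by simp
        qed
        with inc show "\<forall>j. \<exists>i. \<eta> j x < \<eta> i x \<and> \<eta> i x < t" by blast
      next
        assume *: "\<forall>j. \<exists>i. \<eta> j x < \<eta> i x \<and> \<eta> i x < t"
        then have "\<eta> j x \<le> t" for j by (metis less_imp_le less_trans)
        with * show "\<sigma> x \<le> t" by (auto simp: \<sigma>_def intro: SUP_least)
      qed
      \<comment> \<open>\<open>\<eta> j x < t\<close> follows from the other two conditions; it is
        inserted to match \<open>optional_less_Int\<close>.\<close>
      have "{x \<in> space M. \<sigma> x \<le> t} = (\<Inter>j. \<Union>i. {x \<in> space M. \<eta> j x < \<eta> i x \<and> \<eta> j x < t} \<inter> {x \<in> space M. \<eta> i x < t})"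
        unfolding iff by (auto intro: less_trans)
      also have "\<dots> \<in> sets (G t)"
        unfolding s(1) using \<eta> optional_less_Int[OF \<eta> \<eta> s(2)] s(2)
        by (intro sets.countable_INT' sets.countable_UN' image_subsetI sets.Int) auto
      finally show ?thesis by (simp add: pred_def)
    qed simp
  qed
  moreover have "AE x in M. \<sigma> x = \<tau> x"
    using less ge
  proof eventually_elim
    case (elim x)
    have \<eta>_less: "\<eta> j x < \<tau> x" for j
    proof -
      obtain i where "\<forall>k\<ge>i. \<theta> k x < \<tau> x" using elim(1) by (auto simp: eventually_sequentially)
      then have "\<theta> (max i j) x < \<tau> x" by simp
      moreover have "\<eta> j x \<le> \<theta> (max i j) x" unfolding \<eta>_def by (rule INF_lower) simp
      ultimately show ?thesis by simp
    qed
    have \<eta>_ge: "\<exists>i. r \<le> \<eta> i x" if r: "r < \<tau> x" for r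
    proof -
      obtain i where "\<forall>k\<ge>i. r \<le> \<theta> k x"
        using elim(2)[rule_format, OF r] unfolding eventually_sequentially by blast
      then show ?thesis unfolding \<eta>_def by (intro exI[of _ i] INF_greatest) auto
    qed
    \<comment> \<open>Between \<open>\<eta> j x\<close> and \<open>\<tau> x\<close> there is room
      for some \<open>r\<close>, which some term reaches.\<close>
    have inc: "\<forall>j. \<exists>i. \<eta> j x < \<eta> i x"
    proof
      fix j
      obtain r where "\<eta> j x < r" "r < \<tau> x" using dense[OF \<eta>_less] by blast
      with \<eta>_ge[of r] show "\<exists>i. \<eta> j x < \<eta> i x" by (meson less_le_trans)
    qed
    have "(SUP j. \<eta> j x) = \<tau> x"
    proof (rule antisym)
      show "(SUP j. \<eta> j x) \<le> \<tau> x" using \<eta>_less by (intro SUP_least less_imp_le)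
      show "\<tau> x \<le> (SUP j. \<eta> j x)"
      proof (rule dense_le)
        fix r assume "r < \<tau> x"
        with \<eta>_ge obtain i where "r \<le> \<eta> i x" by blast
        also have "\<dots> \<le> (SUP j. \<eta> j x)" by (rule SUP_upper) simp
        finally show "r \<le> (SUP j. \<eta> j x)" .
      qed
    qed
    with inc show ?case by (simp add: \<sigma>_def)
  qed
  ultimately show ?thesis by blast
qed

lemma optional_measurable:
  assumes "\<And>s. 0 \<le> s \<Longrightarrow> {x \<in> space M. \<theta> x < ennreal s} \<in> sets (G (ennreal s))"
  shows "\<theta> \<in> borel_measurable M"
proof (rule borel_measurableI_less)
  fix y :: ennreal
  have *: "{x \<in> space M. \<theta> x < ennreal s} \<in> sets M" if "0 \<le> s" for s
    by (rule sets_G_subset[OF assms[OF that]])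
  show "{x \<in> space M. \<theta> x < y} \<in> sets M"
  proof (cases y)
    case top
    have "z < top \<longleftrightarrow> (\<exists>n::nat. z < ennreal (real n))" for z :: ennreal
      by (cases z) (auto simp: ennreal_less_iff reals_Archimedean2)
    then have "{x \<in> space M. \<theta> x < y} = (\<Union>n::nat. {x \<in> space M. \<theta> x < ennreal (real n)})"
      using top by auto
    also have "\<dots> \<in> sets M" using * by auto
    finally show ?thesis .
  qed (use * in auto)
qed

text \<open>With \<open>Z = 1 - exp(-\<tau>)\<close> and functionals \<open>F\<^sub>j\<close> such that \<open>E|F\<^sub>j - Z| < 4\<^sup>-\<^sup>j\<close>, the announcing times are
  the first times at which the martingale of \<open>F\<^sub>j\<close> drops below \<open>1 - exp(-t) + 2\<^sup>-\<^sup>j\<close>. Optional stopping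
  at these times and at \<open>\<tau>\<close> bounds, respectively, how much too early and how likely too late they
  are; both errors are summable.\<close>

lemma predictable_modification:
  fixes \<tau> :: "'a \<Rightarrow> ennreal"
  assumes \<tau>: "\<And>s. 0 \<le> s \<Longrightarrow> {x \<in> space M. \<tau> x < ennreal s} \<in> sets (G (ennreal s))"
    and pos: "AE x in M. 0 < \<tau> x" and fin: "AE x in M. \<tau> x < \<infinity>"
    and approx: "\<And>e. 0 < e \<Longrightarrow> \<exists>F. pointwise_continuous F \<and>
      (\<integral>x. \<bar>F (U x, path_of W x) - (1 - exp (- enn2real (\<tau> x)))\<bar> \<partial>M) < e"
  shows "\<exists>\<sigma>. stopping_time G \<sigma> \<and> (AE x in M. \<sigma> x = \<tau> x)"
proof -
  define \<phi> :: "real \<Rightarrow> real" where "\<phi> t = 1 - exp (- t)" for t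
  define Z where "Z x = \<phi> (enn2real (\<tau> x))" for x
  have \<phi>_bound: "0 \<le> \<phi> t" "\<phi> t \<le> 1" if "0 \<le> t" for t using that by (auto simp: \<phi>_def)
  have \<phi>_less: "\<phi> s < \<phi> t \<longleftrightarrow> s < t" for s t by (simp add: \<phi>_def)
  \<comment> \<open>The accuracy \<open>(1/4)^j\<close> is the square of the margin
    \<open>(1/2)^j\<close> used below, so that Markov's inequality still leaves the summable bound
    \<open>(1/2)^j\<close>.\<close>
  have "\<exists>F. pointwise_continuous F \<and> (\<integral>x. \<bar>F (U x, path_of W x) - Z x\<bar> \<partial>M) < (1/4) ^ j" for j :: nat
    using approx[of "(1/4) ^ j"] by (simp add: Z_def \<phi>_def)
  then obtain F where F: "\<And>j. pointwise_continuous (F j)"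
    and FZ: "\<And>j::nat. (\<integral>x. \<bar>F j (U x, path_of W x) - Z x\<bar> \<partial>M) < (1/4) ^ j" by metis
  define \<psi> where "\<psi> j t = \<phi> t + (1/2) ^ j" for j :: nat and t
  have \<psi>_cont: "continuous_on {0..} (\<psi> j)" for j
    unfolding \<psi>_def \<phi>_def by (intro continuous_intros)
  define \<theta> where "\<theta> j = hit (F j) (\<psi> j)" for j
  have \<theta>: "{x \<in> space M. \<theta> j x < ennreal s} \<in> sets (G (ennreal s))" if "0 \<le> s" for j s
    unfolding \<theta>_def by (rule hit_optional[OF F that])
  have [measurable]: "\<tau> \<in> borel_measurable M" by (rule optional_measurable[OF \<tau>])
  have [measurable]: "\<theta> j \<in> borel_measurable M" for j by (rule optional_measurable[OF \<theta>])
  have [measurable]: "F j \<in> borel_measurable UC_borel" for j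
    by (rule pointwise_continuous_measurable[OF F])
  have [measurable]: "\<phi> \<in> borel_measurable borel" unfolding \<phi>_def by measurable
  have Zm [measurable]: "Z \<in> borel_measurable M" unfolding Z_def by measurable
  define f where "f j x = F j (U x, path_of W x)" for j x
  have fm [measurable]: "f j \<in> borel_measurable M" for j unfolding f_def by measurable
  have f_bound: "0 \<le> f j x" "f j x \<le> 1" if "x \<in> space M" for j x
    using that pointwise_continuous_nonneg[OF F] pointwise_continuous_le_1[OF F] by (auto simp: f_def)
  have Z_bound: "0 \<le> Z x" "Z x \<le> 1" for x by (auto simp: Z_def intro: \<phi>_bound)
  have int1: "integrable M h" if "h \<in> borel_measurable M" "\<And>x. x \<in> space M \<Longrightarrow> \<bar>h x\<bar> \<le> 2" for h :: "'a \<Rightarrow> real"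
    by (rule integrable_const_bound[where B = 2]) (use that in auto)
  have fZ_le: "(\<integral>x. \<bar>f j x - Z x\<bar> \<partial>M) < (1/4) ^ j" for j using FZ by (simp add: f_def)
  have f_le2: "\<bar>f j x\<bar> \<le> 2" if "x \<in> space M" for j x
    using f_bound[OF that, of j] by linarith
  have Z_le2: "\<bar>Z x\<bar> \<le> 2" for x
    using Z_bound[of x] by linarith
  have diff_le: "\<bar>f j x - Z x\<bar> \<le> 2" if "x \<in> space M" for j x
    using f_bound[OF that, of j] Z_bound[of x] by linarith
  have ind_le: "\<bar>\<integral>x. indicat_real B x * (f j x - Z x) \<partial>M\<bar> \<le> (1/4) ^ j" if [measurable]: "B \<in> sets M" for B j
  proof -
    have "\<bar>\<integral>x. indicat_real B x * (f j x - Z x) \<partial>M\<bar> \<le> (\<integral>x. \<bar>indicat_real B x * (f j x - Z x)\<bar> \<partial>M)"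
      by (rule integral_abs_bound)
    also have "\<dots> \<le> (\<integral>x. \<bar>f j x - Z x\<bar> \<partial>M)"
      by (intro integral_mono int1) (auto simp: indicator_def intro: diff_le)
    finally show ?thesis using fZ_le[of j] by linarith
  qed
  \<comment> \<open>On \<open>B j\<close> the passage comes before \<open>\<tau>\<close>, as it
    should; on \<open>B' j\<close> it comes too late. \<open>optional_stopping\<close> applies on
    the former at \<open>\<theta> j\<close> and on the latter at \<open>\<tau>\<close>.\<close>
  define B where "B j = {x \<in> space M. \<theta> j x < \<tau> x}" for j
  define B' where "B' j = {x \<in> space M. \<not> \<theta> j x < \<tau> x \<and> \<tau> x < \<infinity>}" for j
  have B_opt: "{x \<in> B j. \<theta> j x < ennreal s} \<in> sets (G (ennreal s))" if "0 \<le> s" for j s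
    using optional_less_Int[OF \<theta> \<tau> that, of j] by (simp add: B_def conj_assoc)
  have B'_opt: "{x \<in> B' j. \<tau> x < ennreal s} \<in> sets (G (ennreal s))" if "0 \<le> s" for j s
  proof -
    have "{x \<in> B' j. \<tau> x < ennreal s} = {x \<in> space M. \<tau> x < ennreal s} - {x \<in> space M. \<theta> j x < \<tau> x \<and> \<theta> j x < ennreal s}"
      by (auto simp: B'_def less_top intro: less_trans)
    then show ?thesis using \<tau>[OF that] optional_less_Int[OF \<theta> \<tau> that, of j] by auto
  qed
  have B_fin: "x \<in> space M \<and> \<theta> j x < \<infinity>" if "x \<in> B j" for j x
    using that by (auto simp: B_def intro: less_le_trans)
  have B'_fin: "x \<in> space M \<and> \<tau> x < \<infinity>" if "x \<in> B' j" for j x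
    using that by (auto simp: B'_def)
  note OS = optional_stopping[OF F B_fin B_opt, simplified] and OS' = optional_stopping[OF F B'_fin B'_opt, simplified]
  have Bm [measurable]: "B j \<in> sets M" for j by (rule OS(3))
  have B'm [measurable]: "B' j \<in> sets M" for j by (rule OS'(3))
  \<comment> \<open>How early the passage is, measured in the bounded scale
    \<open>\<phi>\<close>.\<close>
  define h where "h j x = indicat_real (B j) x * (Z x - \<phi> (enn2real (\<theta> j x)))" for j x
  have hm [measurable]: "h j \<in> borel_measurable M" for j unfolding h_def by measurable
  have h_bound: "\<bar>h j x\<bar> \<le> 2" for j x
    using Z_bound[of x] \<phi>_bound[of "enn2real (\<theta> j x)"] by (auto simp: h_def indicator_def)
  have h_nonneg: "AE x in M. 0 \<le> h j x" for j
    using fin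
  proof eventually_elim
    case (elim x)
    have "enn2real (\<theta> j x) \<le> enn2real (\<tau> x)" if "x \<in> B j"
      using that elim by (intro enn2real_mono) (auto simp: B_def)
    then have "\<phi> (enn2real (\<theta> j x)) \<le> Z x" if "x \<in> B j"
      using that \<phi>_less unfolding Z_def by (meson not_less)
    then show ?case by (simp add: h_def indicator_def)
  qed
  \<comment> \<open>On \<open>B j\<close> the stopped martingale is at most
    \<open>\<phi>(\<theta>) + (1/2)^j\<close>, and its integral is that of \<open>f j\<close>, which
    differs from the one of \<open>Z\<close> by at most \<open>(1/4)^j\<close>.\<close>
  have h_le: "(\<integral>x. h j x \<partial>M) \<le> 2 * (1/2) ^ j" for j
  proof -
    have m_le: "mart (F j) (enn2real (\<theta> j x)) x \<le> \<psi> j (enn2real (\<theta> j x))" if "x \<in> B j" for x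
      using mart_at_hit[OF F _ \<psi>_cont, of x j] B_fin[OF that] by (simp add: \<theta>_def)
    have mb: "\<bar>mart (F j) (enn2real (\<theta> j x)) x\<bar> \<le> 1" if "x \<in> space M" for x
      by (rule mart_bound[where K = 1]) (use that in \<open>auto intro: pointwise_continuous_abs_le_1[OF F]\<close>)
    have \<psi>b: "\<bar>\<psi> j t\<bar> \<le> 2" if "0 \<le> t" for t
      using \<phi>_bound[OF that] power_le_one[of "1/2::real" j] zero_le_power[of "1/2::real" j] unfolding \<psi>_def
      by linarith
    have "(\<integral>x. indicat_real (B j) x * f j x \<partial>M) =
        (\<integral>x. indicat_real (B j) x * mart (F j) (enn2real (\<theta> j x)) x \<partial>M)"
      using OS(1)[of j] by (simp add: f_def)
    also have "\<dots> \<le> (\<integral>x. indicat_real (B j) x * \<psi> j (enn2real (\<theta> j x)) \<partial>M)"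
    proof (intro integral_mono int1)
      show "(\<lambda>x. indicat_real (B j) x * mart (F j) (enn2real (\<theta> j x)) x) \<in> borel_measurable M"
        by (rule OS(2))
      show "(\<lambda>x. indicat_real (B j) x * \<psi> j (enn2real (\<theta> j x))) \<in> borel_measurable M"
        unfolding \<psi>_def by measurable
      show "\<bar>indicat_real (B j) x * mart (F j) (enn2real (\<theta> j x)) x\<bar> \<le> 2" if "x \<in> space M" for x
        using mb[OF that] by (auto simp: indicator_def)
      show "\<bar>indicat_real (B j) x * \<psi> j (enn2real (\<theta> j x))\<bar> \<le> 2" if "x \<in> space M" for x
        using \<psi>b[of "enn2real (\<theta> j x)"] by (auto simp: indicator_def)
    qed (use m_le in \<open>auto simp: indicator_def\<close>)
    finally have 1: "(\<integral>x. indicat_real (B j) x * f j x \<partial>M) \<le> (\<integral>x. indicat_real (B j) x * \<psi> j (enn2real (\<theta> j x)) \<partial>M)" .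
    have i1: "integrable M (\<lambda>x. indicat_real (B j) x * f j x)"
      by (rule int1) (use f_le2 in \<open>auto simp: indicator_def\<close>)
    have i2: "integrable M (\<lambda>x. indicat_real (B j) x * \<psi> j (enn2real (\<theta> j x)))"
      by (rule int1) (auto simp: \<psi>_def[abs_def] indicator_def, use \<psi>b in \<open>simp add: \<psi>_def\<close>)
    have i3: "integrable M (\<lambda>x. indicat_real (B j) x * (f j x - Z x))"
      by (rule int1) (use diff_le in \<open>auto simp: indicator_def\<close>)
    have i4: "integrable M (\<lambda>x. indicat_real (B j) x * (1/2) ^ j)"
      by (rule int1) (auto simp: indicator_def power_le_one intro: order_trans[OF power_le_one])
    have "(\<integral>x. h j x \<partial>M) = (\<integral>x. indicat_real (B j) x * f j x - indicat_real (B j) x * \<psi> j (enn2real (\<theta> j x))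
        - indicat_real (B j) x * (f j x - Z x) + indicat_real (B j) x * (1/2) ^ j \<partial>M)"
      by (intro Bochner_Integration.integral_cong refl) (simp add: h_def \<psi>_def algebra_simps)
    also have "\<dots> = (\<integral>x. indicat_real (B j) x * f j x \<partial>M) - (\<integral>x. indicat_real (B j) x * \<psi> j (enn2real (\<theta> j x)) \<partial>M)
        - (\<integral>x. indicat_real (B j) x * (f j x - Z x) \<partial>M) + (\<integral>x. indicat_real (B j) x * (1/2) ^ j \<partial>M)"
      by (simp only: Bochner_Integration.integral_add Bochner_Integration.integral_diff
          Bochner_Integration.integrable_add Bochner_Integration.integrable_diff i1 i2 i3 i4)
    also have "(\<integral>x. indicat_real (B j) x * (1/2) ^ j \<partial>M) = prob (B j) * (1/2) ^ j" by simp
    also have "prob (B j) * (1/2) ^ j \<le> 1 * (1/2) ^ j" by (intro mult_right_mono) auto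
    finally have "(\<integral>x. h j x \<partial>M) \<le> (1/4) ^ j + (1/2) ^ j"
      using 1 ind_le[of "B j" j] by simp
    also have "(1/4) ^ j \<le> (1/2 :: real) ^ j" by (rule power_mono) auto
    finally show ?thesis by simp
  qed
  \<comment> \<open>On \<open>B' j\<close> the martingale has not passed below
    \<open>\<psi> j\<close> by time \<open>\<tau>\<close>, hence exceeds \<open>Z\<close> there by
    at least \<open>(1/2)^j\<close>, while the integrals differ by at most
    \<open>(1/4)^j\<close>.\<close>
  have B'_le: "prob (B' j) \<le> (1/2) ^ j" for j
  proof -
    have mb: "\<bar>mart (F j) (enn2real (\<tau> x)) x\<bar> \<le> 2" if "x \<in> space M" for x
      by (rule order_trans[OF mart_bound[where K = 1]]) (use that in \<open>auto intro: pointwise_continuous_abs_le_1[OF F]\<close>)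
    have i1: "integrable M (\<lambda>x. indicat_real (B' j) x * mart (F j) (enn2real (\<tau> x)) x)"
      by (rule int1[OF OS'(2)]) (use mb in \<open>auto simp: indicator_def\<close>)
    have i2: "integrable M (\<lambda>x. indicat_real (B' j) x * Z x)"
      by (rule int1) (use Z_le2 in \<open>auto simp: indicator_def\<close>)
    have i3: "integrable M (\<lambda>x. indicat_real (B' j) x * f j x)"
      by (rule int1) (use f_le2 in \<open>auto simp: indicator_def\<close>)
    have i4: "integrable M (\<lambda>x. indicat_real (B' j) x * (1/2) ^ j)"
      by (rule int1) (auto simp: indicator_def power_le_one intro: order_trans[OF power_le_one])
    have "(1/2) ^ j * prob (B' j) = (\<integral>x. indicat_real (B' j) x * (1/2) ^ j \<partial>M)" by simp
    also have "\<dots> \<le> (\<integral>x. indicat_real (B' j) x * mart (F j) (enn2real (\<tau> x)) x - indicat_real (B' j) x * Z x \<partial>M)"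
    proof (rule integral_mono_AE[OF i4 Bochner_Integration.integrable_diff[OF i1 i2]])
      show "AE x in M. indicat_real (B' j) x * (1/2) ^ j \<le>
          indicat_real (B' j) x * mart (F j) (enn2real (\<tau> x)) x - indicat_real (B' j) x * Z x"
        using pos
      proof (eventually_elim)
        case (elim x)
        have "\<psi> j (enn2real (\<tau> x)) \<le> mart (F j) (enn2real (\<tau> x)) x" if "x \<in> B' j"
        proof (rule ccontr)
          assume "\<not> ?thesis"
          moreover have "x \<in> space M" "ennreal (enn2real (\<tau> x)) = \<tau> x" "0 < enn2real (\<tau> x)"
            using that elim by (auto simp: B'_def enn2real_positive_iff less_top)
          ultimately have "\<theta> j x < \<tau> x"
            using hit_less[OF F _ \<psi>_cont, of x "enn2real (\<tau> x)" j] by (simp add: \<theta>_def)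
          with that show False by (simp add: B'_def)
        qed
        then show ?case by (auto simp: indicator_def \<psi>_def Z_def)
      qed
    qed
    also have "\<dots> = (\<integral>x. indicat_real (B' j) x * mart (F j) (enn2real (\<tau> x)) x \<partial>M) - (\<integral>x. indicat_real (B' j) x * Z x \<partial>M)"
      by (rule Bochner_Integration.integral_diff[OF i1 i2])
    also have "(\<integral>x. indicat_real (B' j) x * mart (F j) (enn2real (\<tau> x)) x \<partial>M) = (\<integral>x. indicat_real (B' j) x * f j x \<partial>M)"
      using OS'(1)[of j] by (simp add: f_def)
    also have "\<dots> - (\<integral>x. indicat_real (B' j) x * Z x \<partial>M) = (\<integral>x. indicat_real (B' j) x * (f j x - Z x) \<partial>M)"
      by (simp add: right_diff_distrib Bochner_Integration.integral_diff[OF i3 i2])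
    also have "\<dots> \<le> (1/4) ^ j" using ind_le[of "B' j" j] by simp
    also have "(1/4) ^ j = (1/2 :: real) ^ j * (1/2) ^ j" by (simp flip: power_mult_distrib)
    finally show ?thesis by simp
  qed
  have h0: "AE x in M. (\<lambda>j. ennreal (h j x)) \<longlonglongrightarrow> 0"
  proof (rule AE_tendsto_0_of_summable)
    show "(\<integral>\<^sup>+x. ennreal (h j x) \<partial>M) \<le> ennreal (2 * (1/2) ^ j)" for j
      by (subst nn_integral_eq_integral[OF int1 h_nonneg]) (use h_le h_bound in \<open>auto intro: ennreal_leI\<close>)
    show "summable (\<lambda>j. 2 * (1/2 :: real) ^ j)" by (intro summable_mult summable_geometric) simp
  qed auto
  have ind0: "AE x in M. (\<lambda>j. indicator (B' j) x :: ennreal) \<longlonglongrightarrow> 0"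
  proof (rule AE_tendsto_0_of_summable)
    show "(\<integral>\<^sup>+x. indicator (B' j) x \<partial>M) \<le> ennreal ((1/2) ^ j)" for j
      using B'_le[of j] by (simp add: emeasure_eq_measure ennreal_leI)
    show "summable (\<lambda>j. (1/2 :: real) ^ j)" by (rule summable_geometric) simp
  qed auto
  have less: "AE x in M. \<forall>\<^sub>F j in sequentially. \<theta> j x < \<tau> x"
    using ind0 fin AE_space
  proof eventually_elim
    case (elim x)
    from order_tendstoD(2)[OF elim(1), of 1] have "\<forall>\<^sub>F j in sequentially. x \<notin> B' j"
      by (auto simp: indicator_def elim!: eventually_mono split: if_splits)
    then show ?case using elim by (auto simp: B'_def elim!: eventually_mono)
  qed
  show ?thesis
  proof (rule stopping_time_announced[OF \<theta> less])
    show "AE x in M. \<forall>r. r < \<tau> x \<longrightarrow> (\<forall>\<^sub>F j in sequentially. r \<le> \<theta> j x)"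
      using h0 fin less AE_space
    proof eventually_elim
      case (elim x)
      show ?case
      proof (intro allI impI)
        fix r assume r: "r < \<tau> x"
        define a b where "a = enn2real (\<tau> x)" and "b = enn2real r"
        have a: "\<tau> x = ennreal a" using elim by (simp add: a_def)
        have b: "r = ennreal b" "0 \<le> b" using r unfolding b_def by (cases r; auto)+
        have "b < a" using r b unfolding a by (simp add: ennreal_less_iff)
        \<comment> \<open>Strict monotonicity of \<open>\<phi>\<close> turns the convergence of
          \<open>h j x\<close> to 0 into \<open>r \<le> \<theta> j x\<close> for large
          \<open>j\<close>.\<close>
        then have "0 < \<phi> a - \<phi> b" using \<phi>_less by simp
        then have "0 < ennreal (\<phi> a - \<phi> b)" by simp
        from order_tendstoD(2)[OF elim(1) this] elim(3)
        show "\<forall>\<^sub>F j in sequentially. r \<le> \<theta> j x"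
        proof eventually_elim
          case (elim j)
          then have "x \<in> B j" using \<open>x \<in> space M\<close> by (simp add: B_def)
          then have "h j x = \<phi> a - \<phi> (enn2real (\<theta> j x))" by (simp add: h_def Z_def a_def)
          with elim(1) \<open>0 < \<phi> a - \<phi> b\<close> have "\<phi> b < \<phi> (enn2real (\<theta> j x))"
            by (simp add: ennreal_less_iff ennreal_lessI less_le_not_le)
              (smt (verit) ennreal_leI leD)
          then have "b < enn2real (\<theta> j x)" using \<phi>_less by simp
          moreover have "\<theta> j x = ennreal (enn2real (\<theta> j x))" using B_fin[OF \<open>x \<in> B j\<close>] by simp
          ultimately show ?case unfolding b(1) by (metis ennreal_leI less_imp_le)
        qed
      qed
    qed
  qed
qed

end

section \<open>Approximation by continuous functionals\<close>

text \<open>Product sets in \<open>u\<close> and half-lines of single coordinates are the sets whose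
  indicators can be treated by hand; this inclusion lets an induction over generated sets start from
  them.\<close>

lemma sets_borel_C0_borel_subset:
  "sets UC_borel \<subseteq> sigma_sets (UNIV \<times> C0)
     ({A \<times> C0 | A. A \<in> sets (borel :: real measure)} \<union> {UNIV \<times> {w \<in> C0. w s < a} | s a :: real. 0 \<le> s})"
    (is "_ \<subseteq> sigma_sets ?\<Omega> ?E")
proof
  define N where "N = sigma ?\<Omega> ?E"
  have "?E \<subseteq> Pow ?\<Omega>" by auto
  then have N: "space N = ?\<Omega>" "sets N = sigma_sets ?\<Omega> ?E"
    unfolding N_def by (auto simp: space_measure_of_conv)
  have fst_m: "fst \<in> borel_measurable N"
  proof (rule measurableI)
    fix A :: "real set" assume A: "A \<in> sets borel"
    have "fst -` A \<inter> space N = A \<times> C0" by (auto simp: N(1))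
    then show "fst -` A \<inter> space N \<in> sets N" unfolding N(2) using A by (auto intro!: sigma_sets.Basic)
  qed simp
  have snd_m: "snd \<in> N \<rightarrow>\<^sub>M C0_borel"
  proof (rule measurable_C0_borel)
    fix s :: real assume s: "0 \<le> s"
    show "(\<lambda>p. snd p s) \<in> borel_measurable N"
    proof (rule borel_measurableI_less)
      fix a :: real
      have "{p \<in> space N. snd p s < a} = UNIV \<times> {w \<in> C0. w s < a}" by (auto simp: N(1))
      then show "{p \<in> space N. snd p s < a} \<in> sets N" unfolding N(2) using s by (auto intro!: sigma_sets.Basic)
    qed
  qed (auto simp: N(1))
  fix A :: "(real \<times> (real \<Rightarrow> real)) set" assume A: "A \<in> sets UC_borel"
  have "(\<lambda>p. (fst p, snd p)) \<in> N \<rightarrow>\<^sub>M UC_borel"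
    by (rule measurable_Pair[OF fst_m snd_m])
  then have "(\<lambda>p. (fst p, snd p)) -` A \<inter> space N \<in> sets N" using A by (rule measurable_sets)
  moreover have "(\<lambda>p. (fst p, snd p)) -` A \<inter> space N = A"
    using sets.sets_into_space[OF A] by (auto simp: N(1) space_pair_measure)
  ultimately show "A \<in> sigma_sets ?\<Omega> ?E" by (simp add: N(2))
qed

section \<open>A class of functionals closed under complements, products and averages\<close>

lemma pointwise_continuous_compl:
  assumes "pointwise_continuous F"
  shows "pointwise_continuous (\<lambda>p. 1 - F p)"
proof -
  note [measurable] = pointwise_continuous_measurable[OF assms]
  show ?thesis using assms unfolding pointwise_continuous_def
    by (auto intro!: tendsto_intros)
qed

lemma pointwise_continuous_mult:
  assumes "pointwise_continuous F" "pointwise_continuous H"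
  shows "pointwise_continuous (\<lambda>p. F p * H p)"
proof -
  note [measurable] = pointwise_continuous_measurable[OF assms(1)] pointwise_continuous_measurable[OF assms(2)]
  show ?thesis using assms unfolding pointwise_continuous_def
    by (auto intro!: tendsto_mult mult_le_one)
qed

lemma pointwise_continuous_indicator:
  assumes [measurable]: "A \<in> sets borel"
  shows "pointwise_continuous (\<lambda>p. indicator A (fst p))"
  unfolding pointwise_continuous_def by (auto simp: indicator_def)

lemma pointwise_continuous_ramp:
  assumes "0 \<le> s"
  shows "pointwise_continuous (\<lambda>p. min 1 (max 0 (c * (a - snd p s))))"
proof -
  note [measurable] = measurable_C0_eval[OF assms]
  show ?thesis using assms unfolding pointwise_continuous_def
    by (auto intro!: tendsto_intros)
qed

lemma pointwise_continuous_average: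
  assumes "\<And>k. k < n \<Longrightarrow> pointwise_continuous (F k)"
  shows "pointwise_continuous (\<lambda>p. (\<Sum>k<n. F k p) / real n)"
proof (cases "n = 0")
  case True
  have "pointwise_continuous (\<lambda>_. 0)" by (simp add: pointwise_continuous_def)
  moreover have "(\<lambda>p. (\<Sum>k<n. F k p) / real n) = (\<lambda>_. 0)" using True by simp
  ultimately show ?thesis by simp
next
  case False
  have "(\<Sum>k<n. F k (u, w)) \<le> real n" if "w \<in> C0" for u w
    using sum_bounded_above[of "{..<n}" "\<lambda>k. F k (u, w)" 1] pointwise_continuous_le_1[OF assms that] by simp
  moreover have "0 \<le> (\<Sum>k<n. F k (u, w))" if "w \<in> C0" for u w
    by (intro sum_nonneg pointwise_continuous_nonneg[OF assms that]) simp
  moreover have "(\<lambda>p. (\<Sum>k<n. F k p) / real n) \<in> borel_measurable UC_borel"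
    by (intro borel_measurable_divide borel_measurable_sum borel_measurable_const pointwise_continuous_measurable[OF assms]) auto
  moreover have "(\<lambda>m. (\<Sum>k<n. F k (u, v m)) / real n) \<longlonglongrightarrow> (\<Sum>k<n. F k (u, w)) / real n"
    if "\<forall>m. v m \<in> C0" "w \<in> C0" "\<forall>s\<ge>0. (\<lambda>m. v m s) \<longlonglongrightarrow> w s" for u v w
  proof (intro tendsto_divide tendsto_sum tendsto_const)
    fix k assume "k \<in> {..<n}"
    then show "(\<lambda>m. F k (u, v m)) \<longlonglongrightarrow> F k (u, w)"
      using that by (intro pointwise_continuous_tendsto[OF assms]) auto
  qed (use False in simp)
  ultimately show ?thesis using False unfolding pointwise_continuous_def by simp
qed

lemma abs_mult_diff_le:
  fixes a b c d :: real
  assumes "0 \<le> b" "b \<le> 1" "0 \<le> c" "c \<le> 1"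
  shows "\<bar>a * b - c * d\<bar> \<le> \<bar>a - c\<bar> + \<bar>b - d\<bar>"
proof -
  have "a * b - c * d = (a - c) * b + c * (b - d)" by (simp add: algebra_simps)
  then have "\<bar>a * b - c * d\<bar> \<le> \<bar>a - c\<bar> * b + c * \<bar>b - d\<bar>"
    using abs_triangle_ineq[of "(a - c) * b" "c * (b - d)"] assms by (simp add: abs_mult)
  also have "\<dots> \<le> \<bar>a - c\<bar> * 1 + 1 * \<bar>b - d\<bar>"
    using assms by (intro add_mono mult_mono) auto
  finally show ?thesis by simp
qed

text \<open>The number of levels \<open>(k+1)/n\<close> not exceeding \<open>z\<close> is the
  integer part of \<open>n z\<close>: the layer cake formula with \<open>n\<close> layers.\<close>

lemma sum_indicator_le_floor:
  fixes z :: real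
  assumes "0 \<le> z" "z \<le> 1" "0 < n"
  shows "\<bar>(\<Sum>k<n. if real (Suc k) / real n \<le> z then 1 else 0) / real n - z\<bar> \<le> 1 / real n"
proof -
  define m where "m = nat \<lfloor>real n * z\<rfloor>"
  have nz: "0 \<le> real n * z" "real n * z \<le> real n" using assms by (auto simp: mult_left_le)
  have m: "real m \<le> real n * z" "real n * z < real m + 1" using nz(1) unfolding m_def by linarith+
  have mn: "m \<le> n" using m(1) nz(2) by linarith
  have "{k. k < n \<and> real (Suc k) / real n \<le> z} = {..<m}"
  proof (intro equalityI subsetI)
    fix k assume "k \<in> {k. k < n \<and> real (Suc k) / real n \<le> z}"
    then have "real (Suc k) \<le> real n * z" using assms by (simp add: field_simps)
    with m(2) have "real (Suc k) < real m + 1" by linarith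
    then show "k \<in> {..<m}" by simp
  next
    fix k assume k: "k \<in> {..<m}"
    then have "real (Suc k) \<le> real n * z" using m(1) by (auto intro: order_trans[rotated])
    then show "k \<in> {k. k < n \<and> real (Suc k) / real n \<le> z}" using k mn assms by (simp add: field_simps)
  qed
  moreover have "(\<Sum>k<n. if real (Suc k) / real n \<le> z then 1 else 0 :: real) = real (card {k. k < n \<and> real (Suc k) / real n \<le> z})"
    by (subst sum.If_cases) (auto intro!: arg_cong[where f = card])
  ultimately have eq: "(\<Sum>k<n. if real (Suc k) / real n \<le> z then 1 else 0 :: real) = real m" by simp
  have "\<bar>real m - real n * z\<bar> \<le> 1" using m by linarith
  moreover have "real m / real n - z = (real m - real n * z) / real n"
    using assms by (simp add: field_simps)
  ultimately show ?thesis unfolding eq by (simp add: abs_divide divide_right_mono)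
qed

context randomized_brownian
begin

abbreviation UW :: "'a \<Rightarrow> real \<times> (real \<Rightarrow> real)" where
  "UW x \<equiv> (U x, path_of W x)"

text \<open>The approximable sets contain the generators and are closed under complements
  (\<open>1 - F\<close>), finite intersections (products) and pointwise limits (dominated
  convergence). Countable unions are limits of finite ones, so induction over the generated
  \<sigma>-algebra reaches all sets.\<close>

lemma indicator_approx:
  assumes "A \<in> sets UC_borel" "0 < e"
  shows "\<exists>F. pointwise_continuous F \<and> (\<integral>x. \<bar>F (UW x) - indicat_real A (UW x)\<bar> \<partial>M) < e"
proof -
  define E where "E = {A \<times> C0 | A. A \<in> sets (borel :: real measure)} \<union> {UNIV \<times> {w \<in> C0. w s < a} | s a :: real. 0 \<le> s}"
  have sets_sub: "sigma_sets (UNIV \<times> C0) E \<subseteq> sets UC_borel"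
  proof -
    have [measurable]: "C0 \<in> sets C0_borel" using sets.top[of C0_borel] by simp
    have "{w \<in> C0. w s < a} \<in> sets C0_borel" if "0 \<le> s" for s a :: real
      using borel_measurable_less[OF measurable_C0_eval[OF that] borel_measurable_const[of a]] by simp
    then have "E \<subseteq> sets UC_borel" by (auto simp: E_def)
    from sets.sigma_sets_subset[OF this] show ?thesis by (simp add: space_pair_measure)
  qed
  have UW_m [measurable]: "UW \<in> M \<rightarrow>\<^sub>M UC_borel" by measurable
  have int_le: "integrable M h" if "h \<in> borel_measurable M" "\<And>x. x \<in> space M \<Longrightarrow> \<bar>h x\<bar> \<le> 1" for h :: "'a \<Rightarrow> real"
    by (rule integrable_const_bound[where B = 1]) (use that in auto)
  have F_le: "0 \<le> F (UW x)" "F (UW x) \<le> 1" if "pointwise_continuous F" "x \<in> space M" for F x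
    using that by (auto intro: pointwise_continuous_nonneg pointwise_continuous_le_1)
  have F_int: "integrable M (\<lambda>x. \<bar>F (UW x) - indicat_real A (UW x)\<bar>)"
    if F: "pointwise_continuous F" and A [measurable]: "A \<in> sets UC_borel" for F A
  proof (rule int_le)
    note [measurable] = pointwise_continuous_measurable[OF F]
    show "(\<lambda>x. \<bar>F (UW x) - indicat_real A (UW x)\<bar>) \<in> borel_measurable M" by measurable
    show "\<bar>\<bar>F (UW x) - indicat_real A (UW x)\<bar>\<bar> \<le> 1" if "x \<in> space M" for x
      using F_le[OF F that] by (auto simp: indicator_def)
  qed
  define Q where "Q A \<longleftrightarrow> (\<forall>e>0. \<exists>F. pointwise_continuous F \<and> (\<integral>x. \<bar>F (UW x) - indicat_real A (UW x)\<bar> \<partial>M) < e)" for A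
  have Q_compl: "Q ((UNIV \<times> C0) - A)" if "Q A" for A
    unfolding Q_def
  proof safe
    fix e :: real assume "0 < e"
    with that obtain F where F: "pointwise_continuous F" "(\<integral>x. \<bar>F (UW x) - indicat_real A (UW x)\<bar> \<partial>M) < e"
      unfolding Q_def by blast
    have "(\<integral>x. \<bar>(1 - F (UW x)) - indicat_real ((UNIV \<times> C0) - A) (UW x)\<bar> \<partial>M) = (\<integral>x. \<bar>F (UW x) - indicat_real A (UW x)\<bar> \<partial>M)"
      by (rule Bochner_Integration.integral_cong[OF refl]) (auto simp: indicator_def)
    with F show "\<exists>F. pointwise_continuous F \<and> (\<integral>x. \<bar>F (UW x) - indicat_real ((UNIV \<times> C0) - A) (UW x)\<bar> \<partial>M) < e"
      by (intro exI[of _ "\<lambda>p. 1 - F p"]) (auto intro: pointwise_continuous_compl)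
  qed
  have Q_Int: "Q (A \<inter> B)" if Q: "Q A" "Q B" and A: "A \<in> sets UC_borel" and B: "B \<in> sets UC_borel" for A B
    unfolding Q_def
  proof safe
    fix e :: real assume "0 < e"
    then have e2: "0 < e/2" by simp
    from Q e2 obtain F H where F: "pointwise_continuous F" "(\<integral>x. \<bar>F (UW x) - indicat_real A (UW x)\<bar> \<partial>M) < e/2"
      and H: "pointwise_continuous H" "(\<integral>x. \<bar>H (UW x) - indicat_real B (UW x)\<bar> \<partial>M) < e/2"
      unfolding Q_def by blast
    have FH: "pointwise_continuous (\<lambda>p. F p * H p)" by (rule pointwise_continuous_mult[OF F(1) H(1)])
    have "(\<integral>x. \<bar>F (UW x) * H (UW x) - indicat_real (A \<inter> B) (UW x)\<bar> \<partial>M)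
        \<le> (\<integral>x. \<bar>F (UW x) - indicat_real A (UW x)\<bar> + \<bar>H (UW x) - indicat_real B (UW x)\<bar> \<partial>M)"
    proof (rule integral_mono)
      show "integrable M (\<lambda>x. \<bar>F (UW x) * H (UW x) - indicat_real (A \<inter> B) (UW x)\<bar>)"
        using F_int[OF FH sets.Int[OF A B]] by simp
      fix x assume x: "x \<in> space M"
      show "\<bar>F (UW x) * H (UW x) - indicat_real (A \<inter> B) (UW x)\<bar> \<le> \<bar>F (UW x) - indicat_real A (UW x)\<bar> + \<bar>H (UW x) - indicat_real B (UW x)\<bar>"
        unfolding indicator_inter_arith using F_le[OF F(1) x] F_le[OF H(1) x]
        by (intro abs_mult_diff_le) (auto simp: indicator_def)
    qed (intro Bochner_Integration.integrable_add F_int F H A B)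
    also have "\<dots> = (\<integral>x. \<bar>F (UW x) - indicat_real A (UW x)\<bar> \<partial>M) + (\<integral>x. \<bar>H (UW x) - indicat_real B (UW x)\<bar> \<partial>M)"
      by (intro Bochner_Integration.integral_add F_int F H A B)
    finally have "(\<integral>x. \<bar>F (UW x) * H (UW x) - indicat_real (A \<inter> B) (UW x)\<bar> \<partial>M) < e" using F H by simp
    with FH show "\<exists>F. pointwise_continuous F \<and> (\<integral>x. \<bar>F (UW x) - indicat_real (A \<inter> B) (UW x)\<bar> \<partial>M) < e" by blast
  qed
  have Q_limit: "Q A" if Qn: "\<And>n. Q (B n)" and B: "\<And>n::nat. B n \<in> sets UC_borel" and A: "A \<in> sets UC_borel"
    and lim: "\<And>p. p \<in> UNIV \<times> C0 \<Longrightarrow> (\<lambda>n. indicat_real (B n) p) \<longlonglongrightarrow> indicat_real A p" for A B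
    unfolding Q_def
  proof safe
    fix e :: real assume e: "0 < e"
    note [measurable] = A B
    have "(\<lambda>n. \<integral>x. \<bar>indicat_real (B n) (UW x) - indicat_real A (UW x)\<bar> \<partial>M) \<longlonglongrightarrow> (\<integral>x. 0 \<partial>M)"
    proof (rule integral_dominated_convergence[where w = "\<lambda>_. 1"])
      show "AE x in M. (\<lambda>n. \<bar>indicat_real (B n) (UW x) - indicat_real A (UW x)\<bar>) \<longlonglongrightarrow> 0"
      proof (rule AE_I2)
        fix x assume "x \<in> space M"
        from tendsto_rabs[OF tendsto_diff[OF lim[of "UW x"] tendsto_const[of "indicat_real A (UW x)"]]] this
        show "(\<lambda>n. \<bar>indicat_real (B n) (UW x) - indicat_real A (UW x)\<bar>) \<longlonglongrightarrow> 0" by simp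
      qed
    qed (auto simp: indicator_def)
    then have "(\<lambda>n. \<integral>x. \<bar>indicat_real (B n) (UW x) - indicat_real A (UW x)\<bar> \<partial>M) \<longlonglongrightarrow> 0" by simp
    from order_tendstoD(2)[OF this, of "e/2"] e obtain n where
      n: "(\<integral>x. \<bar>indicat_real (B n) (UW x) - indicat_real A (UW x)\<bar> \<partial>M) < e/2"
      unfolding eventually_sequentially by auto
    from Qn[of n] e obtain F where F: "pointwise_continuous F" "(\<integral>x. \<bar>F (UW x) - indicat_real (B n) (UW x)\<bar> \<partial>M) < e/2"
      unfolding Q_def by (meson half_gt_zero)
    have iBA: "integrable M (\<lambda>x. \<bar>indicat_real (B n) (UW x) - indicat_real A (UW x)\<bar>)"
      by (rule int_le) (auto simp: indicator_def)
    have "(\<integral>x. \<bar>F (UW x) - indicat_real A (UW x)\<bar> \<partial>M)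
        \<le> (\<integral>x. \<bar>F (UW x) - indicat_real (B n) (UW x)\<bar> + \<bar>indicat_real (B n) (UW x) - indicat_real A (UW x)\<bar> \<partial>M)"
      by (intro integral_mono Bochner_Integration.integrable_add F_int F A B iBA) linarith
    also have "\<dots> = (\<integral>x. \<bar>F (UW x) - indicat_real (B n) (UW x)\<bar> \<partial>M) + (\<integral>x. \<bar>indicat_real (B n) (UW x) - indicat_real A (UW x)\<bar> \<partial>M)"
      by (intro Bochner_Integration.integral_add F_int F B iBA)
    finally show "\<exists>F. pointwise_continuous F \<and> (\<integral>x. \<bar>F (UW x) - indicat_real A (UW x)\<bar> \<partial>M) < e"
      using F n by (intro exI[of _ F]) auto
  qed
  have Q_exact: "Q A" if "pointwise_continuous F" "\<And>x. x \<in> space M \<Longrightarrow> F (UW x) = indicat_real A (UW x)" for F A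
    unfolding Q_def
  proof safe
    fix e :: real assume "0 < e"
    have "(\<integral>x. \<bar>F (UW x) - indicat_real A (UW x)\<bar> \<partial>M) = (\<integral>x. 0 \<partial>M)"
      by (rule Bochner_Integration.integral_cong) (auto simp: that)
    with that \<open>0 < e\<close> show "\<exists>F. pointwise_continuous F \<and> (\<integral>x. \<bar>F (UW x) - indicat_real A (UW x)\<bar> \<partial>M) < e"
      by (intro exI[of _ F]) auto
  qed
  have "A \<in> sigma_sets (UNIV \<times> C0) E"
    using assms sets_borel_C0_borel_subset by (auto simp: E_def)
  then have "Q A"
  proof (induction rule: sigma_sets.induct)
    case (Basic A)
    then consider (u) B where "A = B \<times> C0" "B \<in> sets borel"
      | (w) s a where "A = UNIV \<times> {w \<in> C0. w s < a}" "0 \<le> s" by (auto simp: E_def)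
    then show ?case
    proof cases
      case u
      show ?thesis
        by (rule Q_exact[OF pointwise_continuous_indicator[OF u(2)]]) (auto simp: u(1) indicator_def)
    next
      case w
      have A: "A \<in> sets UC_borel" using sets_sub Basic by (auto intro: sigma_sets.Basic)
      show ?thesis unfolding Q_def
      proof safe
        fix e :: real assume e: "0 < e"
        define F where "F n p = min 1 (max 0 (real n * (a - snd p s)))" for n :: nat and p :: "real \<times> (real \<Rightarrow> real)"
        have F: "pointwise_continuous (F n)" for n unfolding F_def by (rule pointwise_continuous_ramp[OF w(2)])
        have lim: "(\<lambda>n. F n p) \<longlonglongrightarrow> indicat_real A p" if p: "snd p \<in> C0" for p
        proof (cases "snd p s < a")
          case True
          obtain N :: nat where N: "1 / (a - snd p s) < real N" using reals_Archimedean2 by blast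
          have "F n p = 1" if "n \<ge> N" for n
          proof -
            have "1 / (a - snd p s) \<le> real n" using N that by linarith
            then have "1 \<le> real n * (a - snd p s)" using True by (simp add: field_simps)
            then show ?thesis by (simp add: F_def)
          qed
          then have "\<forall>\<^sub>F n in sequentially. F n p = indicat_real A p"
            using True p by (auto simp: eventually_sequentially w(1) indicator_def mem_Times_iff)
          then show ?thesis by (rule tendsto_eventually)
        next
          case False
          then have "real n * (a - snd p s) \<le> 0" for n by (simp add: mult_nonneg_nonpos)
          then have "F n p = indicat_real A p" for n
            using False by (auto simp: F_def w(1) indicator_def mem_Times_iff max_absorb1)
          then have "(\<lambda>n. F n p) = (\<lambda>_. indicat_real A p)" by (rule ext)
          then show ?thesis by (simp only: tendsto_const)
        qed
        have "(\<lambda>n. \<integral>x. \<bar>F n (UW x) - indicat_real A (UW x)\<bar> \<partial>M) \<longlonglongrightarrow> (\<integral>x. 0 \<partial>M)"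
        proof (rule integral_dominated_convergence[where w = "\<lambda>_. 1"])
          show "AE x in M. (\<lambda>n. \<bar>F n (UW x) - indicat_real A (UW x)\<bar>) \<longlonglongrightarrow> 0"
          proof (rule AE_I2)
            fix x assume "x \<in> space M"
            from tendsto_rabs[OF tendsto_diff[OF lim[of "UW x"] tendsto_const[of "indicat_real A (UW x)"]]] this
            show "(\<lambda>n. \<bar>F n (UW x) - indicat_real A (UW x)\<bar>) \<longlonglongrightarrow> 0" by simp
          qed
          show "(\<lambda>x. \<bar>F n (UW x) - indicat_real A (UW x)\<bar>) \<in> borel_measurable M" for n
            using F_int[OF F A] by (rule borel_measurable_integrable)
          show "AE x in M. norm \<bar>F n (UW x) - indicat_real A (UW x)\<bar> \<le> 1" for n
            by (rule AE_I2) (auto simp: indicator_def F_def)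
        qed auto
        then have "(\<lambda>n. \<integral>x. \<bar>F n (UW x) - indicat_real A (UW x)\<bar> \<partial>M) \<longlonglongrightarrow> 0" by simp
        from order_tendstoD(2)[OF this e] obtain n where "(\<integral>x. \<bar>F n (UW x) - indicat_real A (UW x)\<bar> \<partial>M) < e"
          unfolding eventually_sequentially by auto
        with F show "\<exists>F. pointwise_continuous F \<and> (\<integral>x. \<bar>F (UW x) - indicat_real A (UW x)\<bar> \<partial>M) < e" by blast
      qed
    qed
  next
    case Empty
    show ?case by (rule Q_exact[OF pointwise_continuous_indicator[of "{}"]]) auto
  next
    case (Compl A)
    then show ?case by (intro Q_compl)
  next
    case (Union A)
    have A: "A i \<in> sets UC_borel" for i using Union(1) sets_sub by auto
    have sub: "A i \<subseteq> UNIV \<times> C0" for i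
      using sets.sets_into_space[OF A] by (auto simp: space_pair_measure)
    define B where "B n = (\<Union>i<n. A i)" for n
    have Bm: "B n \<in> sets UC_borel" for n using A by (auto simp: B_def)
    have "Q (B n)" for n
    proof (induction n)
      case 0
      show ?case by (rule Q_exact[OF pointwise_continuous_indicator[of "{}"]]) (auto simp: B_def)
    next
      case (Suc n)
      \<comment> \<open>De Morgan: the union is expressed by the two closure properties at
        hand.\<close>
      have "B (Suc n) = (UNIV \<times> C0) - (((UNIV \<times> C0) - B n) \<inter> ((UNIV \<times> C0) - A n))"
        using sub by (fastforce simp: B_def lessThan_Suc)
      moreover have "(UNIV \<times> C0) - B n \<in> sets UC_borel" "(UNIV \<times> C0) - A n \<in> sets UC_borel"
        using sets.compl_sets[OF Bm[of n]] sets.compl_sets[OF A[of n]] by (auto simp: space_pair_measure)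
      ultimately show ?case using Q_compl[OF Q_Int[OF Q_compl[OF Suc.IH] Q_compl[OF Union(2)[of n]]]] by simp
    qed
    then show ?case
    proof (rule Q_limit[OF _ Bm])
      show "(\<Union>i. A i) \<in> sets UC_borel" using A by auto
      fix p :: "real \<times> (real \<Rightarrow> real)"
      have "(\<lambda>n. indicat_real (\<Union>i<n. A i) p) \<longlonglongrightarrow> indicat_real (\<Union>i. A i) p"
        by (rule LIMSEQ_indicator_UN)
      then show "(\<lambda>n. indicat_real (B n) p) \<longlonglongrightarrow> indicat_real (\<Union>i. A i) p" by (simp add: B_def)
    qed
  qed
  then show ?thesis using assms(2) unfolding Q_def by blast
qed

text \<open>Cut \<open>Z\<close> into \<open>n\<close> layers, approximate each indicator, and
  average: the layers cost at most \<open>1/n < e/2\<close>, the indicators on average at most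
  \<open>e/2\<close>. An average of functionals keeps its values in \<open>[0, 1]\<close>.\<close>

lemma approx_UW:
  assumes Z: "Z \<in> borel_measurable (vimage_algebra (space M) UW UC_borel)"
    and bound: "\<And>x. x \<in> space M \<Longrightarrow> 0 \<le> Z x \<and> Z x \<le> 1" and e: "0 < e"
  shows "\<exists>F. pointwise_continuous F \<and> (\<integral>x. \<bar>F (UW x) - Z x\<bar> \<partial>M) < e"
proof -
  have UW_m [measurable]: "UW \<in> M \<rightarrow>\<^sub>M UC_borel" by measurable
  have UW_sp: "UW \<in> space M \<rightarrow> space UC_borel" by (auto simp: space_pair_measure)
  obtain n' :: nat where n': "1 / real (Suc n') < e / 2"
    using reals_Archimedean[of "e/2"] e by (auto simp: inverse_eq_divide)
  define n where "n = Suc n'"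
  have n: "0 < n" "1 / real n < e / 2" using n' by (auto simp: n_def)
  have "\<exists>A\<in>sets UC_borel. {x \<in> space M. c \<le> Z x} = UW -` A \<inter> space M" for c
  proof -
    have "{x \<in> space M. c \<le> Z x} \<in> sets (vimage_algebra (space M) UW UC_borel)"
      using borel_measurable_le[OF borel_measurable_const[of c] Z] by simp
    then show ?thesis by (auto simp: sets_vimage_algebra2[OF UW_sp])
  qed
  then obtain A where A: "\<And>c. A c \<in> sets UC_borel" and A_eq: "\<And>c. {x \<in> space M. c \<le> Z x} = UW -` A c \<inter> space M"
    by metis
  have e2: "0 < e / 2" using e by simp
  have "\<forall>c. \<exists>F. pointwise_continuous F \<and> (\<integral>x. \<bar>F (UW x) - indicat_real (A c) (UW x)\<bar> \<partial>M) < e / 2"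
    using indicator_approx[OF A e2] by blast
  from choice[OF this] obtain F where F: "\<And>c. pointwise_continuous (F c)"
    and FA: "\<And>c. (\<integral>x. \<bar>F c (UW x) - indicat_real (A c) (UW x)\<bar> \<partial>M) < e / 2" by blast
  define c where "c k = real (Suc k) / real n" for k
  define H where "H p = (\<Sum>k<n. F (c k) p) / real n" for p
  have H: "pointwise_continuous H" unfolding H_def by (rule pointwise_continuous_average[OF F])
  have ind: "indicat_real (A (c k)) (UW x) = (if real (Suc k) / real n \<le> Z x then 1 else 0)" if "x \<in> space M" for k x
    using A_eq[of "c k"] that by (auto simp: indicator_def c_def)
  note [measurable] = A pointwise_continuous_measurable[OF F] pointwise_continuous_measurable[OF H]
  have F_int: "integrable M (\<lambda>x. \<bar>F (c k) (UW x) - indicat_real (A (c k)) (UW x)\<bar>)" for k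
    using pointwise_continuous_nonneg[OF F] pointwise_continuous_le_1[OF F]
    by (intro integrable_const_bound[where B = 1]) (auto simp: indicator_def)
  have "(\<integral>x. \<bar>H (UW x) - Z x\<bar> \<partial>M) \<le> (\<integral>x. (\<Sum>k<n. \<bar>F (c k) (UW x) - indicat_real (A (c k)) (UW x)\<bar>) / real n + 1 / real n \<partial>M)"
  proof (rule integral_mono_AE')
    show "integrable M (\<lambda>x. (\<Sum>k<n. \<bar>F (c k) (UW x) - indicat_real (A (c k)) (UW x)\<bar>) / real n + 1 / real n)"
      using F_int by auto
    show "AE x in M. \<bar>H (UW x) - Z x\<bar> \<le> (\<Sum>k<n. \<bar>F (c k) (UW x) - indicat_real (A (c k)) (UW x)\<bar>) / real n + 1 / real n"
    proof (rule AE_I2)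
      fix x assume x: "x \<in> space M"
      define I where "I = (\<Sum>k<n. indicat_real (A (c k)) (UW x)) / real n"
      have "\<bar>I - Z x\<bar> \<le> 1 / real n"
        unfolding I_def using sum_indicator_le_floor[of "Z x" n] bound[OF x] n by (simp add: ind[OF x])
      moreover have "H (UW x) - I = (\<Sum>k<n. F (c k) (UW x) - indicat_real (A (c k)) (UW x)) / real n"
        by (simp add: H_def I_def sum_subtractf diff_divide_distrib)
      then have "\<bar>H (UW x) - I\<bar> \<le> (\<Sum>k<n. \<bar>F (c k) (UW x) - indicat_real (A (c k)) (UW x)\<bar>) / real n"
        by (simp add: divide_right_mono)
      ultimately show "\<bar>H (UW x) - Z x\<bar> \<le> (\<Sum>k<n. \<bar>F (c k) (UW x) - indicat_real (A (c k)) (UW x)\<bar>) / real n + 1 / real n"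
        by linarith
    qed
  qed (auto intro!: AE_I2 add_nonneg_nonneg divide_nonneg_nonneg sum_nonneg)
  also have "\<dots> = (\<Sum>k<n. \<integral>x. \<bar>F (c k) (UW x) - indicat_real (A (c k)) (UW x)\<bar> \<partial>M) / real n + 1 / real n"
    using F_int by (simp add: prob_space)
  also have "\<dots> \<le> (\<Sum>k<n. e / 2) / real n + 1 / real n"
    using FA n by (intro add_right_mono divide_right_mono sum_mono less_imp_le) auto
  also have "\<dots> = e / 2 + 1 / real n" using n by simp
  also have "\<dots> < e" using n by simp
  finally show ?thesis using H by blast
qed

end

section \<open>Randomized stopping times\<close>

lemma measurable_vimage_algebra_mono:
  assumes "g \<in> space N \<rightarrow> X" "(\<lambda>x. f (g x)) \<in> measurable N M" "h \<in> measurable (vimage_algebra X f M) K"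
  shows "(\<lambda>x. h (g x)) \<in> measurable N K"
  by (rule measurable_compose[OF measurable_vimage_algebra2[OF assms(1,2)] assms(3)])

text \<open>Toss a fair coin to choose the measure: the mixture is a bind over a Bernoulli variable,
  and integrals average accordingly.\<close>

lemma prob_space_mixture:
  assumes M1: "prob_space M1" and M2: "prob_space M2"
    and sets1: "sets M1 = sets S" and sets2: "sets M2 = sets S"
  obtains N where "prob_space N" "sets N = sets S"
    "\<And>f. f \<in> borel_measurable S \<Longrightarrow> (\<integral>\<^sup>+x. f x \<partial>N) = (\<integral>\<^sup>+x. f x \<partial>M1) / 2 + (\<integral>\<^sup>+x. f x \<partial>M2) / 2"
proof -
  define K where "K b = (if b then M1 else M2)" for b
  have K: "K \<in> measure_pmf (bernoulli_pmf (1/2)) \<rightarrow>\<^sub>M subprob_algebra S"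
    using M1[THEN prob_space_imp_subprob_space] M2[THEN prob_space_imp_subprob_space] sets1 sets2
    by (simp add: K_def space_subprob_algebra measurable_pmf_measure1 Pi_iff)
  define N where "N = measure_pmf (bernoulli_pmf (1/2)) \<bind> K"
  have sets: "sets N = sets S" unfolding N_def by (rule sets_bind) (simp_all add: K_def sets1 sets2)
  have nn: "(\<integral>\<^sup>+x. f x \<partial>N) = (\<integral>\<^sup>+x. f x \<partial>M1) / 2 + (\<integral>\<^sup>+x. f x \<partial>M2) / 2" if f: "f \<in> borel_measurable S" for f
  proof -
    have "(\<integral>\<^sup>+x. f x \<partial>N) = (\<integral>\<^sup>+b. \<integral>\<^sup>+x. f x \<partial>K b \<partial>measure_pmf (bernoulli_pmf (1/2)))"
      unfolding N_def by (rule nn_integral_bind[OF f K])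
    also have "\<dots> = (\<integral>\<^sup>+x. f x \<partial>M1) * ennreal (1/2) + (\<integral>\<^sup>+x. f x \<partial>M2) * ennreal (1 - 1/2)"
      by (subst nn_integral_bernoulli_pmf) (auto simp: K_def)
    also have "\<dots> = (\<integral>\<^sup>+x. f x \<partial>M1) / 2 + (\<integral>\<^sup>+x. f x \<partial>M2) / 2"
    proof -
      have "ennreal (1 - 1/2) = inverse 2" "ennreal (1/2) = inverse 2"
        using inverse_ennreal[of 2] by (simp_all add: inverse_eq_divide)
      then show ?thesis by (simp only: divide_ennreal_def)
    qed
    finally show ?thesis .
  qed
  have "emeasure N (space N) = 1"
  proof -
    have sp: "space N = space S" "space M1 = space S" "space M2 = space S"
      using sets sets1 sets2 by (auto dest: sets_eq_imp_space_eq)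
    have "emeasure N (space N) = (\<integral>\<^sup>+x. indicator (space S) x \<partial>N)"
      by (subst nn_integral_indicator) (auto simp: sp sets)
    also have "\<dots> = (\<integral>\<^sup>+x. indicator (space S) x \<partial>M1) / 2 + (\<integral>\<^sup>+x. indicator (space S) x \<partial>M2) / 2"
      by (rule nn) simp
    also have "\<dots> = 1 / 2 + 1 / 2"
      using prob_space.emeasure_space_1[OF M1] prob_space.emeasure_space_1[OF M2]
      by (subst (1 2) nn_integral_indicator) (auto simp: sp sets1 sets2)
    also have "\<dots> = (1 :: ennreal)"
    proof -
      have half: "(1 :: ennreal) / 2 = ennreal (1/2)" using divide_ennreal[of 1 2] by simp
      show ?thesis unfolding half by (subst ennreal_plus[symmetric]) auto
    qed
    finally show ?thesis .
  qed
  then have "prob_space N" by (rule prob_spaceI)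
  with sets nn show ?thesis by (intro that)
qed

context randomized_brownian
begin

text \<open>Generated by the path up to \<open>t\<close> alone, without \<open>U\<close> and without
  whatever else \<open>G\<close> contains: conditioning on it removes the randomness that
  \<open>U\<close> will replace.\<close>

definition past :: "real \<Rightarrow> 'a measure" where
  "past t = vimage_algebra (space M) (\<lambda>x. stopped t (path_of W x)) C0_borel"

definition full :: "'a measure" where
  "full = vimage_algebra (space M) (path_of W) C0_borel"

lemma space_past [simp]: "space (past t) = space M"
  by (simp add: past_def)

lemma space_full [simp]: "space full = space M"
  by (simp add: full_def)

lemma stopped_path_measurable:
  assumes t: "0 \<le> t"
  shows "(\<lambda>x. stopped t (path_of W x)) \<in> G (ennreal t) \<rightarrow>\<^sub>M C0_borel"
proof (rule measurable_C0_borel)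
  fix s :: real assume s: "0 \<le> s"
  have "W (min s t) \<in> borel_measurable (G (ennreal t))"
    using s t by (intro W_adapted ennreal_leI) auto
  then show "(\<lambda>x. stopped t (path_of W x) s) \<in> borel_measurable (G (ennreal t))"
    using s t by (simp add: stopped_def)
qed (use t in \<open>auto intro: stopped_in_C0\<close>)

lemma measurable_past_G:
  assumes "0 \<le> t" "f \<in> past t \<rightarrow>\<^sub>M N"
  shows "f \<in> G (ennreal t) \<rightarrow>\<^sub>M N"
  by (rule measurable_vimage_algebra_mono[where g = "\<lambda>x. x",
        OF _ stopped_path_measurable[OF assms(1)] assms(2)[unfolded past_def]]) simp

lemma measurable_past_full:
  assumes t: "0 \<le> t" and f: "f \<in> past t \<rightarrow>\<^sub>M N"
  shows "f \<in> full \<rightarrow>\<^sub>M N"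
proof -
  have path: "path_of W \<in> full \<rightarrow>\<^sub>M C0_borel"
    unfolding full_def by (rule measurable_vimage_algebra1) auto
  have "(\<lambda>x. stopped t (path_of W x)) \<in> full \<rightarrow>\<^sub>M C0_borel"
  proof (rule measurable_C0_borel)
    fix s :: real assume s: "0 \<le> s"
    then have "(\<lambda>x. path_of W x (min s t)) \<in> borel_measurable full"
      using measurable_compose[OF path measurable_C0_eval[of "min s t"]] t by simp
    then show "(\<lambda>x. stopped t (path_of W x) s) \<in> borel_measurable full"
      using s by (simp add: stopped_def)
  qed (use t in \<open>auto intro: stopped_in_C0\<close>)
  from measurable_vimage_algebra_mono[OF _ this f[unfolded past_def]] show ?thesis by simp
qed

lemma subalgebra_full: "subalgebra M full"
  unfolding subalgebra_def using sets_image_in_sets[of M "space M" "path_of W" C0_borel]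
  by (simp add: full_def)

lemma subalgebra_past: "0 \<le> t \<Longrightarrow> subalgebra M (past t)"
  unfolding subalgebra_def
  using sets_image_in_sets[of M "space M" "\<lambda>x. stopped t (path_of W x)" C0_borel]
    measurable_from_G[OF stopped_path_measurable[of t]]
  by (simp add: past_def)

lemma concat_path_stopped: "0 \<le> t \<Longrightarrow> concat_path t (stopped t w) d = concat_path t w d"
  by (rule ext) (simp add: concat_path_def stopped_def)

text \<open>For a functional not involving \<open>U\<close>, averaging over the later increments
  leaves a function of the stopped path alone. This is sharper than \<open>mart_adapted\<close>, and
  it is what allows conditioning on \<open>past t\<close>.\<close>

lemma mart_past_measurable:
  assumes t: "0 \<le> t" and B: "B \<in> sets C0_borel"
  shows "mart (\<lambda>p. indicat_real B (snd p)) t \<in> borel_measurable (past t)"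
proof -
  have incr: "incr t \<in> M \<rightarrow>\<^sub>M C0_borel" using t by simp
  have "(\<lambda>p. concat_path t (fst p) (incr t (snd p))) \<in> C0_borel \<Otimes>\<^sub>M M \<rightarrow>\<^sub>M C0_borel"
  proof (rule measurable_C0_borel)
    fix s :: real assume s: "0 \<le> s"
    have [measurable]: "(\<lambda>p. fst p (min s t)) \<in> borel_measurable (C0_borel \<Otimes>\<^sub>M M)"
      using s t measurable_compose[OF measurable_fst measurable_C0_eval[of "min s t"]] by simp
    have [measurable]: "(\<lambda>p. incr t (snd p) s) \<in> borel_measurable (C0_borel \<Otimes>\<^sub>M M)"
      by (rule measurable_compose[OF measurable_snd measurable_compose[OF incr measurable_C0_eval[OF s]]])
    have "(\<lambda>p. fst p (min s t) + incr t (snd p) s) \<in> borel_measurable (C0_borel \<Otimes>\<^sub>M M)" by measurable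
    then show "(\<lambda>p. concat_path t (fst p) (incr t (snd p)) s) \<in> borel_measurable (C0_borel \<Otimes>\<^sub>M M)"
      using s by (simp add: concat_path_def del: incr_nonneg)
  qed (use t in \<open>auto simp: space_pair_measure intro: concat_path_in_C0\<close>)
  then have "(\<lambda>p. indicat_real B (concat_path t (fst p) (incr t (snd p)))) \<in> borel_measurable (C0_borel \<Otimes>\<^sub>M M)"
    by (rule measurable_compose) (use B in simp)
  then have "(\<lambda>w. \<integral>x'. indicat_real B (concat_path t w (incr t x')) \<partial>M) \<in> borel_measurable C0_borel"
    by (intro borel_measurable_lebesgue_integral) (simp add: case_prod_beta')
  moreover have "(\<lambda>x. stopped t (path_of W x)) \<in> past t \<rightarrow>\<^sub>M C0_borel"
    unfolding past_def using t by (intro measurable_vimage_algebra1) (auto intro: stopped_in_C0)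
  ultimately have "(\<lambda>x. \<integral>x'. indicat_real B (concat_path t (stopped t (path_of W x)) (incr t x')) \<partial>M) \<in> borel_measurable (past t)"
    by (rule measurable_compose[rotated])
  then show ?thesis
    by (simp add: mart_def[abs_def] concat_path_stopped[OF t])
qed

text \<open>Here \<open>\<xi>\<close> is the joint law of the path and a stopping time \<open>\<tau>\<close>, and \<open>a q\<close> is the conditional
  probability of \<open>\<tau> \<le> q\<close> given the path up to time \<open>q\<close>. Negative \<open>q\<close> are allowed only to index by a
  whole type.\<close>

definition rst :: "((real \<Rightarrow> real) \<times> real) measure \<Rightarrow> (rat \<Rightarrow> 'a \<Rightarrow> real) \<Rightarrow> bool" where
  "rst \<xi> a \<longleftrightarrow> prob_space \<xi> \<and> sets \<xi> = sets CT_borel \<and>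
     (AE p in \<xi>. 0 < snd p) \<and>
     (\<forall>q. a q \<in> borel_measurable (past (max 0 (of_rat q)))) \<and>
     (\<forall>q x. 0 \<le> a q x \<and> a q x \<le> 1) \<and>
     (\<forall>q. \<forall>B\<in>sets C0_borel. measure \<xi> (B \<times> {..of_rat q}) =
        (\<integral>x. indicator B (path_of W x) * a q x \<partial>M))"

text \<open>Conditioning \<open>\<tau> \<le> q\<close> on the path up to \<open>q\<close> must give
  the same as conditioning on the whole path. The martingale property replaces the indicator of
  \<open>B\<close> by its conditional expectation, which depends on the path up to \<open>q\<close>
  only; against it the event may be replaced by its conditional probability, and the martingale
  property is then undone.\<close>

lemma rst_of_stopping_time:
  assumes \<tau>: "\<tau> \<in> stopping_times M G \<mu>" and \<mu>: "\<mu> \<in> P1"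
  shows "\<exists>a. rst (distr M CT_borel (\<lambda>x. (path_of W x, enn2real (\<tau> x)))) a"
proof -
  have st: "stopping_time G \<tau>" and fin: "AE x in M. \<tau> x < \<infinity>" and law: "distr M borel (\<lambda>x. enn2real (\<tau> x)) = \<mu>"
    using \<tau> unfolding stopping_times_def by blast+
  have \<tau>m [measurable]: "\<tau> \<in> borel_measurable M"
    by (rule measurable_stopping_time[OF st]) (simp_all add: subsetI sets_G_subset)
  have tm [measurable]: "(\<lambda>x. enn2real (\<tau> x)) \<in> borel_measurable M" by measurable
  have pos: "AE x in M. 0 < enn2real (\<tau> x)"
  proof (rule AE_distrD[OF tm])
    show "AE t in distr M borel (\<lambda>x. enn2real (\<tau> x)). 0 < t" using \<mu> unfolding law P1_def by blast
  qed
  define t :: "rat \<Rightarrow> real" where "t q = max 0 (of_rat q)" for q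
  have t0: "0 \<le> t q" for q by (simp add: t_def)
  define E where "E q = {x \<in> space M. \<tau> x \<le> ennreal (t q)}" for q
  have EG: "E q \<in> sets (G (ennreal (t q)))" for q
    using stopping_timeD[OF st, of "ennreal (t q)"] by (simp add: pred_def E_def)
  have Em [measurable]: "E q \<in> sets M" for q by (rule sets_G_subset[OF EG])
  define c where "c q = real_cond_exp M (past (t q)) (indicat_real (E q))" for q
  \<comment> \<open>The conditional expectation lies in \<open>[0, 1]\<close> only almost surely;
    truncation makes it so everywhere and keeps it measurable for \<open>past (t q)\<close>.\<close>
  define a where "a q x = min 1 (max 0 (c q x))" for q x
  have fsub: "finite_measure_subalgebra M (past (t q))" for q
    by unfold_locales (rule subalgebra_past[OF t0])
  have a_le: "\<bar>a q x\<bar> \<le> 1" for q x by (simp add: a_def)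
  have cm: "c q \<in> borel_measurable (past (t q))" for q unfolding c_def by simp
  have am: "a q \<in> borel_measurable (past (t q))" for q unfolding a_def[abs_def]
    using cm by measurable
  have intE: "integrable M (indicat_real (E q))" for q by (rule integrable_const_bound[where B = 1]) auto
  have ac: "AE x in M. a q x = c q x" for q
  proof -
    interpret S: finite_measure_subalgebra M "past (t q)" by (rule fsub)
    have "AE x in M. c q x \<ge> 0" "AE x in M. c q x \<le> 1"
      unfolding c_def by (rule S.real_cond_exp_ge_c[OF intE] S.real_cond_exp_le_c[OF intE], simp add: indicator_def)+
    then show ?thesis by eventually_elim (simp add: a_def)
  qed
  define X where "X x = (path_of W x, enn2real (\<tau> x))" for x
  have Xm: "X \<in> M \<rightarrow>\<^sub>M CT_borel" unfolding X_def by measurable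
  have "rst (distr M CT_borel X) a"
    unfolding rst_def
  proof (intro conjI allI ballI)
    show "prob_space (distr M CT_borel X)" by (rule prob_space_distr[OF Xm])
    show "AE p in distr M CT_borel X. 0 < snd p"
      using pos by (subst AE_distr_iff[OF Xm]) (auto simp: X_def)
    show "a q \<in> borel_measurable (past (max 0 (of_rat q)))" for q using am[of q] by (simp add: t_def)
    fix q and B :: "(real \<Rightarrow> real) set" assume B [measurable]: "B \<in> sets C0_borel"
    define F where "F p = indicat_real B (snd p)" for p :: "real \<times> (real \<Rightarrow> real)"
    have F: "F \<in> borel_measurable UC_borel" unfolding F_def by measurable
    have mF: "mart F (t q) \<in> borel_measurable (past (t q))"
      using mart_past_measurable[OF t0 B] by (simp add: F_def[abs_def])
    have mFM: "mart F (t q) \<in> borel_measurable M"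
      by (rule measurable_from_G[OF measurable_past_G[OF t0 mF]])
    have mb: "\<bar>mart F (t q) x\<bar> \<le> 1" if "x \<in> space M" for x
      by (rule mart_bound[where K = 1]) (use that t0 in \<open>auto simp: F_def indicator_def\<close>)
    have aM: "a q \<in> borel_measurable M" by (rule measurable_from_G[OF measurable_past_G[OF t0 am]])
    have "measure (distr M CT_borel X) (B \<times> {..of_rat q}) =
        measure M (X -` (B \<times> {..of_rat q}) \<inter> space M)"
      by (rule measure_distr[OF Xm]) auto
    also have "\<dots> = (\<integral>x. indicat_real (X -` (B \<times> {..of_rat q}) \<inter> space M) x \<partial>M)"
      using measurable_sets[OF Xm, of "B \<times> {..of_rat q}"] by simp
    also have "\<dots> = (\<integral>x. indicat_real (E q) x * F (U x, path_of W x) \<partial>M)"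
    proof (rule integral_cong_AE)
      show "indicat_real (X -` (B \<times> {..of_rat q}) \<inter> space M) \<in> borel_measurable M"
        using measurable_sets[OF Xm, of "B \<times> {..of_rat q}"] by simp
      show "(\<lambda>x. indicat_real (E q) x * F (U x, path_of W x)) \<in> borel_measurable M"
        unfolding F_def by measurable
      show "AE x in M. indicat_real (X -` (B \<times> {..of_rat q}) \<inter> space M) x = indicat_real (E q) x * F (U x, path_of W x)"
        using pos fin AE_space
      proof eventually_elim
        case (elim x)
        then obtain s where s: "\<tau> x = ennreal s" "0 < s" by (cases "\<tau> x") auto
        \<comment> \<open>For negative \<open>q\<close> the set \<open>E q\<close> is the event
          \<open>\<tau> \<le> 0\<close>; positivity of \<open>s\<close> makes both sides
          false.\<close>
        then have "x \<in> E q \<longleftrightarrow> enn2real (\<tau> x) \<le> of_rat q"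
        proof -
          define r :: real where "r = of_rat q"
          have "x \<in> E q \<longleftrightarrow> ennreal s \<le> ennreal r"
            using elim s by (simp add: E_def t_def r_def[symmetric])
          also have "\<dots> \<longleftrightarrow> s \<le> r" using s by (auto simp: ennreal_le_iff2)
          finally show ?thesis using s by (simp add: r_def)
        qed
        then show ?case using elim by (auto simp: indicator_def F_def X_def)
      qed
    qed
    also have "\<dots> = (\<integral>x. indicat_real (E q) x * mart F (t q) x \<partial>M)"
      by (rule mart_martingale[OF t0 F, where K = 1 and L = 1]) (use EG in \<open>auto simp: F_def indicator_def\<close>)
    also have "\<dots> = (\<integral>x. mart F (t q) x * c q x \<partial>M)"
    proof -
      interpret S: finite_measure_subalgebra M "past (t q)" by (rule fsub)
      have "integrable M (\<lambda>x. mart F (t q) x * indicat_real (E q) x)"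
        by (rule integrable_const_bound[where B = 1]) (use mb mFM in \<open>auto simp: indicator_def\<close>)
      from S.real_cond_exp_intg(2)[OF this mF] show ?thesis by (simp add: c_def mult.commute)
    qed
    also have "\<dots> = (\<integral>x. a q x * mart F (t q) x \<partial>M)"
    proof (rule integral_cong_AE)
      have "c q \<in> borel_measurable M" by (rule measurable_from_G[OF measurable_past_G[OF t0 cm]])
      then show "(\<lambda>x. mart F (t q) x * c q x) \<in> borel_measurable M" using mFM by measurable
      show "(\<lambda>x. a q x * mart F (t q) x) \<in> borel_measurable M" using mFM aM by measurable
      show "AE x in M. mart F (t q) x * c q x = a q x * mart F (t q) x"
        using ac[of q] by eventually_elim simp
    qed
    also have "\<dots> = (\<integral>x. a q x * F (U x, path_of W x) \<partial>M)"
      by (rule mart_martingale[OF t0 F, where K = 1 and L = 1, symmetric])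
        (use measurable_past_G[OF t0 am[of q]] a_le in \<open>auto simp: F_def indicator_def\<close>)
    finally show "measure (distr M CT_borel X) (B \<times> {..of_rat q}) =
        (\<integral>x. indicator B (path_of W x) * a q x \<partial>M)"
      by (simp add: F_def mult.commute)
  qed (auto simp: a_def)
  then show ?thesis unfolding X_def[abs_def] by blast
qed

text \<open>Test the defining identity with the set \<open>B\<close> of paths on which
  \<open>a r < a q\<close>; it exists because both functions depend on the path only. The measure of
  \<open>B \<times> {..q}\<close> cannot exceed that of \<open>B \<times> {..r}\<close>, which
  forces \<open>B\<close> to be negligible.\<close>

lemma rst_mono:
  assumes "rst \<xi> a" "q \<le> r"
  shows "AE x in M. a q x \<le> a r x"
proof -
  have am: "a q' \<in> borel_measurable full" for q'
    using assms by (intro measurable_past_full[of "max 0 (of_rat q')"]) (auto simp: rst_def)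
  have aM [measurable]: "a q' \<in> borel_measurable M" for q'
    by (rule measurable_from_subalg[OF subalgebra_full am])
  have a01: "0 \<le> a q' x" "a q' x \<le> 1" for q' x using assms by (auto simp: rst_def)
  have "{x \<in> space M. a r x < a q x} \<in> sets full"
    using borel_measurable_less[OF am[of r] am[of q]] by simp
  then obtain B where B: "B \<in> sets C0_borel" "{x \<in> space M. a r x < a q x} = path_of W -` B \<inter> space M"
    unfolding full_def by (auto simp: sets_vimage_algebra2)
  interpret X: prob_space \<xi> using assms by (simp add: rst_def)
  have sets_\<xi>: "sets \<xi> = sets CT_borel" using assms by (simp add: rst_def)
  have "measure \<xi> (B \<times> {..of_rat q}) \<le> measure \<xi> (B \<times> {..of_rat r})"
    using assms(2) B(1) by (intro X.finite_measure_mono) (auto simp: sets_\<xi> of_rat_less_eq intro: order_trans)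
  then have le: "(\<integral>x. indicator B (path_of W x) * a q x \<partial>M) \<le> (\<integral>x. indicator B (path_of W x) * a r x \<partial>M)"
    using assms B(1) by (simp add: rst_def)
  note [measurable] = B(1)
  have int: "integrable M (\<lambda>x. indicat_real B (path_of W x) * a q' x)" for q'
    by (rule integrable_const_bound[where B = 1]) (use a01 in \<open>auto simp: indicator_def\<close>)
  have "AE x in M. indicat_real B (path_of W x) * a q x - indicat_real B (path_of W x) * a r x = 0"
  proof (rule integral_nonneg_eq_0_iff_AE[THEN iffD1])
    show "integrable M (\<lambda>x. indicat_real B (path_of W x) * a q x - indicat_real B (path_of W x) * a r x)"
      by (intro Bochner_Integration.integrable_diff int)
    have nonneg: "0 \<le> indicat_real B (path_of W x) * a q x - indicat_real B (path_of W x) * a r x" if "x \<in> space M" for x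
    proof (cases "path_of W x \<in> B")
      case True
      then have "x \<in> {x \<in> space M. a r x < a q x}" unfolding B(2) using that by simp
      then show ?thesis using True by simp
    qed simp
    then show "AE x in M. 0 \<le> indicat_real B (path_of W x) * a q x - indicat_real B (path_of W x) * a r x"
      by (rule AE_I2)
    from integral_nonneg_AE[OF this]
    show "(\<integral>x. indicat_real B (path_of W x) * a q x - indicat_real B (path_of W x) * a r x \<partial>M) = 0"
      using le by (simp add: Bochner_Integration.integral_diff[OF int int])
  qed
  then show ?thesis
    using AE_space
  proof eventually_elim
    case (elim x)
    show ?case
    proof (rule ccontr)
      assume "\<not> a q x \<le> a r x"
      then have "x \<in> {x \<in> space M. a r x < a q x}" using elim by simp
      then have "path_of W x \<in> B" unfolding B(2) by simp
      with elim(1) \<open>\<not> a q x \<le> a r x\<close> show False by simp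
    qed
  qed
qed

text \<open>The defining identity is linear in the pair \<open>(\<xi>, a)\<close>. Midpoints are all
  that the parallelogram law will ask for.\<close>

lemma rst_mixture:
  assumes 1: "rst \<xi>\<^sub>1 a\<^sub>1" and 2: "rst \<xi>\<^sub>2 a\<^sub>2"
  obtains \<xi> where "rst \<xi> (\<lambda>q x. (a\<^sub>1 q x + a\<^sub>2 q x) / 2)"
    "\<And>f. f \<in> borel_measurable CT_borel \<Longrightarrow>
      (\<integral>\<^sup>+p. f p \<partial>\<xi>) = (\<integral>\<^sup>+p. f p \<partial>\<xi>\<^sub>1) / 2 + (\<integral>\<^sup>+p. f p \<partial>\<xi>\<^sub>2) / 2"
proof -
  have P: "prob_space \<xi>\<^sub>1" "prob_space \<xi>\<^sub>2" and S: "sets \<xi>\<^sub>1 = sets CT_borel" "sets \<xi>\<^sub>2 = sets CT_borel"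
    using 1 2 by (auto simp: rst_def)
  from prob_space_mixture[OF P S] obtain \<xi> where \<xi>: "prob_space \<xi>" "sets \<xi> = sets CT_borel"
    and nn: "\<And>f. f \<in> borel_measurable CT_borel \<Longrightarrow>
      (\<integral>\<^sup>+p. f p \<partial>\<xi>) = (\<integral>\<^sup>+p. f p \<partial>\<xi>\<^sub>1) / 2 + (\<integral>\<^sup>+p. f p \<partial>\<xi>\<^sub>2) / 2"
    by blast
  interpret X: prob_space \<xi> by fact
  interpret X1: prob_space \<xi>\<^sub>1 by fact
  interpret X2: prob_space \<xi>\<^sub>2 by fact
  have half: "ennreal x / 2 = ennreal (x / 2)" if "0 \<le> x" for x
    using divide_ennreal[OF that, of 2] by simp
  have meas: "measure \<xi> A = (measure \<xi>\<^sub>1 A + measure \<xi>\<^sub>2 A) / 2" if A: "A \<in> sets CT_borel" for A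
  proof -
    have "emeasure \<xi> A = emeasure \<xi>\<^sub>1 A / 2 + emeasure \<xi>\<^sub>2 A / 2"
      using nn[of "indicator A"] A by (simp add: \<xi> S)
    then have "ennreal (measure \<xi> A) = ennreal ((measure \<xi>\<^sub>1 A + measure \<xi>\<^sub>2 A) / 2)"
      by (simp add: X.emeasure_eq_measure X1.emeasure_eq_measure X2.emeasure_eq_measure half add_divide_distrib
          flip: ennreal_plus)
    then show ?thesis by (subst (asm) ennreal_inj) auto
  qed
  have am: "a\<^sub>1 q \<in> borel_measurable (past (max 0 (of_rat q)))" "a\<^sub>2 q \<in> borel_measurable (past (max 0 (of_rat q)))" for q
    using 1 2 by (auto simp: rst_def)
  have aM [measurable]: "a\<^sub>1 q \<in> borel_measurable M" "a\<^sub>2 q \<in> borel_measurable M" for q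
    by (rule measurable_from_subalg[OF subalgebra_past am(1)] measurable_from_subalg[OF subalgebra_past am(2)], simp)+
  have a01: "0 \<le> a\<^sub>1 q x" "a\<^sub>1 q x \<le> 1" "0 \<le> a\<^sub>2 q x" "a\<^sub>2 q x \<le> 1" for q x
    using 1 2 by (auto simp: rst_def)
  have "rst \<xi> (\<lambda>q x. (a\<^sub>1 q x + a\<^sub>2 q x) / 2)"
    unfolding rst_def
  proof (intro conjI allI ballI \<xi>)
    show "AE p in \<xi>. 0 < snd p"
    proof -
      define A where "A = {p \<in> space (C0_borel \<Otimes>\<^sub>M (borel :: real measure)). \<not> 0 < snd p}"
      have A: "A \<in> sets CT_borel" unfolding A_def by measurable
      have "emeasure \<xi>\<^sub>1 A = 0" "emeasure \<xi>\<^sub>2 A = 0"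
        using 1 2 AE_iff_measurable[of A \<xi>\<^sub>1 "\<lambda>p. 0 < snd p"] AE_iff_measurable[of A \<xi>\<^sub>2 "\<lambda>p. 0 < snd p"] A
        by (auto simp: rst_def A_def sets_eq_imp_space_eq[OF S(1)] sets_eq_imp_space_eq[OF S(2)])
      then have "emeasure \<xi> A = 0" using nn[of "indicator A"] A by (simp add: \<xi> S)
      then show ?thesis using A
        by (intro AE_I[of _ _ A]) (auto simp: A_def \<xi> sets_eq_imp_space_eq[OF \<xi>(2)])
    qed
    show "(\<lambda>x. (a\<^sub>1 q x + a\<^sub>2 q x) / 2) \<in> borel_measurable (past (max 0 (of_rat q)))" for q
      using am[of q] by measurable
    show "0 \<le> (a\<^sub>1 q x + a\<^sub>2 q x) / 2" "(a\<^sub>1 q x + a\<^sub>2 q x) / 2 \<le> 1" for q x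
      using a01[of q x] by auto
    fix q and B :: "(real \<Rightarrow> real) set" assume B [measurable]: "B \<in> sets C0_borel"
    have int: "integrable M (\<lambda>x. indicat_real B (path_of W x) * a\<^sub>1 q x)" "integrable M (\<lambda>x. indicat_real B (path_of W x) * a\<^sub>2 q x)"
      by (rule integrable_const_bound[where B = 1], use a01 in \<open>auto simp: indicator_def\<close>)+
    have "measure \<xi> (B \<times> {..of_rat q}) = ((\<integral>x. indicat_real B (path_of W x) * a\<^sub>1 q x \<partial>M) + (\<integral>x. indicat_real B (path_of W x) * a\<^sub>2 q x \<partial>M)) / 2"
      using 1 2 B by (subst meas) (auto simp: rst_def)
    also have "\<dots> = (\<integral>x. indicat_real B (path_of W x) * ((a\<^sub>1 q x + a\<^sub>2 q x) / 2) \<partial>M)"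
      using int by (simp add: distrib_left flip: add_divide_distrib)
    finally show "measure \<xi> (B \<times> {..of_rat q}) = (\<integral>x. indicat_real B (path_of W x) * ((a\<^sub>1 q x + a\<^sub>2 q x) / 2) \<partial>M)" .
  qed
  with nn show ?thesis by (rule that[rotated])
qed

end

section \<open>Realization by quantiles\<close>

text \<open>Open half-lines fit the events \<open>quantile a x < s\<close>, whose probabilities are
  accessible.\<close>

lemma measure_eqI_lessThan:
  fixes \<xi> \<nu> :: "('b \<times> real) measure"
  assumes "finite_measure \<xi>" "sets \<xi> = sets (S \<Otimes>\<^sub>M borel)" "sets \<nu> = sets (S \<Otimes>\<^sub>M borel)"
    and eq: "\<And>B s. B \<in> sets S \<Longrightarrow> emeasure \<xi> (B \<times> {..<s}) = emeasure \<nu> (B \<times> {..<s})"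
  shows "\<xi> = \<nu>"
proof (rule measure_eqI_generator_eq)
  define E where "E = {B \<times> A | B A. B \<in> sets S \<and> A \<in> range (lessThan :: real \<Rightarrow> real set)}"
  show "Int_stable E"
    unfolding Int_stable_def
  proof (intro ballI)
    fix X Y assume "X \<in> E" "Y \<in> E"
    then obtain A B s t where "X = A \<times> {..<s}" "Y = B \<times> {..<t}" "A \<in> sets S" "B \<in> sets S" by (auto simp: E_def)
    then have "X \<inter> Y = (A \<inter> B) \<times> {..<min s t}" "A \<inter> B \<in> sets S" by auto
    then show "X \<inter> Y \<in> E" unfolding E_def by blast
  qed
  show "E \<subseteq> Pow (space S \<times> UNIV)" using sets.sets_into_space by (fastforce simp: E_def)
  have "\<exists>n::nat. x < real n" for x by (rule reals_Archimedean2)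
  then have UN: "(\<Union>n::nat. {..<real n}) = (UNIV :: real set)" by auto
  have gen: "sets (S \<Otimes>\<^sub>M (borel :: real measure)) = sigma_sets (space S \<times> UNIV) E"
  proof -
    have "sets (S \<Otimes>\<^sub>M (borel :: real measure)) = sets (sigma (space S \<times> space (borel :: real measure)) E)"
      unfolding E_def
    proof (rule sets_pair_eq[where Ca = "{space S}" and Cb = "range (\<lambda>n::nat. {..<real n})"])
      show "sets (borel :: real measure) = sigma_sets (space borel) (range lessThan)"
        by (subst borel_Iio) (simp add: space_measure_of_conv)
    qed (use UN in \<open>auto simp: sets.sigma_sets_eq dest: sets.sets_into_space\<close>)
    also have "\<dots> = sigma_sets (space S \<times> UNIV) E"
      using sets.sets_into_space by (subst sets_measure_of) (fastforce simp: E_def)+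
    finally show ?thesis .
  qed
  show "sets \<xi> = sigma_sets (space S \<times> UNIV) E" "sets \<nu> = sigma_sets (space S \<times> UNIV) E"
    using assms gen by simp_all
  show "emeasure \<xi> X = emeasure \<nu> X" if "X \<in> E" for X using that eq by (auto simp: E_def)
  show "range (\<lambda>n::nat. space S \<times> {..<real n}) \<subseteq> E" by (auto simp: E_def)
  show "(\<Union>n::nat. space S \<times> {..<real n}) = space S \<times> UNIV" using UN by blast
  show "emeasure \<xi> (space S \<times> {..<real n}) \<noteq> \<infinity>" for n :: nat
    using finite_measure.emeasure_finite[OF assms(1)] by simp
qed

context randomized_brownian
begin

abbreviation unif :: "real measure" where
  "unif \<equiv> uniform_measure lborel {0..1}"

lemma prob_space_unif: "prob_space unif"
  by (rule prob_space_uniform_measure) auto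

text \<open>Keeps the outcome itself as second coordinate, observed through \<open>full\<close>, so
  that functions of the path can be used without factoring them through the path space.\<close>

lemma distr_U_full: "distr M (borel \<Otimes>\<^sub>M full) (\<lambda>x. (U x, x)) = unif \<Otimes>\<^sub>M distr M full (\<lambda>x. x)"
proof -
  have id: "(\<lambda>x. x) \<in> M \<rightarrow>\<^sub>M full" by (rule measurable_from_subalg[OF subalgebra_full]) simp
  have ind: "indep_set (sets (vimage_algebra (space M) U borel)) (sets full)"
    using randomization unfolding uniform_independent_def full_def by blast
  have law: "distr M borel U = unif" using randomization unfolding uniform_independent_def by blast
  show ?thesis unfolding law[symmetric]
  proof (rule distr_pair_indep[OF U_measurable id])
    fix A B assume A: "A \<in> sets (borel :: real measure)" and B: "B \<in> sets full"
    have "(\<lambda>x. x) -` B \<inter> space M = B" using sets.sets_into_space[OF B] by auto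
    then show "prob ((U -` A \<inter> space M) \<inter> ((\<lambda>x. x) -` B \<inter> space M)) = prob (U -` A \<inter> space M) * prob ((\<lambda>x. x) -` B \<inter> space M)"
      using indep_setD[OF ind in_vimage_algebra[OF A] B] by simp
  qed
qed

lemma emeasure_U_full:
  assumes D: "D \<in> sets (borel \<Otimes>\<^sub>M full)"
  shows "emeasure M {x \<in> space M. (U x, x) \<in> D} = (\<integral>\<^sup>+x. emeasure unif {u. (u, x) \<in> D} \<partial>M)"
proof -
  have id: "(\<lambda>x. x) \<in> M \<rightarrow>\<^sub>M full" by (rule measurable_from_subalg[OF subalgebra_full]) simp
  define MF where "MF = distr M full (\<lambda>x. x)"
  interpret unif: prob_space unif by (rule prob_space_unif)
  interpret MF: prob_space MF unfolding MF_def by (rule prob_space_distr[OF id])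
  interpret P: pair_sigma_finite unif MF ..
  have "sets (unif \<Otimes>\<^sub>M MF) = sets (borel \<Otimes>\<^sub>M full)"
    by (rule sets_pair_measure_cong) (auto simp: MF_def)
  with D have D': "D \<in> sets (unif \<Otimes>\<^sub>M MF)" by simp
  have "{x \<in> space M. (U x, x) \<in> D} = (\<lambda>x. (U x, x)) -` D \<inter> space M" by auto
  then have "emeasure M {x \<in> space M. (U x, x) \<in> D} = emeasure (unif \<Otimes>\<^sub>M MF) D"
    unfolding MF_def distr_U_full[symmetric]
    by (simp add: emeasure_distr[OF measurable_Pair[OF U_measurable id] D])
  also have "\<dots> = (\<integral>\<^sup>+x. emeasure unif ((\<lambda>u. (u, x)) -` D) \<partial>MF)"
    by (rule P.emeasure_pair_measure_alt2[OF D'])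
  also have "\<dots> = (\<integral>\<^sup>+x. emeasure unif ((\<lambda>u. (u, x)) -` D) \<partial>M)"
    using P.measurable_emeasure_Pair2[OF D'] unfolding MF_def
    by (intro nn_integral_distr[OF id]) (simp add: measurable_def)
  finally show ?thesis by (simp add: vimage_def)
qed

text \<open>\<open>U\<close> has no atoms and is independent of \<open>a\<close>. Excluding ties is
  what makes quantiles converge in \<open>quantile_tendsto\<close>.\<close>

lemma AE_U_neq:
  assumes a: "a \<in> borel_measurable full"
  shows "AE x in M. U x \<noteq> a x"
proof -
  define D where "D = {p \<in> space (borel \<Otimes>\<^sub>M full). fst p = a (snd p)}"
  note [measurable] = a
  have D: "D \<in> sets (borel \<Otimes>\<^sub>M full)" unfolding D_def by measurable
  have "emeasure unif {u. (u, x) \<in> D} = 0" if x: "x \<in> space M" for x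
  proof -
    have "{u. (u, x) \<in> D} = {a x}" using x by (auto simp: D_def space_pair_measure)
    moreover have "emeasure lborel ({0..1} \<inter> {a x}) \<le> emeasure lborel {a x}"
      by (rule emeasure_mono) auto
    ultimately show ?thesis by (simp add: emeasure_uniform_measure)
  qed
  then have "emeasure M {x \<in> space M. (U x, x) \<in> D} = 0"
    unfolding emeasure_U_full[OF D] by (subst nn_integral_0_iff_AE) (auto simp: nn_integral_cong intro!: AE_I2 cong: measurable_cong)
  moreover have "{x \<in> space M. (U x, x) \<in> D} = {x \<in> space M. U x = a x}"
    by (auto simp: D_def space_pair_measure)
  moreover have "{x \<in> space M. U x = a x} \<in> sets M"
    using measurable_from_subalg[OF subalgebra_full a] by measurable
  ultimately show ?thesis by (intro AE_I[of _ _ "{x \<in> space M. U x = a x}"]) auto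
qed

text \<open>Given the path, \<open>a\<close> is a constant in \<open>[0, 1]\<close>, and a uniform
  variable falls below it with just that probability.\<close>

lemma prob_U_less:
  assumes a: "a \<in> borel_measurable full" and a01: "\<And>x. 0 \<le> a x \<and> a x \<le> 1" and B: "B \<in> sets C0_borel"
  shows "(\<integral>x. indicat_real B (path_of W x) * (if U x < a x then 1 else 0) \<partial>M) =
      (\<integral>x. indicat_real B (path_of W x) * a x \<partial>M)"
proof -
  have path: "path_of W \<in> full \<rightarrow>\<^sub>M C0_borel"
    unfolding full_def by (rule measurable_vimage_algebra1) auto
  have aM [measurable]: "a \<in> borel_measurable M" by (rule measurable_from_subalg[OF subalgebra_full a])
  define D where "D = {p \<in> space (borel \<Otimes>\<^sub>M full). fst p < a (snd p) \<and> path_of W (snd p) \<in> B}"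
  have D: "D \<in> sets (borel \<Otimes>\<^sub>M full)" unfolding D_def
  proof -
    note [measurable] = a path B
    show "{p \<in> space (borel \<Otimes>\<^sub>M full). fst p < a (snd p) \<and> path_of W (snd p) \<in> B} \<in> sets (borel \<Otimes>\<^sub>M full)"
      by measurable
  qed
  note [measurable] = B
  have un: "emeasure unif {u. (u, x) \<in> D} = ennreal (indicat_real B (path_of W x) * a x)" if x: "x \<in> space M" for x
  proof (cases "path_of W x \<in> B")
    case True
    then have "{u. (u, x) \<in> D} = {..<a x}" using x by (auto simp: D_def space_pair_measure)
    moreover have "{0..1} \<inter> {..<a x} = {0..<a x}" using a01[of x] by auto
    ultimately show ?thesis using True a01[of x] by (simp add: emeasure_uniform_measure divide_ennreal_def)
  next
    case False
    then have "{u. (u, x) \<in> D} = {}" by (auto simp: D_def)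
    then show ?thesis using False by simp
  qed
  have D_eq: "{x \<in> space M. (U x, x) \<in> D} = {x \<in> space M. U x < a x \<and> path_of W x \<in> B}"
    by (auto simp: D_def space_pair_measure)
  have Dm: "{x \<in> space M. U x < a x \<and> path_of W x \<in> B} \<in> sets M" by measurable
  have "(\<integral>x. indicat_real B (path_of W x) * (if U x < a x then 1 else 0) \<partial>M) =
      (\<integral>x. indicat_real {x \<in> space M. U x < a x \<and> path_of W x \<in> B} x \<partial>M)"
    by (rule Bochner_Integration.integral_cong) (auto simp: indicator_def)
  also have "\<dots> = prob {x \<in> space M. U x < a x \<and> path_of W x \<in> B}" using Dm by simp
  finally have 1: "ennreal (\<integral>x. indicat_real B (path_of W x) * (if U x < a x then 1 else 0) \<partial>M) =
      emeasure M {x \<in> space M. (U x, x) \<in> D}" unfolding D_eq by (simp add: emeasure_eq_measure)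
  also have "\<dots> = (\<integral>\<^sup>+x. ennreal (indicat_real B (path_of W x) * a x) \<partial>M)"
    unfolding emeasure_U_full[OF D] by (rule nn_integral_cong) (simp add: un)
  also have "\<dots> = ennreal (\<integral>x. indicat_real B (path_of W x) * a x \<partial>M)"
    by (rule nn_integral_eq_integral, rule integrable_const_bound[where B = 1]) (use a01 in \<open>auto simp: indicator_def\<close>)
  finally show ?thesis
    by (subst (asm) ennreal_inj) (auto intro!: Bochner_Integration.integral_nonneg simp: a01)
qed

text \<open>The generalized inverse of \<open>q \<mapsto> a q x\<close> at level \<open>U x\<close>.
  The strict inequality makes \<open>quantile a x < s\<close> a countable union;
  \<open>ennreal\<close> reads negative rationals as 0.\<close>

definition quantile :: "(rat \<Rightarrow> 'a \<Rightarrow> real) \<Rightarrow> 'a \<Rightarrow> ennreal" where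
  "quantile a x = (INF q\<in>{q. U x < a q x}. ennreal (of_rat q))"

lemma quantile_less_iff: "quantile a x < s \<longleftrightarrow> (\<exists>q. ennreal (of_rat q) < s \<and> U x < a q x)"
  unfolding quantile_def by (auto simp: INF_less_iff)

lemma quantile_optional:
  assumes a: "\<And>q. a q \<in> borel_measurable (past (max 0 (of_rat q)))" and s: "0 \<le> s"
  shows "{x \<in> space M. quantile a x < ennreal s} \<in> sets (G (ennreal s))"
proof -
  have "{x \<in> space M. quantile a x < ennreal s} = (\<Union>q\<in>{q. ennreal (of_rat q) < ennreal s}. {x \<in> space M. U x < a q x})"
    by (auto simp: quantile_less_iff)
  also have "\<dots> \<in> sets (G (ennreal s))"
  proof (rule sets.countable_UN')
    show "countable {q::rat. ennreal (of_rat q) < ennreal s}" by (rule countableI_type)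
    show "(\<lambda>q. {x \<in> space M. U x < a q x}) ` {q. ennreal (of_rat q) < ennreal s} \<subseteq> sets (G (ennreal s))"
    proof safe
      fix q :: rat assume q: "ennreal (of_rat q) < ennreal s"
      have "a q \<in> borel_measurable (G (ennreal (max 0 (of_rat q))))"
        by (rule measurable_past_G[OF _ a]) simp
      then have "a q \<in> borel_measurable (G (ennreal s))"
        by (rule measurable_G_mono) (use q in simp)
      from borel_measurable_less[OF U_adapted this]
      show "{x \<in> space M. U x < a q x} \<in> sets (G (ennreal s))" by simp
    qed
  qed
  finally show ?thesis .
qed

lemma quantile_UW_measurable:
  assumes a: "\<And>q. a q \<in> borel_measurable (past (max 0 (of_rat q)))"
  shows "quantile a \<in> borel_measurable (vimage_algebra (space M) UW UC_borel)"
proof (rule borel_measurableI_less)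
  let ?V = "vimage_algebra (space M) UW UC_borel"
  have UWm: "UW \<in> ?V \<rightarrow>\<^sub>M UC_borel"
    by (rule measurable_vimage_algebra1) (auto simp: space_pair_measure)
  have Um: "U \<in> borel_measurable ?V" using measurable_compose[OF UWm measurable_fst] by simp
  have path: "path_of W \<in> ?V \<rightarrow>\<^sub>M C0_borel" using measurable_compose[OF UWm measurable_snd] by simp
  have am: "a q \<in> borel_measurable ?V" for q
  proof (rule measurable_vimage_algebra_mono[where g = "\<lambda>x. x" and h = "a q"])
    show "a q \<in> borel_measurable (vimage_algebra (space M) (path_of W) C0_borel)"
      using measurable_past_full[OF _ a[of q]] by (simp add: full_def)
  qed (use path in auto)
  fix s
  have "{x \<in> space ?V. quantile a x < s} = (\<Union>q\<in>{q. ennreal (of_rat q) < s}. {x \<in> space ?V. U x < a q x})"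
    by (auto simp: quantile_less_iff)
  also have "\<dots> \<in> sets ?V"
    using borel_measurable_less[OF Um am] by (intro sets.countable_UN' countableI_type image_subsetI)
  finally show "{x \<in> space ?V. quantile a x < s} \<in> sets ?V" .
qed

text \<open>Given the path, the event \<open>U < a q\<close> has probability \<open>a q\<close>, and
  for rationals \<open>q\<close> approaching \<open>s\<close> from below these events converge to
  \<open>quantile a < s\<close> by monotonicity in \<open>q\<close>. This yields the joint law on
  open half-lines, and letting \<open>s\<close> grow shows finiteness.\<close>

lemma quantile_law:
  assumes rst: "rst \<xi> a"
  shows "quantile a \<in> borel_measurable M"
    and "distr M CT_borel (\<lambda>x. (path_of W x, enn2real (quantile a x))) = \<xi>"
    and "AE x in M. quantile a x < \<infinity>"
proof -
  have a: "a q \<in> borel_measurable (past (max 0 (of_rat q)))" for q using rst by (simp add: rst_def)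
  have af: "a q \<in> borel_measurable full" for q by (rule measurable_past_full[OF _ a]) simp
  have aM [measurable]: "a q \<in> borel_measurable M" for q by (rule measurable_from_subalg[OF subalgebra_full af])
  have a01: "0 \<le> a q x \<and> a q x \<le> 1" for q x using rst by (simp add: rst_def)
  have sets_\<xi>: "sets \<xi> = sets CT_borel" using rst by (simp add: rst_def)
  interpret X: prob_space \<xi> using rst by (simp add: rst_def)
  show qm [measurable]: "quantile a \<in> borel_measurable M"
    by (rule optional_measurable[OF quantile_optional[OF a]])
  have mono: "AE x in M. \<forall>q r. q \<le> r \<longrightarrow> a q x \<le> a r x"
    unfolding AE_all_countable using rst_mono[OF rst] by auto
  have key: "prob {x \<in> space M. path_of W x \<in> B \<and> quantile a x < ennreal s} = measure \<xi> (B \<times> {..<s})"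
    if B [measurable]: "B \<in> sets C0_borel" and s: "0 < s" for B s
  proof -
    have "\<exists>q::rat. s - 1 / real (Suc n) < of_rat q \<and> real_of_rat q < s" for n
      using of_rat_dense[of "s - 1 / real (Suc n)" s] by auto
    then obtain q :: "nat \<Rightarrow> rat" where q: "\<And>n. s - 1 / real (Suc n) < of_rat (q n)" "\<And>n. real_of_rat (q n) < s" by metis
    have q_lim: "(\<lambda>n. real_of_rat (q n)) \<longlonglongrightarrow> s"
    proof (rule tendsto_sandwich[where f = "\<lambda>n. s - 1 / real (Suc n)" and h = "\<lambda>_. s"])
      show "(\<lambda>n. s - 1 / real (Suc n)) \<longlonglongrightarrow> s"
        using tendsto_diff[OF tendsto_const[of s] LIMSEQ_Suc[OF lim_1_over_n]] by simp
    qed (use q in \<open>auto intro!: always_eventually less_imp_le\<close>)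
    have ev: "\<forall>\<^sub>F n in sequentially. r < real_of_rat (q n)" if "r < s" for r
      by (rule order_tendstoD(1)[OF q_lim that])
    define I where "I n x = indicat_real B (path_of W x) * (if U x < a (q n) x then 1 else 0)" for n x
    have "(\<lambda>n. \<integral>x. I n x \<partial>M) \<longlonglongrightarrow> (\<integral>x. indicat_real {x \<in> space M. path_of W x \<in> B \<and> quantile a x < ennreal s} x \<partial>M)"
    proof (rule integral_dominated_convergence[where w = "\<lambda>_. 1"])
      show "AE x in M. (\<lambda>n. I n x) \<longlonglongrightarrow> indicat_real {x \<in> space M. path_of W x \<in> B \<and> quantile a x < ennreal s} x"
        using mono AE_space
      proof eventually_elim
        case (elim x)
        \<comment> \<open>If the quantile is below \<open>s\<close>, a witness \<open>r < s\<close>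
          is eventually passed by \<open>q n\<close>, and monotonicity transfers
          \<open>U x < a r x\<close>; otherwise no \<open>q n\<close> qualifies.\<close>
        have "\<forall>\<^sub>F n in sequentially. I n x = indicat_real {x \<in> space M. path_of W x \<in> B \<and> quantile a x < ennreal s} x"
        proof (cases "quantile a x < ennreal s")
          case True
          then obtain r where r: "ennreal (of_rat r) < ennreal s" "U x < a r x" unfolding quantile_less_iff by blast
          have "real_of_rat r < s" using r(1) by (meson ennreal_leI leD not_less)
          from ev[OF this] show ?thesis
          proof eventually_elim
            case (elim n)
            then have "a r x \<le> a (q n) x"
              using \<open>\<forall>q r. q \<le> r \<longrightarrow> a q x \<le> a r x\<close> by (simp add: of_rat_less)
            then show ?case using r True \<open>x \<in> space M\<close> by (auto simp: I_def indicator_def)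
          qed
        next
          case False
          have "ennreal (of_rat (q n)) < ennreal s" for n using q(2)[of n] s by (simp add: ennreal_lessI)
          with False have "\<not> U x < a (q n) x" for n unfolding quantile_less_iff by blast
          then show ?thesis using False by (simp add: I_def)
        qed
        then show ?case by (rule tendsto_eventually)
      qed
      show "I n \<in> borel_measurable M" for n unfolding I_def by measurable
      show "AE x in M. norm (I n x) \<le> 1" for n by (auto simp: I_def indicator_def)
    qed auto
    moreover have "(\<integral>x. I n x \<partial>M) = measure \<xi> (B \<times> {..of_rat (q n)})" for n
      unfolding I_def using prob_U_less[OF af a01 B] rst B by (simp add: rst_def)
    moreover have "(\<lambda>n. measure \<xi> (B \<times> {..of_rat (q n)})) \<longlonglongrightarrow> measure \<xi> (B \<times> {..<s})"
    proof -
      have BS: "B \<times> {..t} \<in> sets \<xi>" "B \<times> {..<t} \<in> sets \<xi>" for t :: real by (auto simp: sets_\<xi>)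
      have "(\<lambda>n. \<integral>p. indicat_real (B \<times> {..of_rat (q n)}) p \<partial>\<xi>) \<longlonglongrightarrow> (\<integral>p. indicat_real (B \<times> {..<s}) p \<partial>\<xi>)"
      proof (rule integral_dominated_convergence[where w = "\<lambda>_. 1"])
        show "AE p in \<xi>. (\<lambda>n. indicat_real (B \<times> {..of_rat (q n)}) p) \<longlonglongrightarrow> indicat_real (B \<times> {..<s}) p"
        proof (rule AE_I2)
          fix p :: "(real \<Rightarrow> real) \<times> real"
          have "\<forall>\<^sub>F n in sequentially. indicat_real (B \<times> {..of_rat (q n)}) p = indicat_real (B \<times> {..<s}) p"
          proof (cases "snd p < s")
            case True
            from ev[OF this] show ?thesis
              by eventually_elim (use True in \<open>auto simp: indicator_def mem_Times_iff\<close>)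
          next
            case False
            then have "\<not> snd p \<le> of_rat (q n)" for n using q(2)[of n] by linarith
            then show ?thesis using False by (auto simp: indicator_def mem_Times_iff)
          qed
          then show "(\<lambda>n. indicat_real (B \<times> {..of_rat (q n)}) p) \<longlonglongrightarrow> indicat_real (B \<times> {..<s}) p"
            by (rule tendsto_eventually)
        qed
      qed (use BS in \<open>auto simp: indicator_def\<close>)
      then show ?thesis using BS by simp
    qed
    ultimately have "(\<integral>x. indicat_real {x \<in> space M. path_of W x \<in> B \<and> quantile a x < ennreal s} x \<partial>M) = measure \<xi> (B \<times> {..<s})"
      using LIMSEQ_unique by fastforce
    moreover have "{x \<in> space M. path_of W x \<in> B \<and> quantile a x < ennreal s} \<in> sets M" by measurable
    ultimately show ?thesis by simp
  qed
  show fin: "AE x in M. quantile a x < \<infinity>"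
  proof -
    define A where "A n = {x \<in> space M. path_of W x \<in> C0 \<and> quantile a x < ennreal (real (Suc n))}" for n
    have C0S: "C0 \<in> sets C0_borel" using sets.top[of C0_borel] by simp
    then have Am: "A n \<in> sets M" for n unfolding A_def by measurable
    have "(\<lambda>n. measure \<xi> (C0 \<times> {..<real (Suc n)})) \<longlonglongrightarrow> measure \<xi> (\<Union>n. C0 \<times> {..<real (Suc n)})"
      using C0S by (intro X.finite_Lim_measure_incseq) (auto simp: incseq_def sets_\<xi>)
    also have "(\<Union>n. C0 \<times> {..<real (Suc n)}) = space \<xi>"
    proof -
      have "\<exists>n. y < real (Suc n)" for y
        using reals_Archimedean2[of y] by (metis less_trans of_nat_less_iff lessI)
      then show ?thesis by (auto simp: sets_eq_imp_space_eq[OF sets_\<xi>] space_pair_measure)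
    qed
    finally have "(\<lambda>n. measure \<xi> (C0 \<times> {..<real (Suc n)})) \<longlonglongrightarrow> 1" by (simp add: X.prob_space)
    moreover have "measure \<xi> (C0 \<times> {..<real (Suc n)}) = prob (A n)" for n
      using key[OF C0S, of "real (Suc n)"] by (simp add: A_def)
    moreover have "prob (A n) \<le> prob {x \<in> space M. quantile a x < \<infinity>}" for n
      by (rule finite_measure_mono) (auto simp: A_def less_top intro: less_trans)
    ultimately have "1 \<le> prob {x \<in> space M. quantile a x < \<infinity>}"
      by (intro LIMSEQ_le_const2) auto
    moreover have "prob {x \<in> space M. quantile a x < \<infinity>} \<le> 1" by simp
    ultimately have "prob {x \<in> space M. quantile a x < \<infinity>} = 1" by linarith
    moreover have "{x \<in> space M. quantile a x < \<infinity>} \<in> sets M" by measurable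
    ultimately have "AE x in M. x \<in> {x \<in> space M. quantile a x < \<infinity>}" using AE_in_set_eq_1 by blast
    then show ?thesis by eventually_elim simp
  qed
  define X where "X x = (path_of W x, enn2real (quantile a x))" for x
  have Xm: "X \<in> M \<rightarrow>\<^sub>M CT_borel" unfolding X_def by measurable
  have "distr M CT_borel X = \<xi>"
  proof (rule measure_eqI_lessThan[where S = C0_borel])
    show "finite_measure (distr M CT_borel X)"
      using prob_space_distr[OF Xm] by (rule prob_space.finite_measure)
    fix B s assume B [measurable]: "B \<in> sets C0_borel"
    have "emeasure (distr M CT_borel X) (B \<times> {..<s}) = emeasure M (X -` (B \<times> {..<s}) \<inter> space M)"
      by (rule emeasure_distr[OF Xm]) auto
    also have "\<dots> = emeasure \<xi> (B \<times> {..<s})"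
    \<comment> \<open>For \<open>s \<le> 0\<close> both sides vanish: \<open>enn2real\<close> is
      nonnegative, and \<open>\<xi>\<close> charges only positive times.\<close>
    proof (cases "0 < s")
      case True
      have "emeasure M (X -` (B \<times> {..<s}) \<inter> space M) = emeasure M {x \<in> space M. path_of W x \<in> B \<and> quantile a x < ennreal s}"
      proof (rule emeasure_eq_AE)
        show "AE x in M. x \<in> X -` (B \<times> {..<s}) \<inter> space M \<longleftrightarrow> x \<in> {x \<in> space M. path_of W x \<in> B \<and> quantile a x < ennreal s}"
          using fin
        proof eventually_elim
          case (elim x)
          then obtain t where "quantile a x = ennreal t" "0 \<le> t" by (cases "quantile a x") auto
          then show ?case by (auto simp: X_def ennreal_less_iff)
        qed
        show "X -` (B \<times> {..<s}) \<inter> space M \<in> sets M" by (rule measurable_sets[OF Xm]) auto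
      qed measurable
      then show ?thesis using key[OF B True] by (simp add: emeasure_eq_measure X.emeasure_eq_measure)
    next
      case False
      have "X -` (B \<times> {..<s}) \<inter> space M = {}"
        using False by (auto simp: X_def) (meson enn2real_nonneg le_less_trans less_imp_le)
      moreover have "emeasure \<xi> (B \<times> {..<s}) = 0"
      proof -
        have "AE p in \<xi>. 0 < snd p" using rst by (simp add: rst_def)
        then have "AE p in \<xi>. p \<notin> B \<times> {..<s}" by eventually_elim (use False in auto)
        moreover have "B \<times> {..<s} \<in> sets \<xi>" by (auto simp: sets_\<xi>)
        ultimately show ?thesis using AE_iff_null_sets null_setsD1 by blast
      qed
      ultimately show ?thesis by simp
    qed
    finally show "emeasure (distr M CT_borel X) (B \<times> {..<s}) = emeasure \<xi> (B \<times> {..<s})" .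
  qed (simp_all add: sets_\<xi>)
  then show "distr M CT_borel (\<lambda>x. (path_of W x, enn2real (quantile a x))) = \<xi>"
    by (simp add: X_def[abs_def])
qed

text \<open>An upper bound comes from a single \<open>q\<close> with \<open>U < a q\<close>, which
  persists along the sequence. For a lower bound take \<open>q\<close> below the quantile:
  \<open>a q \<le> U\<close> is strict since ties are excluded, hence persists, and monotonicity of
  \<open>b n\<close> rules out all smaller rationals at once.\<close>

lemma quantile_tendsto:
  assumes lim: "\<And>q. (\<lambda>n. b n q x) \<longlonglongrightarrow> a q x" and mono: "\<And>n q r. q \<le> r \<Longrightarrow> b n q x \<le> b n r x"
    and neq: "\<And>q. U x \<noteq> a q x"
  shows "(\<lambda>n. quantile (b n) x) \<longlonglongrightarrow> quantile a x"
proof (rule order_tendstoI)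
  fix s assume "quantile a x < s"
  then obtain q where q: "ennreal (of_rat q) < s" "U x < a q x" unfolding quantile_less_iff by blast
  from order_tendstoD(1)[OF lim q(2)] show "\<forall>\<^sub>F n in sequentially. quantile (b n) x < s"
    by eventually_elim (use q in \<open>auto simp: quantile_less_iff\<close>)
next
  fix s assume s: "s < quantile a x"
  then obtain s' where s': "s < s'" "s' < quantile a x" using dense by blast
  define u v where "u = enn2real s" and "v = enn2real s'"
  have u: "s = ennreal u" "0 \<le> u" using s' unfolding u_def by (cases s; auto)+
  have v: "s' = ennreal v" "0 \<le> v" using s' unfolding v_def by (cases s'; auto)+
  have "u < v" using s'(1) u v by (simp add: ennreal_less_iff)
  then obtain q :: rat where q: "u < of_rat q" "of_rat q < v" using of_rat_dense by blast
  have "ennreal (of_rat q) \<le> ennreal v" using q by (intro ennreal_leI) simp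
  also have "\<dots> < quantile a x" using s'(2) by (simp add: v(1))
  finally have "ennreal (of_rat q) < quantile a x" .
  then have "\<not> U x < a q x" unfolding quantile_def by (metis (mono_tags, lifting) INF_lower leD mem_Collect_eq)
  with neq[of q] have "a q x < U x" by simp
  from order_tendstoD(2)[OF lim this] show "\<forall>\<^sub>F n in sequentially. s < quantile (b n) x"
  proof eventually_elim
    case (elim n)
    have "ennreal (of_rat q) \<le> quantile (b n) x"
      unfolding quantile_def
    proof (rule INF_greatest)
      fix r assume "r \<in> {r. U x < b n r x}"
      then have "\<not> r \<le> q" using mono[of r q n] elim by auto
      then show "ennreal (of_rat q) \<le> ennreal (of_rat r)" by (intro ennreal_leI) (simp add: of_rat_less_eq)
    qed
    moreover have "s < ennreal (of_rat q)" using u q by (simp add: ennreal_less_iff)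
    ultimately show ?case by simp
  qed
qed

end

section \<open>A selection lemma for convex sets\<close>

text \<open>The Hilbert space substitute for weak compactness: elements of almost minimal norm in a
  decreasing sequence of convex sets form a Cauchy sequence, by the parallelogram law.\<close>

lemma (in prob_space) midpoint_convex_selection:
  fixes C :: "nat \<Rightarrow> ('a \<Rightarrow> real) set"
  assumes meas: "\<And>n f. f \<in> C n \<Longrightarrow> f \<in> borel_measurable M"
    and bound: "\<And>n f x. f \<in> C n \<Longrightarrow> x \<in> space M \<Longrightarrow> \<bar>f x\<bar> \<le> 1"
    and mid: "\<And>n f g. f \<in> C n \<Longrightarrow> g \<in> C n \<Longrightarrow> (\<lambda>x. (f x + g x) / 2) \<in> C n"
    and dec: "\<And>n. C (Suc n) \<subseteq> C n" and ne: "\<And>n. C n \<noteq> {}"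
  obtains s where "\<And>n. s n \<in> C n" "AE x in M. convergent (\<lambda>n. s n x)"
proof -
  define E where "E f = (\<integral>x. (f x)\<^sup>2 \<partial>M)" for f :: "'a \<Rightarrow> real"
  define d where "d n = Inf (E ` C n)" for n
  have sub: "C m \<subseteq> C n" if "n \<le> m" for n m using lift_Suc_antimono_le[of C, OF dec that] .
  have int: "integrable M (\<lambda>x. (f x)\<^sup>2)" if "f \<in> C n" for f n
    by (rule integrable_const_bound[where B = 1])
      (use meas[OF that] bound[OF that] in \<open>auto simp: abs_square_le_1\<close>)
  have E_bound: "0 \<le> E f" "E f \<le> 1" if "f \<in> C n" for f n
  proof -
    show "0 \<le> E f" by (simp add: E_def)
    have "E f \<le> (\<integral>x. 1 \<partial>M)" unfolding E_def
      by (rule integral_mono[OF int[OF that]]) (use bound[OF that] in \<open>auto simp: abs_square_le_1\<close>)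
    then show "E f \<le> 1" by (simp add: prob_space)
  qed
  have bdd: "bdd_below (E ` C n)" for n using E_bound(1) by (intro bdd_belowI2[of _ 0]) auto
  have d_le: "d n \<le> E f" if "f \<in> C n" for n f
    unfolding d_def by (rule cInf_lower[OF _ bdd]) (use that in auto)
  have d_mono: "d n \<le> d m" if "n \<le> m" for n m
    unfolding d_def using ne sub[OF that] by (intro cInf_superset_mono bdd) auto
  have d1: "d n \<le> 1" for n
  proof -
    obtain f where "f \<in> C n" using ne by blast
    with d_le E_bound(2) show ?thesis by (meson order_trans)
  qed
  obtain L where L: "d \<longlonglongrightarrow> L" "\<And>n. d n \<le> L"
    using incseq_convergent[of d 1] d_mono d1 by (auto simp: incseq_def)
  have "\<exists>f\<in>C n. E f < d n + 1 / real (Suc n)" for n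
    using cInf_lessD[of "E ` C n" "d n + 1 / real (Suc n)"] ne unfolding d_def by auto
  then obtain f where f: "\<And>n. f n \<in> C n" and Ef: "\<And>n. E (f n) < d n + 1 / real (Suc n)" by metis
  note [measurable] = meas[OF f]
  have f_bound: "\<bar>f n x\<bar> \<le> 1" if "x \<in> space M" for n x using bound[OF f that] .
  \<comment> \<open>The parallelogram bound: \<open>2 (d m + d n) - 4 d n\<close> is at most
    \<open>2 (L - d n)\<close>, and the slacks \<open>2/(m+1)\<close> and \<open>2/(n+1)\<close> are
    together at most \<open>4/(n+1)\<close> when \<open>n \<le> m\<close>.\<close>
  define r where "r n = 2 * (L - d n) + 4 / real (Suc n)" for n
  have r0: "r \<longlonglongrightarrow> 0"
  proof -
    have "(\<lambda>n. 2 * (L - d n) + 4 * (1 / real (Suc n))) \<longlonglongrightarrow> 2 * (L - L) + 4 * 0"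
      by (intro tendsto_intros L LIMSEQ_Suc[OF lim_1_over_n])
    then show ?thesis by (simp add: r_def[abs_def])
  qed
  have diff: "(\<integral>x. (f m x - f n x)\<^sup>2 \<partial>M) \<le> r n" if nm: "n \<le> m" for n m
  proof -
    have fm: "f m \<in> C n" using f sub[OF nm] by auto
    define g where "g x = (f m x + f n x) / 2" for x
    have g: "g \<in> C n" unfolding g_def by (rule mid[OF fm f])
    have "(\<integral>x. (f m x - f n x)\<^sup>2 \<partial>M) = (\<integral>x. 2 * (f m x)\<^sup>2 + 2 * (f n x)\<^sup>2 - 4 * (g x)\<^sup>2 \<partial>M)"
      by (rule Bochner_Integration.integral_cong[OF refl]) (simp add: g_def power2_eq_square field_simps)
    also have "\<dots> = 2 * E (f m) + 2 * E (f n) - 4 * E g"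
      using int[OF fm] int[OF f] int[OF g] by (simp add: E_def)
    also have "\<dots> \<le> 2 * (d m + 1 / real (Suc m)) + 2 * (d n + 1 / real (Suc n)) - 4 * d n"
      using Ef[of m] Ef[of n] d_le[OF g] by (intro diff_mono add_mono mult_left_mono less_imp_le) auto
    also have "\<dots> \<le> r n"
    proof -
      have "1 / real (Suc m) \<le> 1 / real (Suc n)" using nm by (simp add: frac_le)
      then show ?thesis using L(2)[of m] unfolding r_def by (simp add: algebra_simps)
    qed
    finally show ?thesis .
  qed
  \<comment> \<open>From the mean square to the mean by \<open>y \<le> e + y\<^sup>2 / e\<close>.
    With half the target for \<open>e\<close>, it remains to make \<open>r n\<close> smaller than
    the square of that half.\<close>
  have L1: "(\<integral>x. \<bar>f m x - f n x\<bar> \<partial>M) \<le> e + r n / e" if "n \<le> m" "0 < e" for n m e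
  proof -
    have i2: "integrable M (\<lambda>x. (f m x - f n x)\<^sup>2)"
    proof (rule integrable_const_bound[where B = 4])
      show "AE x in M. norm ((f m x - f n x)\<^sup>2) \<le> 4"
      proof (rule AE_I2)
        fix x assume "x \<in> space M"
        then have "\<bar>f m x - f n x\<bar> \<le> 2" using f_bound[of x m] f_bound[of x n] by linarith
        then have "\<bar>f m x - f n x\<bar>\<^sup>2 \<le> 2\<^sup>2" by (rule power_mono) simp
        then show "norm ((f m x - f n x)\<^sup>2) \<le> 4" by simp
      qed
    qed measurable
    have "(\<integral>x. \<bar>f m x - f n x\<bar> \<partial>M) \<le> (\<integral>x. e + (f m x - f n x)\<^sup>2 / e \<partial>M)"
    proof (rule integral_mono_AE')
      show "integrable M (\<lambda>x. e + (f m x - f n x)\<^sup>2 / e)" using i2 by simp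
      show "AE x in M. \<bar>f m x - f n x\<bar> \<le> e + (f m x - f n x)\<^sup>2 / e"
      proof (rule AE_I2)
        fix x
        define y where "y = \<bar>f m x - f n x\<bar>"
        have y: "0 \<le> y" "(f m x - f n x)\<^sup>2 = y * y" by (simp_all add: y_def power2_eq_square)
        have "y \<le> e + y * y / e"
        proof (cases "y \<le> e")
          case True
          then show ?thesis using y(1) that by (simp add: add_increasing2)
        next
          case False
          then have "y * e \<le> y * y" using y(1) by (intro mult_left_mono) auto
          then have "y \<le> y * y / e" using that by (simp add: pos_le_divide_eq)
          then show ?thesis using that by simp
        qed
        then show "\<bar>f m x - f n x\<bar> \<le> e + (f m x - f n x)\<^sup>2 / e" unfolding y(2) by (simp add: y_def)
      qed
    qed (use that in \<open>auto intro!: AE_I2 add_nonneg_nonneg\<close>)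
    also have "\<dots> = e + (\<integral>x. (f m x - f n x)\<^sup>2 \<partial>M) / e" using i2 by (simp add: prob_space)
    also have "\<dots> \<le> e + r n / e" using diff[OF that(1)] that(2) by (simp add: divide_right_mono)
    finally show ?thesis .
  qed
  have cauchy: "\<exists>N. \<forall>i\<ge>N. \<forall>j\<ge>N. (\<integral>x. norm (f i x - f j x) \<partial>M) < e" if e: "0 < e" for e :: real
  proof -
    have "0 < (e/2) * (e/2)" using e by simp
    from order_tendstoD(2)[OF r0 this] obtain N where N: "\<And>n. n \<ge> N \<Longrightarrow> r n < (e/2) * (e/2)"
      unfolding eventually_sequentially by auto
    have lt: "(\<integral>x. \<bar>f m x - f n x\<bar> \<partial>M) < e" if "n \<ge> N" "n \<le> m" for n m
    proof -
      have "r n / (e/2) < e/2" using N[OF that(1)] e by (simp add: pos_divide_less_eq)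
      with L1[OF that(2), of "e/2"] e show ?thesis by simp
    qed
    show ?thesis
    proof (intro exI[of _ N] allI impI)
      fix i j assume "i \<ge> N" "j \<ge> N"
      then show "(\<integral>x. norm (f i x - f j x) \<partial>M) < e"
        using lt[of j i] lt[of i j] by (cases "j \<le> i") (auto simp: abs_minus_commute)
    qed
  qed
  have f_int: "integrable M (f n)" for n
    by (rule integrable_const_bound[where B = 1]) (use f_bound in auto)
  obtain k where k: "strict_mono k" "AE x in M. Cauchy (\<lambda>i. f (k i) x)"
    using cauchy_L1_AE_cauchy_subseq[OF f_int cauchy] by blast
  show ?thesis
  proof
    show "f (k n) \<in> C n" for n using f[of "k n"] sub[OF seq_suble[OF k(1)]] by blast
    show "AE x in M. convergent (\<lambda>n. f (k n) x)" using k(2) by (simp add: Cauchy_convergent_iff)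
  qed
qed

section \<open>Compactness\<close>

text \<open>Nonnegativity makes these integrals representable in \<open>ennreal\<close> without
  truncation, and the class is stable under \<open>f \<mapsto> 1 - f\<close>, so that one-sided
  bounds for all its members become equalities.\<close>

definition Lip1 :: "(real \<Rightarrow> real) set" where
  "Lip1 = {f. (\<forall>x. 0 \<le> f x \<and> f x \<le> 1) \<and> (\<forall>x y. \<bar>f x - f y\<bar> \<le> \<bar>x - y\<bar>)}"

lemma lipschitz_borel_measurable:
  fixes f :: "real \<Rightarrow> real"
  assumes "\<And>x y. \<bar>f x - f y\<bar> \<le> \<bar>x - y\<bar>"
  shows "f \<in> borel_measurable borel"
proof (rule borel_measurable_continuous_onI)
  show "continuous_on UNIV f"
    unfolding continuous_on_iff dist_real_def using assms by (meson le_less_trans)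
qed

lemma Lip1_measurable: "f \<in> Lip1 \<Longrightarrow> f \<in> borel_measurable borel"
  by (rule lipschitz_borel_measurable) (simp add: Lip1_def)

lemma Lip1_compl: "f \<in> Lip1 \<Longrightarrow> (\<lambda>x. 1 - f x) \<in> Lip1"
  by (auto simp: Lip1_def abs_minus_commute)

text \<open>The easy half of Kantorovich duality: integrate the Lipschitz inequality against a
  coupling of cost below \<open>e\<close>. Besides bounded test functions, the identity will be
  inserted to bound means.\<close>

lemma nn_integral_W1_le:
  fixes f :: "real \<Rightarrow> real"
  assumes W: "W1 \<mu> \<nu> < ennreal e" and lip: "\<And>x y. \<bar>f x - f y\<bar> \<le> \<bar>x - y\<bar>"
  shows "(\<integral>\<^sup>+x. ennreal (f x) \<partial>\<nu>) \<le> (\<integral>\<^sup>+x. ennreal (f x) \<partial>\<mu>) + ennreal e"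
proof -
  obtain \<pi> where \<pi>: "\<pi> \<in> couplings \<mu> \<nu>" "(\<integral>\<^sup>+p. ennreal \<bar>fst p - snd p\<bar> \<partial>\<pi>) < ennreal e"
    using W unfolding W1_def INF_less_iff by blast
  have sets: "sets \<pi> = sets (borel \<Otimes>\<^sub>M borel)" and law: "distr \<pi> borel fst = \<mu>" "distr \<pi> borel snd = \<nu>"
    using \<pi>(1) by (auto simp: couplings_def)
  have fst_m [measurable]: "fst \<in> borel_measurable \<pi>" and snd_m [measurable]: "snd \<in> borel_measurable \<pi>"
    by (simp_all add: measurable_cong_sets[OF sets refl])
  have fm [measurable]: "f \<in> borel_measurable borel" by (rule lipschitz_borel_measurable[OF lip])
  have "(\<integral>\<^sup>+x. ennreal (f x) \<partial>distr \<pi> borel fst) = (\<integral>\<^sup>+p. ennreal (f (fst p)) \<partial>\<pi>)"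
    by (rule nn_integral_distr[OF fst_m]) simp
  then have eq_fst: "(\<integral>\<^sup>+p. ennreal (f (fst p)) \<partial>\<pi>) = (\<integral>\<^sup>+x. ennreal (f x) \<partial>\<mu>)" by (simp only: law)
  have "(\<integral>\<^sup>+x. ennreal (f x) \<partial>distr \<pi> borel snd) = (\<integral>\<^sup>+p. ennreal (f (snd p)) \<partial>\<pi>)"
    by (rule nn_integral_distr[OF snd_m]) simp
  then have "(\<integral>\<^sup>+x. ennreal (f x) \<partial>\<nu>) = (\<integral>\<^sup>+p. ennreal (f (snd p)) \<partial>\<pi>)" by (simp only: law)
  also have "\<dots> \<le> (\<integral>\<^sup>+p. ennreal (f (fst p)) + ennreal \<bar>fst p - snd p\<bar> \<partial>\<pi>)"
  proof (rule nn_integral_mono)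
    fix p
    have "f (snd p) \<le> f (fst p) + \<bar>fst p - snd p\<bar>" using lip[of "snd p" "fst p"] by linarith
    then have "ennreal (f (snd p)) \<le> ennreal (f (fst p) + \<bar>fst p - snd p\<bar>)" by (rule ennreal_leI)
    also have "\<dots> \<le> ennreal (max 0 (f (fst p)) + \<bar>fst p - snd p\<bar>)" by (rule ennreal_leI) simp
    also have "\<dots> = ennreal (f (fst p)) + ennreal \<bar>fst p - snd p\<bar>" by (subst ennreal_plus) auto
    finally show "ennreal (f (snd p)) \<le> ennreal (f (fst p)) + ennreal \<bar>fst p - snd p\<bar>" .
  qed
  also have "\<dots> = (\<integral>\<^sup>+p. ennreal (f (fst p)) \<partial>\<pi>) + (\<integral>\<^sup>+p. ennreal \<bar>fst p - snd p\<bar> \<partial>\<pi>)"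
    by (rule nn_integral_add) measurable
  also note eq_fst
  finally show ?thesis using \<pi>(2) by (meson add_left_mono less_imp_le order_trans)
qed

text \<open>Passing from \<open>f\<close> to \<open>1 - f\<close> reverses the inequality, so
  integrals of test functions agree; steep ramps made from them recover the distribution
  functions.\<close>

lemma measure_eqI_Lip1:
  assumes \<nu>: "prob_space \<nu>" "sets \<nu> = sets borel" and \<mu>: "prob_space \<mu>" "sets \<mu> = sets borel"
    and le: "\<And>f. f \<in> Lip1 \<Longrightarrow> (\<integral>x. f x \<partial>\<nu>) \<le> (\<integral>x. f x \<partial>\<mu>)"
  shows "\<nu> = \<mu>"
proof (rule cdf_unique)
  have int: "integrable N f" if "f \<in> Lip1" "prob_space N" "sets N = sets borel" for f N
  proof -
    interpret prob_space N by fact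
    show ?thesis using that Lip1_measurable[OF that(1)]
      by (intro integrable_const_bound[where B = 1]) (auto simp: Lip1_def measurable_cong_sets[OF that(3) refl])
  qed
  have eq: "(\<integral>x. f x \<partial>\<nu>) = (\<integral>x. f x \<partial>\<mu>)" if f: "f \<in> Lip1" for f
  proof -
    have "(\<integral>x. 1 - f x \<partial>\<nu>) \<le> (\<integral>x. 1 - f x \<partial>\<mu>)" by (rule le[OF Lip1_compl[OF f]])
    then have "(\<integral>x. f x \<partial>\<mu>) \<le> (\<integral>x. f x \<partial>\<nu>)"
      using int[OF f \<nu>] int[OF f \<mu>] prob_space.prob_space[OF \<nu>(1)] prob_space.prob_space[OF \<mu>(1)]
        prob_space.finite_measure[OF \<nu>(1)] prob_space.finite_measure[OF \<mu>(1)]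
      by (simp add: finite_measure.integrable_const)
    with le[OF f] show ?thesis by simp
  qed
  show "real_distribution \<nu>" "real_distribution \<mu>"
    using assms sets_eq_imp_space_eq[of \<nu> borel] sets_eq_imp_space_eq[of \<mu> borel]
    by (auto simp: real_distribution_def real_distribution_axioms_def)
  show "cdf \<nu> = cdf \<mu>"
  proof
    fix c
    \<comment> \<open>Height \<open>1/(m+1)\<close> keeps the slope at 1; multiplied by
      \<open>m + 1\<close>, the ramp is 1 up to \<open>c\<close> and 0 from
      \<open>c + 1/(m+1)\<close> on.\<close>
    define f where "f m x = min (1 / real (Suc m)) (max 0 (c - x + 1 / real (Suc m)))" for m x
    have f: "f m \<in> Lip1" for m
    proof -
      have "1 / real (Suc m) \<le> 1" by simp
      then have "f m x \<le> 1" for x unfolding f_def by (rule order_trans[OF min.cobounded1])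
      then show ?thesis unfolding Lip1_def f_def by (auto simp: min_def max_def abs_if)
    qed
    have lim: "(\<lambda>m. \<integral>x. real (Suc m) * f m x \<partial>N) \<longlonglongrightarrow> (\<integral>x. indicat_real {..c} x \<partial>N)"
      if N: "prob_space N" "sets N = sets borel" for N
    proof (rule integral_dominated_convergence[where w = "\<lambda>_. 1"])
      have bound: "0 \<le> real (Suc m) * f m x" "real (Suc m) * f m x \<le> 1" for m x
      proof -
        show "0 \<le> real (Suc m) * f m x" using f[of m] by (auto simp: Lip1_def)
        have "real (Suc m) * f m x \<le> real (Suc m) * (1 / real (Suc m))"
          by (rule mult_left_mono) (auto simp: f_def)
        then show "real (Suc m) * f m x \<le> 1" by simp
      qed
      show "AE x in N. (\<lambda>m. real (Suc m) * f m x) \<longlonglongrightarrow> indicat_real {..c} x"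
      proof (rule AE_I2)
        fix x
        show "(\<lambda>m. real (Suc m) * f m x) \<longlonglongrightarrow> indicat_real {..c} x"
        proof (cases "x \<le> c")
          case True
          then have "real (Suc m) * f m x = indicat_real {..c} x" for m
            by (simp add: f_def max_def min_def)
          then show ?thesis by (simp only: tendsto_const)
        next
          case False
          then obtain k where k: "1 / real (Suc k) < x - c"
            using reals_Archimedean[of "x - c"] by (auto simp: inverse_eq_divide)
          have "real (Suc m) * f m x = indicat_real {..c} x" if "k \<le> m" for m
          proof -
            have "1 / real (Suc m) \<le> 1 / real (Suc k)" using that by (simp add: frac_le)
            with k have neg: "c - x + 1 / real (Suc m) \<le> 0" by linarith
            have "f m x = 0" unfolding f_def max_absorb1[OF neg] by simp
            then show ?thesis using False by simp
          qed
          then have "\<forall>\<^sub>F m in sequentially. real (Suc m) * f m x = indicat_real {..c} x"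
            unfolding eventually_sequentially by blast
          then show ?thesis by (rule tendsto_eventually)
        qed
      qed
      show "AE x in N. norm (real (Suc m) * f m x) \<le> 1" for m
        by (rule AE_I2) (simp only: real_norm_def abs_of_nonneg[OF bound(1)] bound(2))
      show "(\<lambda>x. real (Suc m) * f m x) \<in> borel_measurable N" for m
        using borel_measurable_integrable[OF int[OF f N]] by measurable
      show "integrable N (\<lambda>_. 1 :: real)" using N by (simp add: finite_measure.integrable_const prob_space.finite_measure)
      show "indicat_real {..c} \<in> borel_measurable N" by (rule borel_measurable_indicator) (simp add: N)
    qed
    have "(\<integral>x. real (Suc m) * f m x \<partial>\<nu>) = (\<integral>x. real (Suc m) * f m x \<partial>\<mu>)" for m
      using eq[OF f[of m]] by simp
    with lim[OF \<nu>] lim[OF \<mu>] have "(\<integral>x. indicat_real {..c} x \<partial>\<nu>) = (\<integral>x. indicat_real {..c} x \<partial>\<mu>)"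
      using LIMSEQ_unique by force
    then show "cdf \<nu> c = cdf \<mu> c"
      by (simp add: cdf_def \<nu> \<mu> sets_eq_imp_space_eq[OF \<nu>(2)] sets_eq_imp_space_eq[OF \<mu>(2)])
  qed
qed

text \<open>Trades a lower bound on a possibly infinite expectation for an upper bound on the
  integral of a nonnegative function. Positive part plus \<open>K - f\<close> equals
  \<open>K\<close> plus negative part, and the integral of the positive part is finite, so it can be
  cancelled.\<close>

lemma (in prob_space) le_ext_expectation_iff:
  assumes f [measurable]: "f \<in> borel_measurable M" and le: "\<And>x. x \<in> space M \<Longrightarrow> f x \<le> K" and K: "0 \<le> K" "b \<le> K"
  shows "ereal b \<le> ext_expectation M f \<longleftrightarrow> (\<integral>\<^sup>+x. ennreal (K - f x) \<partial>M) \<le> ennreal (K - b)"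
proof -
  define J where "J = (\<integral>\<^sup>+x. ennreal (K - f x) \<partial>M)"
  define P where "P = (\<integral>\<^sup>+x. ennreal (f x) \<partial>M)"
  define N where "N = (\<integral>\<^sup>+x. ennreal (- f x) \<partial>M)"
  have "J + P = (\<integral>\<^sup>+x. ennreal (K - f x) + ennreal (f x) \<partial>M)"
    unfolding J_def P_def by (rule nn_integral_add[symmetric]) measurable
  also have "\<dots> = (\<integral>\<^sup>+x. ennreal K + ennreal (- f x) \<partial>M)"
  proof (rule nn_integral_cong)
    fix x assume "x \<in> space M"
    with le have "f x \<le> K" by simp
    then show "ennreal (K - f x) + ennreal (f x) = ennreal K + ennreal (- f x)"
    proof (cases "0 \<le> f x")
      case True
      with \<open>f x \<le> K\<close> have "ennreal (K - f x) + ennreal (f x) = ennreal (K - f x + f x)"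
        by (subst ennreal_plus) auto
      with True show ?thesis by (simp add: ennreal_neg)
    next
      case False
      then have "ennreal K + ennreal (- f x) = ennreal (K + - f x)" using K by (subst ennreal_plus) auto
      with False show ?thesis by (simp add: ennreal_neg)
    qed
  qed
  also have "\<dots> = (\<integral>\<^sup>+x. ennreal K \<partial>M) + N"
    unfolding N_def by (rule nn_integral_add) measurable
  also have "(\<integral>\<^sup>+x. ennreal K \<partial>M) = ennreal K" by (simp add: emeasure_space_1)
  finally have JP: "J + P = ennreal K + N" .
  have "P \<le> (\<integral>\<^sup>+x. ennreal K \<partial>M)" unfolding P_def by (intro nn_integral_mono ennreal_leI le)
  then have "P \<le> ennreal K" by (simp add: emeasure_space_1)
  then have "P < top" by (rule le_less_trans) simp
  then obtain p where p: "P = ennreal p" "0 \<le> p" by (cases P) auto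
  have "ereal b \<le> enn2ereal P - enn2ereal N \<longleftrightarrow> J \<le> ennreal (K - b)"
  proof (cases N)
    case top
    then have "J = top" using JP p by (cases J) auto
    then show ?thesis using top p by (simp add: top_unique enn2ereal_ennreal)
  next
    case (real n)
    then have "J + P < top" using JP by simp
    then obtain j where j: "J = ennreal j" "0 \<le> j" by (cases J) auto
    have "ennreal (j + p) = ennreal (K + n)" using JP p j real K by (simp add: ennreal_plus)
    then have "j + p = K + n" using p j real K by (subst (asm) ennreal_inj) auto
    then show ?thesis using real p j K by (auto simp: enn2ereal_ennreal)
  qed
  then show ?thesis by (simp add: ext_expectation_def J_def P_def N_def)
qed

section \<open>Compactness of randomized stopping times under linear constraints\<close>

context randomized_brownian
begin

text \<open>\<open>\<F> n\<close> lists upper bounds on integrals under the joint law. The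
  conditional distribution functions obeying the list form a set closed under midpoints, so the
  selection lemma applies. The bounds are asserted for the approximants \<open>t n\<close> only: how
  they pass to the limit depends on the integrand.\<close>

lemma rst_compactness:
  fixes \<F> :: "nat \<Rightarrow> (((real \<Rightarrow> real) \<times> real \<Rightarrow> ennreal) \<times> ennreal) set"
  assumes meas: "\<And>n f z. (f, z) \<in> \<F> n \<Longrightarrow> f \<in> borel_measurable CT_borel"
    and inc: "\<And>n. \<F> n \<subseteq> \<F> (Suc n)"
    and ex: "\<And>n. \<exists>\<xi> a. rst \<xi> a \<and> (\<forall>(f, z)\<in>\<F> n. (\<integral>\<^sup>+p. f p \<partial>\<xi>) \<le> z)"
  obtains t \<tau> where
    "\<And>n::nat. t n \<in> borel_measurable M" "\<And>n. AE x in M. t n x < \<infinity>"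
    "\<And>n f z. (f, z) \<in> \<F> n \<Longrightarrow> (\<integral>\<^sup>+x. f (path_of W x, enn2real (t n x)) \<partial>M) \<le> z"
    "AE x in M. (\<lambda>n. t n x) \<longlonglongrightarrow> \<tau> x"
    "\<And>s. 0 \<le> s \<Longrightarrow> {x \<in> space M. \<tau> x < ennreal s} \<in> sets (G (ennreal s))"
    "\<tau> \<in> borel_measurable (vimage_algebra (space M) UW UC_borel)"
proof -
  \<comment> \<open>A probability charging every rational. On its product with \<open>M\<close> a
    single \<open>L\<^sup>2\<close> space holds all rational times, and almost sure convergence
    there means almost sure convergence at each of them.\<close>
  define p :: "rat pmf" where "p = map_pmf from_nat (geometric_pmf (1/2))"
  have set_p: "set_pmf p = UNIV" by (auto simp: p_def set_pmf_geometric)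
  interpret MP: pair_prob_space "measure_pmf p" M ..
  define good where "good n \<xi> \<longleftrightarrow> (\<forall>(f, z)\<in>\<F> n. (\<integral>\<^sup>+q. f q \<partial>\<xi>) \<le> z)" for n \<xi>
  define C where "C n = {(\<lambda>(q, x). a q x) | a. \<exists>\<xi>. rst \<xi> a \<and> good n \<xi>}" for n
  have aM: "a q \<in> borel_measurable M" if "rst \<xi> a" for \<xi> a q
    using measurable_from_subalg[OF subalgebra_past, of "max 0 (of_rat q)" "a q"] that by (simp add: rst_def)
  obtain s where s: "\<And>n. s n \<in> C n" and conv: "AE x in measure_pmf p \<Otimes>\<^sub>M M. convergent (\<lambda>n. s n x)"
  proof (rule MP.midpoint_convex_selection[of C])
    fix n f assume "f \<in> C n"
    then obtain a \<xi> where f: "f = (\<lambda>(q, x). a q x)" and rst: "rst \<xi> a" by (auto simp: C_def)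
    have "(\<lambda>x. f (q, x)) \<in> borel_measurable M" for q using aM[OF rst] by (simp add: f)
    then have "f \<in> borel_measurable (count_space UNIV \<Otimes>\<^sub>M M)"
      by (intro measurable_pair_measure_countable1) auto
    moreover have "sets (measure_pmf p \<Otimes>\<^sub>M M) = sets (count_space UNIV \<Otimes>\<^sub>M M)"
      by (intro sets_pair_measure_cong) auto
    ultimately show "f \<in> borel_measurable (measure_pmf p \<Otimes>\<^sub>M M)"
      using measurable_cong_sets by blast
    show "\<bar>f y\<bar> \<le> 1" for y using rst by (auto simp: f rst_def split: prod.split)
  next
    fix n f g assume "f \<in> C n" "g \<in> C n"
    then obtain a \<xi> b \<zeta> where f: "f = (\<lambda>(q, x). a q x)" and a: "rst \<xi> a" "good n \<xi>"
      and g: "g = (\<lambda>(q, x). b q x)" and b: "rst \<zeta> b" "good n \<zeta>" by (auto simp: C_def)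
    obtain \<eta> where \<eta>: "rst \<eta> (\<lambda>q x. (a q x + b q x) / 2)"
      and nn: "\<And>f. f \<in> borel_measurable CT_borel \<Longrightarrow>
        (\<integral>\<^sup>+p. f p \<partial>\<eta>) = (\<integral>\<^sup>+p. f p \<partial>\<xi>) / 2 + (\<integral>\<^sup>+p. f p \<partial>\<zeta>) / 2"
      using rst_mixture[OF a(1) b(1)] by blast
    have half: "z / 2 + z / 2 = z" for z :: ennreal
    proof (cases z)
      case (real r)
      then have "z / 2 = ennreal (r / 2)" using divide_ennreal[of r 2] by simp
      then show ?thesis using real by (simp flip: ennreal_plus)
    qed (simp add: ennreal_top_divide)
    have "good n \<eta>"
      unfolding good_def
    proof safe
      fix h z assume hz: "(h, z) \<in> \<F> n"
      have "(\<integral>\<^sup>+q. h q \<partial>\<eta>) = (\<integral>\<^sup>+q. h q \<partial>\<xi>) / 2 + (\<integral>\<^sup>+q. h q \<partial>\<zeta>) / 2" by (rule nn[OF meas[OF hz]])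
      also have "\<dots> \<le> z / 2 + z / 2"
        using a(2) b(2) hz by (intro add_mono divide_right_mono_ennreal) (auto simp: good_def)
      finally show "(\<integral>\<^sup>+q. h q \<partial>\<eta>) \<le> z" by (simp add: half)
    qed
    moreover have "(\<lambda>y. (f y + g y) / 2) = (\<lambda>(q, x). (a q x + b q x) / 2)" by (auto simp: f g)
    ultimately show "(\<lambda>y. (f y + g y) / 2) \<in> C n" unfolding C_def using \<eta> by blast
  next
    show "C (Suc n) \<subseteq> C n" for n using inc[of n] by (fastforce simp: C_def good_def)
    show "C n \<noteq> {}" for n using ex[of n] by (auto simp: C_def good_def)
  qed blast
  have "\<exists>a \<xi>. s n = (\<lambda>(q, x). a q x) \<and> rst \<xi> a \<and> good n \<xi>" for n
    using s[of n] by (auto simp: C_def)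
  then obtain a \<xi> where a: "\<And>n. s n = (\<lambda>(q, x). a n q x)" "\<And>n. rst (\<xi> n) (a n)" "\<And>n. good n (\<xi> n)"
    by metis
  have convM: "AE x in M. \<forall>q. convergent (\<lambda>n. a n q x)"
    using MP.AE_pair[OF conv] by (simp add: a(1) AE_measure_pmf_iff set_p AE_all_countable)
  have mono: "AE x in M. \<forall>n q r. q \<le> r \<longrightarrow> a n q x \<le> a n r x"
    unfolding AE_all_countable using rst_mono[OF a(2)] by auto
  \<comment> \<open>\<open>lim\<close> is taken at every outcome, convergent or not, so
    \<open>b q\<close> stays measurable for the past up to \<open>q\<close>, with no null set to
    adjoin.\<close>
  define b where "b q x = lim (\<lambda>n. a n q x)" for q x
  have bp: "b q \<in> borel_measurable (past (max 0 (of_rat q)))" for q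
    unfolding b_def[abs_def] by (rule borel_measurable_lim_metric) (use a(2) in \<open>simp add: rst_def\<close>)
  have neq: "AE x in M. \<forall>q. U x \<noteq> b q x"
    unfolding AE_all_countable using AE_U_neq[OF measurable_past_full[OF _ bp]] by simp
  define t where "t n = quantile (a n)" for n
  note law = quantile_law[OF a(2), folded t_def]
  show ?thesis
  proof (rule that[of t "quantile b"])
    show "t n \<in> borel_measurable M" "AE x in M. t n x < \<infinity>" for n by (rule law)+
    show "AE x in M. (\<lambda>n. t n x) \<longlonglongrightarrow> quantile b x"
      using convM mono neq
      by eventually_elim (auto simp: t_def b_def convergent_LIMSEQ_iff intro!: quantile_tendsto)
    show "(\<integral>\<^sup>+x. f (path_of W x, enn2real (t n x)) \<partial>M) \<le> z" if fz: "(f, z) \<in> \<F> n" for n f z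
    proof -
      note [measurable] = law(1)[of n]
      have "(\<integral>\<^sup>+x. f (path_of W x, enn2real (t n x)) \<partial>M) =
          (\<integral>\<^sup>+q. f q \<partial>distr M CT_borel (\<lambda>x. (path_of W x, enn2real (t n x))))"
        by (rule nn_integral_distr[symmetric]) (use meas[OF fz] in measurable)
      then show ?thesis using a(3)[of n] fz by (auto simp: law(2) good_def)
    qed
    show "{x \<in> space M. quantile b x < ennreal s} \<in> sets (G (ennreal s))" if "0 \<le> s" for s
      by (rule quantile_optional[OF bp that])
    show "quantile b \<in> borel_measurable (vimage_algebra (space M) UW UC_borel)"
      by (rule quantile_UW_measurable[OF bp])
  qed
qed

end

section \<open>Limits of stopping times whose laws converge\<close>

context randomized_brownian
begin

text \<open>\<open>k\<close> stands for the defect \<open>K - c\<close>: upper semicontinuity and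
  bounds from below become lower semicontinuity and bounds from above, the form that Fatou's lemma
  accepts.\<close>

lemma stopping_time_limit:
  fixes k :: "(real \<Rightarrow> real) \<times> real \<Rightarrow> ennreal"
  assumes \<mu>: "\<mu> \<in> P1" and \<nu>: "\<And>n. \<nu> n \<in> P1" and W1: "\<And>n. W1 \<mu> (\<nu> n) < ennreal (1 / real (Suc n))"
    and \<sigma>: "\<And>n. \<sigma> n \<in> stopping_times M G (\<nu> n)"
    and k [measurable]: "k \<in> borel_measurable CT_borel"
    and k_le: "\<And>n. (\<integral>\<^sup>+x. k (path_of W x, enn2real (\<sigma> n x)) \<partial>M) \<le> z"
    and k_lsc: "AE x in M. \<forall>u v. (\<forall>n. 0 \<le> u n) \<longrightarrow> u \<longlonglongrightarrow> v \<longrightarrow>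
      k (path_of W x, v) \<le> liminf (\<lambda>n::nat. k (path_of W x, u n))"
  shows "\<exists>\<tau>\<in>stopping_times M G \<mu>. (\<integral>\<^sup>+x. k (path_of W x, enn2real (\<tau> x)) \<partial>M) \<le> z"
proof -
  \<comment> \<open>A common bound on the means: that of \<open>\<mu>\<close> plus 1, the largest of
    the distances \<open>1/(n+1)\<close>.\<close>
  define m where "m = (\<integral>\<^sup>+x. ennreal x \<partial>\<mu>) + 1"
  have \<mu>': "prob_space \<mu>" "sets \<mu> = sets borel" "AE x in \<mu>. 0 < x" "integrable \<mu> (\<lambda>x. x)"
    using \<mu> by (auto simp: P1_def)
  have m_fin: "m < \<infinity>"
  proof -
    have "(\<integral>\<^sup>+x. ennreal x \<partial>\<mu>) = ennreal (\<integral>x. x \<partial>\<mu>)"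
      by (rule nn_integral_eq_integral[OF \<mu>'(4)]) (use \<mu>'(3) in \<open>auto elim: eventually_mono\<close>)
    then show ?thesis by (simp add: m_def)
  qed
  \<comment> \<open>The law is imposed up to a tolerance: \<open>\<nu> n\<close> meets every
    tolerance \<open>1/(j+1)\<close> with \<open>j \<le> n\<close>, which keeps the lists
    increasing, and each tolerance is in force from some index on.\<close>
  define \<F> where "\<F> n = {(k, z), (\<lambda>p. ennreal (snd p), m)} \<union>
      {(\<lambda>p. ennreal (f (snd p)), (\<integral>\<^sup>+x. ennreal (f x) \<partial>\<mu>) + ennreal (1 / real (Suc j))) | f j. f \<in> Lip1 \<and> j \<le> n}" for n
  have meas: "f \<in> borel_measurable CT_borel" if fy: "(f, y) \<in> \<F> n" for n f y
  proof -
    consider "f = k" "y = z" | "f = (\<lambda>p. ennreal (snd p))" "y = m"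
      | g j where "f = (\<lambda>p. ennreal (g (snd p)))" "y = (\<integral>\<^sup>+x. ennreal (g x) \<partial>\<mu>) + ennreal (1 / real (Suc j))" "g \<in> Lip1" "j \<le> n"
      using fy unfolding \<F>_def by blast
    then show ?thesis
    proof cases
      case 3
      note [measurable] = Lip1_measurable[OF 3(3)]
      show ?thesis unfolding 3(1) by measurable
    qed (simp_all add: k)
  qed
  have ex: "\<exists>\<xi> a. rst \<xi> a \<and> (\<forall>(f, y)\<in>\<F> n. (\<integral>\<^sup>+p. f p \<partial>\<xi>) \<le> y)" for n
  proof -
    define X where "X x = (path_of W x, enn2real (\<sigma> n x))" for x
    have st: "stopping_time G (\<sigma> n)" and law: "distr M borel (\<lambda>x. enn2real (\<sigma> n x)) = \<nu> n"
      using \<sigma>[of n] unfolding stopping_times_def by blast+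
    have \<sigma>m [measurable]: "\<sigma> n \<in> borel_measurable M"
      by (rule measurable_stopping_time[OF st]) (simp_all add: subsetI sets_G_subset)
    have Xm: "X \<in> M \<rightarrow>\<^sub>M CT_borel" unfolding X_def by measurable
    obtain a where a: "rst (distr M CT_borel X) a"
      using rst_of_stopping_time[OF \<sigma> \<nu>] unfolding X_def[abs_def] by blast
    have nn: "(\<integral>\<^sup>+p. f p \<partial>distr M CT_borel X) = (\<integral>\<^sup>+x. f (X x) \<partial>M)" if "(f, y) \<in> \<F> n" for f y
      by (rule nn_integral_distr[OF Xm]) (use meas[OF that] in simp)
    have snd: "(\<integral>\<^sup>+x. ennreal (f (snd (X x))) \<partial>M) = (\<integral>\<^sup>+x. ennreal (f x) \<partial>\<nu> n)"
      if "f \<in> borel_measurable borel" for f :: "real \<Rightarrow> real"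
      unfolding law[symmetric] X_def using that by (subst nn_integral_distr) auto
    have le: "(\<integral>\<^sup>+x. ennreal (f x) \<partial>\<nu> n) \<le> (\<integral>\<^sup>+x. ennreal (f x) \<partial>\<mu>) + ennreal (1 / real (Suc n))"
      if "\<And>x y. \<bar>f x - f y\<bar> \<le> \<bar>x - y\<bar>" for f :: "real \<Rightarrow> real"
      by (rule nn_integral_W1_le[OF W1 that])
    have "(\<integral>\<^sup>+x. f (X x) \<partial>M) \<le> y" if fy: "(f, y) \<in> \<F> n" for f y
    proof -
      consider "f = k" "y = z" | "f = (\<lambda>p. ennreal (snd p))" "y = m"
        | g j where "f = (\<lambda>p. ennreal (g (snd p)))" "y = (\<integral>\<^sup>+x. ennreal (g x) \<partial>\<mu>) + ennreal (1 / real (Suc j))" "g \<in> Lip1" "j \<le> n"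
        using fy unfolding \<F>_def by blast
      then show ?thesis
      proof cases
        case 1
        then show ?thesis using k_le[of n] by (simp add: X_def)
      next
        case 2
        have "(\<integral>\<^sup>+x. ennreal (snd (X x)) \<partial>M) \<le> (\<integral>\<^sup>+x. ennreal x \<partial>\<mu>) + ennreal (1 / real (Suc n))"
          using snd[of "\<lambda>x. x"] le[of "\<lambda>x. x"] by simp
        also have "\<dots> \<le> m" unfolding m_def by (intro add_left_mono) (simp add: ennreal_le_1)
        finally show ?thesis using 2 by simp
      next
        case 3
        have "(\<integral>\<^sup>+x. ennreal (g (snd (X x))) \<partial>M) \<le> (\<integral>\<^sup>+x. ennreal (g x) \<partial>\<mu>) + ennreal (1 / real (Suc n))"
          using snd[OF Lip1_measurable[OF 3(3)]] le[of g] 3(3) by (simp add: Lip1_def)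
        also have "\<dots> \<le> y" unfolding 3(2) using 3(4) by (intro add_left_mono ennreal_leI) (simp add: frac_le)
        finally show ?thesis using 3 by simp
      qed
    qed
    then have "\<forall>(f, y)\<in>\<F> n. (\<integral>\<^sup>+p. f p \<partial>distr M CT_borel X) \<le> y"
      using nn by (intro ballI) (simp add: case_prod_beta' del: nn_integral_distr, metis prod.collapse)
    with a show ?thesis by blast
  qed
  have inc: "\<F> n \<subseteq> \<F> (Suc n)" for n unfolding \<F>_def by (auto intro: le_SucI)
  obtain t \<tau> where tm: "\<And>n::nat. t n \<in> borel_measurable M" and t_fin: "\<And>n. AE x in M. t n x < \<infinity>"
    and t_le: "\<And>n f y. (f, y) \<in> \<F> n \<Longrightarrow> (\<integral>\<^sup>+x. f (path_of W x, enn2real (t n x)) \<partial>M) \<le> y"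
    and t_lim: "AE x in M. (\<lambda>n. t n x) \<longlonglongrightarrow> \<tau> x"
    and \<tau>: "\<And>s. 0 \<le> s \<Longrightarrow> {x \<in> space M. \<tau> x < ennreal s} \<in> sets (G (ennreal s))"
    and \<tau>_UW: "\<tau> \<in> borel_measurable (vimage_algebra (space M) UW UC_borel)"
  proof (rule rst_compactness[of \<F>])
    show "f \<in> borel_measurable CT_borel" if "(f, y) \<in> \<F> n" for n f y by (rule meas[OF that])
    show "\<F> n \<subseteq> \<F> (Suc n)" for n by (rule inc)
    show "\<exists>\<xi> a. rst \<xi> a \<and> (\<forall>(f, y)\<in>\<F> n. (\<integral>\<^sup>+p. f p \<partial>\<xi>) \<le> y)" for n by (rule ex)
  qed blast
  note [measurable] = tm
  have \<tau>m [measurable]: "\<tau> \<in> borel_measurable M" by (rule optional_measurable[OF \<tau>])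
  \<comment> \<open>The first moment prevents mass from escaping to infinity: by Fatou the mean of
    \<open>\<tau>\<close> is at most \<open>m\<close>.\<close>
  have \<tau>_fin: "AE x in M. \<tau> x < \<infinity>"
  proof -
    have le: "(\<integral>\<^sup>+x. t n x \<partial>M) \<le> m" for n
    proof -
      have "(\<integral>\<^sup>+x. t n x \<partial>M) = (\<integral>\<^sup>+x. ennreal (enn2real (t n x)) \<partial>M)"
        by (rule nn_integral_cong_AE) (use t_fin[of n] in \<open>auto elim!: eventually_mono\<close>)
      also have "\<dots> \<le> m" using t_le[of "\<lambda>p. ennreal (snd p)" m n] by (simp add: \<F>_def)
      finally show ?thesis .
    qed
    have "(\<integral>\<^sup>+x. \<tau> x \<partial>M) = (\<integral>\<^sup>+x. liminf (\<lambda>n. t n x) \<partial>M)"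
      by (rule nn_integral_cong_AE) (use t_lim in \<open>auto elim!: eventually_mono simp: lim_imp_Liminf\<close>)
    also have "\<dots> \<le> liminf (\<lambda>n. \<integral>\<^sup>+x. t n x \<partial>M)" by (rule nn_integral_liminf) measurable
    also have "\<dots> \<le> m" by (intro Liminf_le always_eventually allI le) simp
    finally have "(\<integral>\<^sup>+x. \<tau> x \<partial>M) \<noteq> \<infinity>" using m_fin by (auto simp: top_unique)
    from nn_integral_PInf_AE[OF \<tau>m this] show ?thesis by (simp add: less_top)
  qed
  have r_lim: "AE x in M. (\<lambda>n. enn2real (t n x)) \<longlonglongrightarrow> enn2real (\<tau> x)"
    using t_lim \<tau>_fin by eventually_elim (intro tendsto_enn2real, auto simp: less_top)
  have law: "distr M borel (\<lambda>x. enn2real (\<tau> x)) = \<mu>"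
  proof (rule measure_eqI_Lip1)
    show "prob_space (distr M borel (\<lambda>x. enn2real (\<tau> x)))" by (rule prob_space_distr) measurable
    fix f assume f: "f \<in> Lip1"
    note [measurable] = Lip1_measurable[OF f]
    have f01: "0 \<le> f x" "f x \<le> 1" for x using f by (auto simp: Lip1_def)
    have cont: "isCont f x" for x
      unfolding continuous_at_eps_delta dist_real_def using f by (simp add: Lip1_def) (meson le_less_trans)
    \<comment> \<open>For fixed \<open>j\<close> the tolerance holds for all late approximants and
      survives the limit; afterwards \<open>j\<close> tends to infinity.\<close>
    have "(\<integral>x. f (enn2real (\<tau> x)) \<partial>M) \<le> (\<integral>x. f x \<partial>\<mu>) + 1 / real (Suc j)" for j
    proof -
      have "(\<lambda>n. \<integral>x. f (enn2real (t n x)) \<partial>M) \<longlonglongrightarrow> (\<integral>x. f (enn2real (\<tau> x)) \<partial>M)"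
      proof (rule integral_dominated_convergence[where w = "\<lambda>_. 1"])
        show "AE x in M. (\<lambda>n. f (enn2real (t n x))) \<longlonglongrightarrow> f (enn2real (\<tau> x))"
          using r_lim by eventually_elim (rule isCont_tendsto_compose[OF cont])
      qed (use f01 in auto)
      moreover have "(\<integral>x. f (enn2real (t n x)) \<partial>M) \<le> (\<integral>x. f x \<partial>\<mu>) + 1 / real (Suc j)" if "j \<le> n" for n
      proof -
        interpret \<mu>: prob_space \<mu> by fact
        have f\<mu>: "integrable \<mu> f"
          using Lip1_measurable[OF f] f01
          by (intro \<mu>.integrable_const_bound[where B = 1]) (auto simp: measurable_cong_sets[OF \<mu>'(2) refl])
        have "ennreal (\<integral>x. f (enn2real (t n x)) \<partial>M) = (\<integral>\<^sup>+x. ennreal (f (enn2real (t n x))) \<partial>M)"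
          by (rule nn_integral_eq_integral[symmetric], rule integrable_const_bound[where B = 1]) (use f01 in auto)
        also have "\<dots> \<le> (\<integral>\<^sup>+x. ennreal (f x) \<partial>\<mu>) + ennreal (1 / real (Suc j))"
          using t_le[of "\<lambda>p. ennreal (f (snd p))" "(\<integral>\<^sup>+x. ennreal (f x) \<partial>\<mu>) + ennreal (1 / real (Suc j))" n] f that
          unfolding \<F>_def by auto
        also have "(\<integral>\<^sup>+x. ennreal (f x) \<partial>\<mu>) = ennreal (\<integral>x. f x \<partial>\<mu>)"
          by (rule nn_integral_eq_integral[OF f\<mu>]) (use f01 in auto)
        also have "ennreal (\<integral>x. f x \<partial>\<mu>) + ennreal (1 / real (Suc j)) = ennreal ((\<integral>x. f x \<partial>\<mu>) + 1 / real (Suc j))"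
          using f01 by (intro ennreal_plus[symmetric] Bochner_Integration.integral_nonneg) auto
        finally show ?thesis
          using f01 by (subst (asm) ennreal_le_iff) (auto intro!: add_nonneg_nonneg Bochner_Integration.integral_nonneg)
      qed
      ultimately show ?thesis by (intro LIMSEQ_le_const2) auto
    qed
    moreover have "(\<lambda>j. (\<integral>x. f x \<partial>\<mu>) + 1 / real (Suc j)) \<longlonglongrightarrow> (\<integral>x. f x \<partial>\<mu>) + 0"
      by (intro tendsto_add tendsto_const LIMSEQ_Suc[OF lim_1_over_n])
    ultimately have "(\<integral>x. f (enn2real (\<tau> x)) \<partial>M) \<le> (\<integral>x. f x \<partial>\<mu>) + 0"
      by (intro LIMSEQ_le_const) auto
    then show "(\<integral>x. f x \<partial>distr M borel (\<lambda>x. enn2real (\<tau> x))) \<le> (\<integral>x. f x \<partial>\<mu>)"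
      by (simp add: integral_distr)
  qed (use \<mu>' in auto)
  have \<tau>_real: "(\<lambda>x. enn2real (\<tau> x)) \<in> borel_measurable M" by measurable
  \<comment> \<open>Positivity is read off from the limit law \<open>\<mu>\<close>, since positive
    times may converge to 0.\<close>
  have \<tau>_pos: "AE x in M. 0 < \<tau> x"
  proof -
    have "AE x in M. 0 < enn2real (\<tau> x)"
    proof (rule AE_distrD[OF \<tau>_real])
      show "AE s in distr M borel (\<lambda>x. enn2real (\<tau> x)). 0 < s" unfolding law by (rule \<mu>'(3))
    qed
    then show ?thesis by eventually_elim (simp add: enn2real_positive_iff)
  qed
  have "\<exists>F. pointwise_continuous F \<and> (\<integral>x. \<bar>F (U x, path_of W x) - (1 - exp (- enn2real (\<tau> x)))\<bar> \<partial>M) < e" if "0 < e" for e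
    using that by (intro approx_UW) (use \<tau>_UW in auto)
  from predictable_modification[OF \<tau> \<tau>_pos \<tau>_fin this] obtain \<rho> where \<rho>: "stopping_time G \<rho>" "AE x in M. \<rho> x = \<tau> x"
    by blast
  have \<rho>m [measurable]: "\<rho> \<in> borel_measurable M"
    by (rule measurable_stopping_time[OF \<rho>(1)]) (simp_all add: subsetI sets_G_subset)
  have "distr M borel (\<lambda>x. enn2real (\<rho> x)) = distr M borel (\<lambda>x. enn2real (\<tau> x))"
    by (rule distr_cong_AE) (use \<rho>(2) in \<open>auto elim: eventually_mono\<close>)
  then have "\<rho> \<in> stopping_times M G \<mu>"
    unfolding stopping_times_def using \<rho> \<tau>_fin law by (auto elim: eventually_elim2)
  moreover have "(\<integral>\<^sup>+x. k (path_of W x, enn2real (\<rho> x)) \<partial>M) \<le> z"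
  proof -
    have "(\<integral>\<^sup>+x. k (path_of W x, enn2real (\<rho> x)) \<partial>M) \<le> (\<integral>\<^sup>+x. liminf (\<lambda>n. k (path_of W x, enn2real (t n x))) \<partial>M)"
    proof (rule nn_integral_mono_AE)
      show "AE x in M. k (path_of W x, enn2real (\<rho> x)) \<le> liminf (\<lambda>n. k (path_of W x, enn2real (t n x)))"
        using \<rho>(2) r_lim k_lsc by eventually_elim simp
    qed
    also have "\<dots> \<le> liminf (\<lambda>n. \<integral>\<^sup>+x. k (path_of W x, enn2real (t n x)) \<partial>M)"
      by (rule nn_integral_liminf) measurable
    also have "\<dots> \<le> z" by (intro Liminf_le always_eventually allI t_le) (simp_all add: \<F>_def)
    finally show ?thesis .
  qed
  ultimately show ?thesis by blast
qed

end

section \<open>Upper semicontinuity of the value\<close>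

theorem proposition2p1:
  fixes M :: "'a measure" and G :: "ennreal \<Rightarrow> 'a measure"
    and W :: "real \<Rightarrow> 'a \<Rightarrow> real" and U :: "'a \<Rightarrow> real"
    and c :: "(real \<Rightarrow> real) \<Rightarrow> real \<Rightarrow> real"
  assumes "filtered_prob_space M G"
    and "brownian_motion M G W"
    and "uniform_independent M G W U"
    and c_measurable:
      "(\<lambda>(w, t). c w t) \<in> borel_measurable (C0_borel \<Otimes>\<^sub>M restrict_space borel {0..})"
    and c_adapted: "\<forall>w\<in>C0. \<forall>t\<ge>0. c w t = c (stopped t w) t"
    and well_defined: "\<forall>\<mu>\<in>P1. \<forall>\<tau>\<in>stopping_times M G \<mu>.
      expectation_defined M (cost W c \<tau>) \<and> ext_expectation M (cost W c \<tau>) < \<infinity>"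
    and nontrivial: "\<forall>\<mu>\<in>P1. \<exists>\<tau>\<in>stopping_times M G \<mu>. ext_expectation M (cost W c \<tau>) > -\<infinity>"
    and c_bounded_above: "\<exists>K. \<forall>w\<in>C0. \<forall>t\<ge>0. c w t \<le> K"
    and c_usc: "AE w in wiener_measure M W.
      usc_on (top_of_set {0..}) (\<lambda>t. ereal (c (stopped t w) t))"
  shows "usc_on W1_topology (stopping_value M G W c)"
proof -
  interpret randomized_brownian M G W U
    using assms(1-3) by (simp add: randomized_brownian_def randomized_brownian_axioms_def filtered_prob_space_def)
  have "\<exists>e>0. \<forall>\<nu>\<in>P1. W1 \<mu> \<nu> < ennreal e \<longrightarrow> stopping_value M G W c \<nu> < a"
    if \<mu>: "\<mu> \<in> P1" and a: "stopping_value M G W c \<mu> < a" for \<mu> a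
  proof (rule ccontr)
    assume not: "\<not> ?thesis"
    obtain b where b: "stopping_value M G W c \<mu> < ereal b" "ereal b < a"
      using ereal_dense2[OF a] by blast
    obtain K0 where K0: "\<And>w t. w \<in> C0 \<Longrightarrow> 0 \<le> t \<Longrightarrow> c w t \<le> K0" using c_bounded_above by blast
    \<comment> \<open>Above the cost, so that \<open>K - c\<close> is nonnegative; above
      \<open>b\<close> and 0, so that \<open>ennreal\<close> truncates neither \<open>K - b\<close>
      nor \<open>K\<close>.\<close>
    define K where "K = max 0 (max b K0)"
    have K: "0 \<le> K" "b \<le> K" "\<And>w t. w \<in> C0 \<Longrightarrow> 0 \<le> t \<Longrightarrow> c w t \<le> K"
      using K0 by (auto simp: K_def le_max_iff_disj)
    \<comment> \<open>\<open>c\<close> is measurable on nonnegative times only; \<open>max 0\<close>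
      extends it to the whole line without changing its value at
      \<open>enn2real (\<tau> x)\<close>.\<close>
    define k where "k p = ennreal (K - c (fst p) (max 0 (snd p)))" for p
    have k_cost: "ennreal (K - cost W c \<tau> x) = k (path_of W x, enn2real (\<tau> x))" for \<tau> x
      by (simp add: k_def cost_def)
    have value_iff: "ereal b \<le> ext_expectation M (cost W c \<tau>) \<longleftrightarrow>
        (\<integral>\<^sup>+x. k (path_of W x, enn2real (\<tau> x)) \<partial>M) \<le> ennreal (K - b)"
      if "\<tau> \<in> stopping_times M G \<nu>" "\<nu> \<in> P1" for \<tau> \<nu>
      unfolding k_cost[symmetric]
    proof (rule le_ext_expectation_iff)
      show "cost W c \<tau> \<in> borel_measurable M" using well_defined that by (auto simp: expectation_defined_def)
      show "cost W c \<tau> x \<le> K" if "x \<in> space M" for x using that by (simp add: cost_def K(3))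
    qed (use K in auto)
    \<comment> \<open>Failure of the claim at radius \<open>1/(n+1)\<close> gives a law of value at
      least \<open>a\<close>, and \<open>b < a\<close> leaves room for a stopping time beating
      \<open>b\<close>.\<close>
    have "\<exists>\<nu> \<tau>. \<nu> \<in> P1 \<and> W1 \<mu> \<nu> < ennreal (1 / real (Suc n)) \<and> \<tau> \<in> stopping_times M G \<nu> \<and>
        ereal b < ext_expectation M (cost W c \<tau>)" for n
    proof -
      have "0 < 1 / real (Suc n)" by simp
      with not obtain \<nu> where \<nu>: "\<nu> \<in> P1" "W1 \<mu> \<nu> < ennreal (1 / real (Suc n))" "\<not> stopping_value M G W c \<nu> < a"
        by blast
      then have "ereal b < stopping_value M G W c \<nu>" using b(2) by simp
      with \<nu> show ?thesis unfolding stopping_value_def less_SUP_iff by blast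
    qed
    then obtain \<nu> \<sigma> where \<nu>: "\<And>n. \<nu> n \<in> P1" "\<And>n. W1 \<mu> (\<nu> n) < ennreal (1 / real (Suc n))"
      and \<sigma>: "\<And>n. \<sigma> n \<in> stopping_times M G (\<nu> n)" "\<And>n. ereal b < ext_expectation M (cost W c (\<sigma> n))"
      by metis
    have k_meas: "k \<in> borel_measurable CT_borel"
    proof -
      have [measurable]: "(\<lambda>p. max 0 (snd p)) \<in> CT_borel \<rightarrow>\<^sub>M restrict_space borel {0 :: real..}"
        by (rule measurable_restrict_space2) auto
      have "(\<lambda>p. (fst p, max 0 (snd p))) \<in> CT_borel \<rightarrow>\<^sub>M C0_borel \<Otimes>\<^sub>M restrict_space borel {0 :: real..}"
        by measurable
      from measurable_compose[OF this c_measurable]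
      have "(\<lambda>p. c (fst p) (max 0 (snd p))) \<in> borel_measurable CT_borel" by simp
      then show ?thesis unfolding k_def by measurable
    qed
    \<comment> \<open>The assumption concerns \<open>c (stopped t w) t\<close>, which adaptedness of
      \<open>c\<close> identifies with \<open>c w t\<close>; subtraction from \<open>K\<close> turns
      it into lower semicontinuity along sequences.\<close>
    have k_lsc: "AE x in M. \<forall>u v. (\<forall>n. 0 \<le> u n) \<longrightarrow> u \<longlonglongrightarrow> v \<longrightarrow>
        k (path_of W x, v) \<le> liminf (\<lambda>n::nat. k (path_of W x, u n))"
      using AE_distrD[OF path_measurable c_usc[unfolded wiener_measure_def]] AE_space
    proof eventually_elim
      case (elim x)
      define w where "w = path_of W x"
      have w: "w \<in> C0" using elim by (simp add: w_def)
      have usc: "usc_on (top_of_set {0..}) (\<lambda>t. ereal (c (stopped t w) t))"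
        using elim(1) by (simp add: w_def)
      show ?case
        unfolding w_def[symmetric]
      proof (intro allI impI)
        fix u :: "nat \<Rightarrow> real" and v assume u: "\<forall>n. 0 \<le> u n" "u \<longlonglongrightarrow> v"
        have v: "0 \<le> v" using u by (intro LIMSEQ_le_const[OF u(2)]) auto
        show "k (w, v) \<le> liminf (\<lambda>n. k (w, u n))"
          unfolding le_Liminf_iff
        proof (intro allI impI)
          fix y assume y: "y < k (w, v)"
          define r where "r = enn2real y"
          have r: "y = ennreal r" "0 \<le> r" using y unfolding r_def by (cases y; auto)+
          have "r < K - c w v" using y r v by (simp add: k_def ennreal_less_iff max_absorb2)
          then have less: "ereal (c (stopped v w) v) < ereal (K - r)" using c_adapted w v by simp
          have "v \<in> topspace (top_of_set {0..})" using v by simp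
          from usc[unfolded usc_on_def, rule_format, OF this less] obtain V where V: "openin (top_of_set {0..}) V" "v \<in> V"
            "\<And>s. s \<in> V \<Longrightarrow> ereal (c (stopped s w) s) < ereal (K - r)"
            by blast
          then obtain T where T: "open T" "V = {0..} \<inter> T" by (auto simp: openin_open)
          have "\<forall>\<^sub>F n in sequentially. u n \<in> T"
            by (rule topological_tendstoD[OF u(2) T(1)]) (use V T in auto)
          then show "\<forall>\<^sub>F n in sequentially. y < k (w, u n)"
          proof eventually_elim
            case (elim n)
            then have "c (stopped (u n) w) (u n) < K - r" using V(3)[of "u n"] u T by simp
            then have "r < K - c w (u n)" using c_adapted w u by simp
            then show ?case using r u by (simp add: k_def ennreal_less_iff max_absorb2)
          qed
        qed
      qed
    qed
    have "\<exists>\<tau>\<in>stopping_times M G \<mu>. (\<integral>\<^sup>+x. k (path_of W x, enn2real (\<tau> x)) \<partial>M) \<le> ennreal (K - b)"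
    proof (rule stopping_time_limit[OF \<mu> \<nu> \<sigma>(1) k_meas _ k_lsc])
      show "(\<integral>\<^sup>+x. k (path_of W x, enn2real (\<sigma> n x)) \<partial>M) \<le> ennreal (K - b)" for n
        using value_iff[OF \<sigma>(1)[of n] \<nu>(1)[of n]] \<sigma>(2)[of n] less_imp_le by blast
    qed
    then obtain \<tau> where \<tau>: "\<tau> \<in> stopping_times M G \<mu>" "ereal b \<le> ext_expectation M (cost W c \<tau>)"
      using value_iff[OF _ \<mu>] by blast
    then have "ereal b \<le> stopping_value M G W c \<mu>"
      unfolding stopping_value_def by (meson SUP_upper order_trans)
    with b(1) show False by simp
  qed
  note nbhd = this
  show ?thesis
    unfolding usc_on_def topspace_W1_topology openin_W1_topology
  proof (intro ballI allI impI)
    fix \<mu> a assume \<mu>: "\<mu> \<in> P1" and a: "stopping_value M G W c \<mu> < a"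
    \<comment> \<open>The strict sublevel set is itself the neighbourhood: it is open because
      \<open>nbhd\<close> applies at each of its points.\<close>
    show "\<exists>V. W1_open V \<and> \<mu> \<in> V \<and> (\<forall>\<nu>\<in>V. stopping_value M G W c \<nu> < a)"
      using \<mu> a nbhd
      by (intro exI[of _ "{\<nu> \<in> P1. stopping_value M G W c \<nu> < a}"]) (auto simp: W1_open_def)
  qed
qed

end
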